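(* Let $X\subset\mathbb{R}^2$ be a real algebraic curve and $x\in X$ an algebraic singular point with local branch parametrized, in Euclidean coordinates with $x$ at the origin and the $x_1$-axis along the tangent line, by $$x_1(t)=t^p,\qquad x_2(t)=c\,t^q+\sigma_{q+1}(t),\qquad q>p\ge 2,\ c>0,$$ and let $\rho=\frac{q}{2p}$. (1) The normal line $N_x$ is contained in the discriminant $\Delta_{tED}$ if - $p$ and $q$ are odd and $\rho<1$, or - $x$ is a geometric singular point (i.e. $p$ is even). (2) The limit of the focal set (as $t\to0$) is - the point $u=x$ if $\rho<1$; - the finite focal point $u\neq x$ on $N_x$ if $\rho=1$; - the infinite point on $N_x$ if $\rho>1$. (3) In detail, for the contribution of this branch: the following list says whether $N=N_x$ is contained in the discriminant, and gives the change of the numbers of local maxima ($M$) and local minima ($m$) of $\mathbb{D}_u$ near $x$ when $u_2\neq 0$ (not the focal point) is fixed and $u_1$ passes through $0$ (where, depending on the sign of $u_2$, sometimes the roles of $m$ and $M$ have to be interchanged): - $p$ odd, $q$ odd, $\rho<1$: $N$ is contained; $M+m\leftrightarrow\emptyset$. - $p$ odd, $q$ odd, $\rho>1$: $N$ is not contained; $m$ or $M$ persists. - $p$ odd, $q$ even, $\rho<1$, $\rho=1$ or $\rho>1$: $N$ is not contained; $m$ or $M$ persists. - $p$ even, $q$ odd, $\rho<1$: $N$ is contained; $M+m\leftrightarrow M+m$. - $p$ even, $q$ odd, $\rho>1$: $N$ is contained; $m\leftrightarrow 2m+M$. - $p$ even, $q$ even, $\rho<1$, $\rho=1$ or $\rho>1$: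 $N$ is contained; $2M+m\leftrightarrow M$. In all cases the focal point on $N$ is $x$ if $\rho<1$, a finite point $\ne x$ of $N$ if $\rho=1$, and there is none if $\rho>1$.
   Context: $X$ is a reduced real algebraic curve $\Phi=0$ all of whose local branches are real and $1$-dimensional; an algebraic singular point is a point of $X$ with $\nabla\Phi=0$. $\sigma_{q+1}$ is a real convergent power series with all terms of degree $>q$; the parametrization is injective near $t=0$. $\mathbb{D}_u(y)=|y-u|^2$ for $y\in X$, considered on the normalization of $X$ (as a function of the parameter on each branch). $N_x=\{u_1=0\}$ is the line through $x$ orthogonal to the tangent line of the branch. Topological critical points of $\mathbb{D}_u$ are local maxima and minima on the normalization; elsewhere $\mathbb{D}_u$ is topologically regular (locally homeomorphic to a linear function). The topological type of $\mathbb{D}_u$ is determined by the numbers of maxima and minima on each normalized branch. A point $u\in\mathbb{R}^2$ is topologically stable if there is a neighborhood $U$ of $u$ such that for all $v\in U$ the functions $\mathbb{D}_v$ and $\mathbb{D}_u$ are topologically equivalent; $\Delta_{tED}$ is the complement of the set of stable points. In (3), "contained / not contained" refers to the discriminant of the germ of the branch at $x$, i.e. stability of the local type of $\mathbb{D}_u$ near $t=0$. A focal point on a normal line is a point $u$ of it where the local type of $\mathbb{D}_u$ at the base point is different from the generic types on that normal line, equivalently the center of the best-tangent circle; at a smooth $C^2$ point of non-zero curvature it is the center of curvature. The focal set near $x$ consists of the focal points on the normal lines at the points with parameter $t\ne0$ near $0$, and its limit is taken as $t\to 0$; "the infinite point on $N_x$" means that the focal points tend to infinity asymptotically to $N_x$.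 *)

theory Defs
  imports "HOL-Analysis.Analysis" "HOL-Computational_Algebra.Computational_Algebra"
begin

section \<open>Plane algebraic curves\<close>

text \<open>A polynomial in two variables is an element of \<open>R[X][Y]\<close>; the inner variable is
  the first coordinate.\<close>

definition poly2 :: "'a::comm_ring_1 poly poly \<Rightarrow> 'a \<times> 'a \<Rightarrow> 'a"
  where "poly2 \<Phi> y = poly (poly \<Phi> [:snd y:]) (fst y)"

definition curve :: "real poly poly \<Rightarrow> (real \<times> real) set"
  where "curve \<Phi> = {y. poly2 \<Phi> y = 0}"

definition algebraic_singular_points :: "real poly poly \<Rightarrow> (real \<times> real) set"
  where "algebraic_singular_points \<Phi> =
    {y \<in> curve \<Phi>. (poly2 \<Phi> has_derivative (\<lambda>_. 0)) (at y)}"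

section \<open>Local branches and the normalization\<close>

definition analytic_arc :: "(real \<Rightarrow> real \<times> real) \<Rightarrow> bool"
  where "analytic_arc \<gamma> \<longleftrightarrow>
    (\<exists>F. (\<lambda>t. fst (\<gamma> t)) has_fps_expansion F) \<and> (\<exists>G. (\<lambda>t. snd (\<gamma> t)) has_fps_expansion G)"

definition injective_near_0 :: "(real \<Rightarrow> 'a) \<Rightarrow> bool"
  where "injective_near_0 \<gamma> \<longleftrightarrow> (\<exists>r>0. inj_on \<gamma> {-r<..<r})"

definition branch_param :: "(real \<times> real) set \<Rightarrow> (real \<Rightarrow> real \<times> real) \<Rightarrow> bool"
  where "branch_param X \<gamma> \<longleftrightarrow>
    analytic_arc \<gamma> \<and> injective_near_0 \<gamma> \<and> (\<forall>\<^sub>F t in nhds 0. \<gamma> t \<in> X)"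

text \<open>The complex local branch with parametrization \<open>(\<alpha>, \<beta>)\<close> is the germ at the
  origin of its image.  It is real and one-dimensional if it contains a real branch: the
  complex conjugate branch then shares infinitely many points with it, and so equals it.\<close>

definition all_branches_real :: "real poly poly \<Rightarrow> bool"
  where "all_branches_real \<Phi> \<longleftrightarrow>
    (\<forall>(\<alpha>::complex \<Rightarrow> complex) \<beta> y. \<alpha> analytic_on {0} \<and> \<beta> analytic_on {0} \<and>
       \<alpha> 0 = of_real (fst y) \<and> \<beta> 0 = of_real (snd y) \<and>
       (\<exists>\<^sub>F z in at 0. (\<alpha> z, \<beta> z) \<noteq> (\<alpha> 0, \<beta> 0)) \<and>
       (\<forall>\<^sub>F z in nhds 0. poly2 (map_poly (map_poly of_real) \<Phi>) (\<alpha> z, \<beta> z) = 0) \<longrightarrow>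
       (\<exists>\<delta>. branch_param (curve \<Phi>) \<delta> \<and> \<delta> 0 = y \<and>
          (\<forall>r>0. \<forall>\<^sub>F t in nhds 0. \<exists>z\<in>ball 0 r.
             (\<alpha> z, \<beta> z) = (of_real (fst (\<delta> t)), of_real (snd (\<delta> t))))))"

text \<open>A point of the normalization is a local branch of the curve, i.e. the germ of the
  image of a parametrization, encoded as the image of the neighbourhood filter: two
  parametrizations of the same branch have the same image filter.  The centre of the
  branch is the limit of the filter.\<close>

definition branch_germ :: "(real \<Rightarrow> real \<times> real) \<Rightarrow> real \<Rightarrow> (real \<times> real) filter"
  where "branch_germ \<gamma> s = filtermap \<gamma> (nhds s)"

definition branches :: "(real \<times> real) set \<Rightarrow> (real \<times> real) filter set"
  where "branches X = {branch_germ \<gamma> 0 |\<gamma>. branch_param X \<gamma>}"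

definition centre :: "(real \<times> real) filter \<Rightarrow> real \<times> real"
  where "centre P = Lim P (\<lambda>y. y)"

text \<open>The finest topology for which every parametrized branch, lifted to the
  normalization, is continuous at its base point; the lifted parametrizations are its charts.\<close>

definition normalization :: "(real \<times> real) set \<Rightarrow> (real \<times> real) filter topology"
  where "normalization X = topology (\<lambda>W. W \<subseteq> branches X \<and>
    (\<forall>\<gamma>. branch_param X \<gamma> \<and> branch_germ \<gamma> 0 \<in> W \<longrightarrow> (\<forall>\<^sub>F s in nhds 0. branch_germ \<gamma> s \<in> W)))"

lemma openin_normalization:
  "openin (normalization X) W \<longleftrightarrow> W \<subseteq> branches X \<and>
    (\<forall>\<gamma>. branch_param X \<gamma> \<and> branch_germ \<gamma> 0 \<in> W \<longrightarrow> (\<forall>\<^sub>F s in nhds 0. branch_germ \<gamma> s \<in> W))"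
proof -
  have "istopology (\<lambda>W. W \<subseteq> branches X \<and>
    (\<forall>\<gamma>. branch_param X \<gamma> \<and> branch_germ \<gamma> 0 \<in> W \<longrightarrow> (\<forall>\<^sub>F s in nhds 0. branch_germ \<gamma> s \<in> W)))"
    (is "istopology ?L")
    unfolding istopology_def
  proof (intro conjI allI impI)
    fix S T assume "?L S" "?L T"
    then show "S \<inter> T \<subseteq> branches X" by blast
    show "\<forall>\<^sub>F s in nhds 0. branch_germ \<gamma> s \<in> S \<inter> T"
      if "branch_param X \<gamma> \<and> branch_germ \<gamma> 0 \<in> S \<inter> T" for \<gamma>
      using \<open>?L S\<close> \<open>?L T\<close> that by (simp add: eventually_conj)
  next
    fix K assume K: "\<forall>S\<in>K. ?L S"
    then show "\<Union>K \<subseteq> branches X" by blast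
    show "\<forall>\<^sub>F s in nhds 0. branch_germ \<gamma> s \<in> \<Union>K"
      if \<gamma>: "branch_param X \<gamma> \<and> branch_germ \<gamma> 0 \<in> \<Union>K" for \<gamma>
    proof -
      obtain S where "S \<in> K" "branch_germ \<gamma> 0 \<in> S" using \<gamma> by blast
      with K \<gamma> have "\<forall>\<^sub>F s in nhds 0. branch_germ \<gamma> s \<in> S" by blast
      then show ?thesis by eventually_elim (use \<open>S \<in> K\<close> in blast)
    qed
  qed
  then show ?thesis by (simp add: normalization_def)
qed

section \<open>The distance function and topological stability\<close>

definition sqdist :: "real \<times> real \<Rightarrow> real \<times> real \<Rightarrow> real"
  where "sqdist u y = (dist y u)\<^sup>2"

definition local_maxima :: "'a topology \<Rightarrow> ('a \<Rightarrow> real) \<Rightarrow> 'a set"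
  where "local_maxima T f = {P. \<exists>W. openin T W \<and> P \<in> W \<and> (\<forall>Q\<in>W. f Q \<le> f P)}"

definition local_minima :: "'a topology \<Rightarrow> ('a \<Rightarrow> real) \<Rightarrow> 'a set"
  where "local_minima T f = {P. \<exists>W. openin T W \<and> P \<in> W \<and> (\<forall>Q\<in>W. f P \<le> f Q)}"

text \<open>The topological type of a function on a one-dimensional manifold \<open>T\<close> records the
  numbers of its local maxima and minima on each connected component.  Equipollence is used
  since a distance function that is constant on a circle has infinitely many of both.\<close>

definition top_equivalent :: "'a topology \<Rightarrow> ('a \<Rightarrow> real) \<Rightarrow> ('a \<Rightarrow> real) \<Rightarrow> bool"
  where "top_equivalent T f g \<longleftrightarrow>
    (\<forall>C\<in>connected_components_of T.
       local_maxima T f \<inter> C \<approx> local_maxima T g \<inter> C \<and>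
       local_minima T f \<inter> C \<approx> local_minima T g \<inter> C)"

definition top_stable :: "real poly poly \<Rightarrow> real \<times> real \<Rightarrow> bool"
  where "top_stable \<Phi> u \<longleftrightarrow>
    (\<exists>U. open U \<and> u \<in> U \<and> (\<forall>v\<in>U. top_equivalent (normalization (curve \<Phi>))
       (\<lambda>P. sqdist v (centre P)) (\<lambda>P. sqdist u (centre P))))"

definition tED_discriminant :: "real poly poly \<Rightarrow> (real \<times> real) set"
  where "tED_discriminant \<Phi> = {u. \<not> top_stable \<Phi> u}"

text \<open>Stability of the local type near the base point of a single parametrized branch, and
  the discriminant of the branch germ.  The order of the quantifiers, first a small interval
  of parameters and then a smaller neighbourhood of \<open>u\<close>, keeps critical points from
  entering through the ends of the interval.\<close>

definition germ_stable :: "(real \<Rightarrow> real \<times> real) \<Rightarrow> real \<times> real \<Rightarrow> bool"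
  where "germ_stable \<gamma> u \<longleftrightarrow>
    (\<forall>\<^sub>F \<epsilon> in at_right 0. \<exists>U. open U \<and> u \<in> U \<and>
       (\<forall>v\<in>U. top_equivalent (top_of_set {-\<epsilon><..<\<epsilon>})
          (\<lambda>t. sqdist v (\<gamma> t)) (\<lambda>t. sqdist u (\<gamma> t))))"

definition germ_discriminant :: "(real \<Rightarrow> real \<times> real) \<Rightarrow> (real \<times> real) set"
  where "germ_discriminant \<gamma> = {u. \<not> germ_stable \<gamma> u}"

section \<open>Focal points\<close>

definition normal_line :: "real \<times> real \<Rightarrow> real \<times> real \<Rightarrow> (real \<times> real) set"
  where "normal_line y d = {u. (u - y) \<bullet> d = 0}"

text \<open>The order to which the circle with centre \<open>u\<close> through the base point touches the
  branch there (\<open>\<infinity>\<close> if the branch lies on the circle).\<close>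

definition contact_order :: "(real \<Rightarrow> real \<times> real) \<Rightarrow> real \<Rightarrow> real \<times> real \<Rightarrow> enat"
  where "contact_order \<gamma> t u =
    Inf (enat ` {k. 1 \<le> k \<and> (deriv ^^ k) (\<lambda>s. sqdist u (\<gamma> s)) t \<noteq> 0})"

text \<open>The points of the normal line at \<open>\<gamma> t\<close> (with \<open>d\<close> a tangent vector) whose local type
  differs from the generic types, the generic types being those attained at infinitely many
  points of the line.  The local type of the distance function along the branch is its
  type up to analytic change of the parameter and sign, i.e. the contact order.  The
  topological type would not detect centres of curvature at vertices of a smooth curve.\<close>

definition focal_points :: "(real \<Rightarrow> real \<times> real) \<Rightarrow> real \<Rightarrow> real \<times> real \<Rightarrow> (real \<times> real) set"
  where "focal_points \<gamma> t d =
    {u \<in> normal_line (\<gamma> t) d.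
       finite {w \<in> normal_line (\<gamma> t) d. contact_order \<gamma> t w = contact_order \<gamma> t u}}"

section \<open>Change of the numbers of local extrema\<close>

text \<open>The pair consists of the number of maxima and the number of minima.\<close>

definition has_extrema ::
    "(real \<Rightarrow> real \<times> real) \<Rightarrow> real \<Rightarrow> real \<times> real \<Rightarrow> nat \<times> nat \<Rightarrow> bool"
  where "has_extrema \<gamma> \<epsilon> u n \<longleftrightarrow>
    (let T = top_of_set {-\<epsilon><..<\<epsilon>}; f = (\<lambda>t. sqdist u (\<gamma> t))
     in finite (local_maxima T f) \<and> card (local_maxima T f) = fst n \<and>
        finite (local_minima T f) \<and> card (local_minima T f) = snd n)"

text \<open>In the following, \<open>h\<close> is a path of centres that meets the normal line at parameter 0.\<close>

definition passes ::
    "(real \<Rightarrow> real \<times> real) \<Rightarrow> (real \<Rightarrow> real \<times> real) \<Rightarrow> nat \<times> nat \<Rightarrow> nat \<times> nat \<Rightarrow> bool"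
  where "passes \<gamma> h n n' \<longleftrightarrow>
    (\<forall>\<^sub>F \<epsilon> in at_right 0.
       (\<forall>\<^sub>F a in at_left 0. has_extrema \<gamma> \<epsilon> (h a) n) \<and>
       (\<forall>\<^sub>F a in at_right 0. has_extrema \<gamma> \<epsilon> (h a) n'))"

definition changes ::
    "(real \<Rightarrow> real \<times> real) \<Rightarrow> (real \<Rightarrow> real \<times> real) \<Rightarrow> nat \<times> nat \<Rightarrow> nat \<times> nat \<Rightarrow> bool"
  where "changes \<gamma> h n n' \<longleftrightarrow> passes \<gamma> h n n' \<or> passes \<gamma> h n' n"

definition persists ::
    "(real \<Rightarrow> real \<times> real) \<Rightarrow> (real \<Rightarrow> real \<times> real) \<Rightarrow> nat \<times> nat \<Rightarrow> bool"
  where "persists \<gamma> h n \<longleftrightarrow>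
    (\<forall>\<^sub>F \<epsilon> in at_right 0. \<forall>\<^sub>F a in nhds 0. has_extrema \<gamma> \<epsilon> (h a) n)"

end

theory Submission
  imports Defs "HOL-Complex_Analysis.Complex_Analysis" "HOL-Computational_Algebra.Field_as_Ring"
begin

text \<open>
  For the centre with coordinates \<open>(a, b)\<close> the squared distance along the branch has derivative
  \<open>2 t\<^sup>p\<^sup>-\<^sup>1 (G b t - p a)\<close> with \<open>G b t = p t\<^sup>p + t\<^sup>q\<^sup>-\<^sup>p Y t (y t - b)\<close>. Its leading term \<open>k t\<^sup>m\<close>, with
  \<open>m = min p (q - p)\<close> away from the focal point, is monotone on both sides of 0, so the zeros of the
  derivative for small \<open>a\<close>, and hence the numbers of extrema, depend only on the parities of \<open>p\<close>
  and \<open>m\<close> and on the signs of \<open>k\<close> and \<open>a\<close>. When \<open>p\<close> or \<open>m\<close> is even, one sign of \<open>a\<close> has a local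
  maximum more than \<open>a = 0\<close>.

  For the global discriminant such a gain could only be compensated by a loss elsewhere on the same
  component of the normalization. There is none: by elimination the component carries finitely many
  extrema, all strict because the distance is not constant on it, and a strict maximum survives
  perturbation of the centre. Perturbed maxima stay distinct since different branches with the same
  centre have no other common points near it.
\<close>

text \<open>Three obstacles shape the argument. A point of the normalization is an image filter and
  not a parametrization, so branches with accumulating common points must be shown to have equal
  germs; the power normal forms serve this. Branches may be singular where the distance has an
  extremum, so extrema are confined without smoothness: near a point where
  \<open>(\<Psi>, Q)\<close> is injective, \<open>Q\<close> is injective on the branch and has no
  extremum. Finally, all of the normal line is claimed, including the focal point, where the
  expected leading coefficient \<open>K b\<close> vanishes. For even \<open>p\<close> this does no
  harm: either parity of \<open>m\<close> yields one more maximum, and injectivity of the branch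
  ensures that some leading term exists. For odd \<open>p\<close>, odd \<open>q\<close> and
  \<open>q < 2 * p\<close> the focal point is \<open>x\<close>, where \<open>G 0\<close> has the odd
  order \<open>p\<close> and moving \<open>a\<close> alone creates nothing; there the centre first
  moves along the normal line to a point where the order \<open>q - p\<close> is even. Conversely,
  one stable point shows that the line is not contained in the discriminant of the germ, but it must
  withstand perturbations of both coordinates; monotonicity of \<open>G b\<close> uniform in
  \<open>b\<close> provides this.\<close>

section \<open>Real-analytic functions of one variable\<close>

text \<open>Analyticity is expressed by a holomorphic extension that is real on the real axis, so
  that composition, derivatives, inverses and roots can be taken from complex analysis.\<close>

definition real_analytic_at :: "(real \<Rightarrow> real) \<Rightarrow> real \<Rightarrow> bool"
  where "real_analytic_at f s \<longleftrightarrow> (\<exists>g. g analytic_on {of_real s} \<and>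
    (\<forall>\<^sub>F t in nhds s. g (of_real t) = complex_of_real (f t)))"

lemma real_analytic_cong:
  assumes "real_analytic_at f s" "\<forall>\<^sub>F t in nhds s. f t = f' t"
  shows "real_analytic_at f' s"
proof -
  obtain g where g: "g analytic_on {of_real s}" "\<forall>\<^sub>F t in nhds s. g (of_real t) = complex_of_real (f t)"
    using assms(1) by (auto simp: real_analytic_at_def)
  have "\<forall>\<^sub>F t in nhds s. g (of_real t) = complex_of_real (f' t)"
    using g(2) assms(2) by eventually_elim simp
  with g(1) show ?thesis by (auto simp: real_analytic_at_def)
qed

lemma real_analytic_const [simp, intro]: "real_analytic_at (\<lambda>_. c) s"
  unfolding real_analytic_at_def by (rule exI[of _ "\<lambda>_. of_real c"]) auto

lemma real_analytic_ident [simp, intro]: "real_analytic_at (\<lambda>t. t) s"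
  unfolding real_analytic_at_def by (rule exI[of _ "\<lambda>t. t"]) auto

lemma real_analytic_add [intro]: assumes "real_analytic_at f s" "real_analytic_at g s" shows "real_analytic_at (\<lambda>t. f t + g t) s"
proof -
  obtain F G where "F analytic_on {of_real s}" "\<forall>\<^sub>F t in nhds s. F (of_real t) = complex_of_real (f t)"
    and "G analytic_on {of_real s}" "\<forall>\<^sub>F t in nhds s. G (of_real t) = complex_of_real (g t)"
    using assms by (auto simp: real_analytic_at_def)
  then show ?thesis unfolding real_analytic_at_def
    by (intro exI[of _ "\<lambda>z. F z + G z"] conjI analytic_on_add) (auto elim: eventually_elim2)
qed

lemma real_analytic_mult [intro]: assumes "real_analytic_at f s" "real_analytic_at g s" shows "real_analytic_at (\<lambda>t. f t * g t) s"
proof -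
  obtain F G where "F analytic_on {of_real s}" "\<forall>\<^sub>F t in nhds s. F (of_real t) = complex_of_real (f t)"
    and "G analytic_on {of_real s}" "\<forall>\<^sub>F t in nhds s. G (of_real t) = complex_of_real (g t)"
    using assms by (auto simp: real_analytic_at_def)
  then show ?thesis unfolding real_analytic_at_def
    by (intro exI[of _ "\<lambda>z. F z * G z"] conjI analytic_on_mult) (auto elim: eventually_elim2)
qed

lemma real_analytic_diff [intro]: assumes "real_analytic_at f s" "real_analytic_at g s" shows "real_analytic_at (\<lambda>t. f t - g t) s"
  using real_analytic_add[OF assms(1) real_analytic_mult[OF real_analytic_const[of "-1"] assms(2)]] by simp

lemma real_analytic_power [intro]: "real_analytic_at f s \<Longrightarrow> real_analytic_at (\<lambda>t. f t ^ n) s"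
  by (induction n) auto

lemma real_analytic_isCont: assumes "real_analytic_at f s" shows "isCont f s"
proof -
  obtain g where g: "g analytic_on {of_real s}" "\<forall>\<^sub>F t in nhds s. g (of_real t) = complex_of_real (f t)"
    using assms(1) by (auto simp: real_analytic_at_def)
  have "isCont g (of_real s)" using g(1) by (rule analytic_at_imp_isCont)
  then have "isCont (\<lambda>t. g (of_real t)) s"
    by (intro isCont_o2[where g=g and f=complex_of_real] isCont_of_real[OF continuous_ident])
  then have "isCont (\<lambda>t. Re (g (of_real t))) s" by (rule isCont_Re)
  moreover have "\<forall>\<^sub>F t in nhds s. Re (g (of_real t)) = f t"
    using g(2) by eventually_elim simp
  ultimately show ?thesis using isCont_cong[of "\<lambda>t. Re (g (of_real t))" f s] by blast
qed

lemma real_analytic_compose: assumes "real_analytic_at f s" "real_analytic_at k (f s)" shows "real_analytic_at (\<lambda>t. k (f t)) s"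
proof -
  obtain g where g: "g analytic_on {of_real s}" "\<forall>\<^sub>F t in nhds s. g (of_real t) = complex_of_real (f t)"
    using assms(1) by (auto simp: real_analytic_at_def)
  obtain h where h: "h analytic_on {of_real (f s)}"
      "\<forall>\<^sub>F t in nhds (f s). h (of_real t) = complex_of_real (k t)"
    using assms(2) by (auto simp: real_analytic_at_def)
  have s: "g (of_real s) = of_real (f s)" using eventually_nhds_x_imp_x[OF g(2)] .
  have "filterlim f (nhds (f s)) (nhds s)"
    using real_analytic_isCont[OF assms(1)] by (simp add: isCont_def tendsto_at_iff_tendsto_nhds)
  then have "\<forall>\<^sub>F t in nhds s. h (of_real (f t)) = complex_of_real (k (f t))"
    using h(2) by (auto simp: filterlim_iff)
  with g(2) have "\<forall>\<^sub>F t in nhds s. (h \<circ> g) (of_real t) = complex_of_real (k (f t))"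
    by eventually_elim simp
  moreover have "(h \<circ> g) analytic_on {of_real s}"
    by (rule analytic_on_compose) (use g h s in auto)
  ultimately show ?thesis unfolding real_analytic_at_def by blast
qed

lemma real_analytic_eventually: assumes "real_analytic_at f s" shows "\<forall>\<^sub>F s' in nhds s. real_analytic_at f s'"
proof -
  obtain g where g: "g analytic_on {of_real s}" "\<forall>\<^sub>F t in nhds s. g (of_real t) = complex_of_real (f t)"
    using assms(1) by (auto simp: real_analytic_at_def)
  obtain e where e: "e > 0" "g holomorphic_on ball (of_real s) e"
    using g(1) by (auto simp: analytic_on_def)
  have "\<forall>\<^sub>F t in nhds s. dist t s < e" using e(1) by (auto simp: eventually_nhds_metric)
  then show ?thesis
    using iffD2[OF eventually_eventually g(2)]
  proof eventually_elim
    case (elim t)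
    have "complex_of_real t \<in> ball (of_real s) e"
      using elim(1) by (simp add: dist_commute dist_of_real)
    then have "g analytic_on {of_real t}"
      using e(2) by (meson analytic_on_open analytic_on_subset bot_least insert_subset open_ball)
    with elim(2) show ?case unfolding real_analytic_at_def by blast
  qed
qed

text \<open>The derivative of the holomorphic extension is again holomorphic, and it is real on the
  real axis because the extension is.\<close>

lemma real_analytic_deriv:
  assumes "real_analytic_at f s"
  shows "\<exists>f'. real_analytic_at f' s \<and> (\<forall>\<^sub>F t in nhds s. (f has_real_derivative f' t) (at t))"
proof -
  obtain g where g: "g analytic_on {of_real s}" "\<forall>\<^sub>F t in nhds s. g (of_real t) = complex_of_real (f t)"
    using assms(1) by (auto simp: real_analytic_at_def)
  obtain e where e: "e > 0" "g holomorphic_on ball (of_real s) e"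
    using g(1) by (auto simp: analytic_on_def)
  have "\<forall>\<^sub>F t in nhds s. dist t s < e" using e(1) by (auto simp: eventually_nhds_metric)
  then have *: "\<forall>\<^sub>F t in nhds s. deriv g (of_real t) = of_real (Re (deriv g (of_real t))) \<and>
     (f has_real_derivative Re (deriv g (of_real t))) (at t)"
    using iffD2[OF eventually_eventually g(2)]
  proof eventually_elim
    case (elim t)
    have "complex_of_real t \<in> ball (of_real s) e"
      using elim(1) by (simp add: dist_commute dist_of_real)
    then have "(g has_field_derivative deriv g (of_real t)) (at (of_real t))"
      using e(2) by (meson holomorphic_derivI open_ball)
    then have v: "((\<lambda>x. g (of_real x)) has_vector_derivative deriv g (of_real t)) (at t)"
      by (rule has_vector_derivative_real_field)
    have "((\<lambda>x. Im (g (of_real x))) has_vector_derivative Im (deriv g (of_real t))) (at t)"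
      by (rule bounded_linear.has_vector_derivative[OF bounded_linear_Im v])
    then have i: "((\<lambda>x. Im (g (of_real x))) has_real_derivative Im (deriv g (of_real t))) (at t)"
      by (simp add: has_real_derivative_iff_has_vector_derivative)
    \<comment> \<open>The imaginary part of \<open>g\<close> vanishes on the real axis near
      \<open>t\<close>, so its derivative along that axis is 0.\<close>
    have "((\<lambda>x. 0) has_real_derivative Im (deriv g (of_real t))) (at t)"
      by (subst DERIV_cong_ev[OF refl _ refl, where g="\<lambda>x. Im (g (of_real x))"])
         (use elim(2) i in \<open>auto elim!: eventually_mono\<close>)
    then have "Im (deriv g (of_real t)) = 0" using DERIV_unique DERIV_const by blast
    moreover have "((\<lambda>x. Re (g (of_real x))) has_vector_derivative Re (deriv g (of_real t))) (at t)"
      by (rule bounded_linear.has_vector_derivative[OF bounded_linear_Re v])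
    then have i: "((\<lambda>x. Re (g (of_real x))) has_real_derivative Re (deriv g (of_real t))) (at t)"
      by (simp add: has_real_derivative_iff_has_vector_derivative)
    have "(f has_real_derivative Re (deriv g (of_real t))) (at t)"
      by (subst DERIV_cong_ev[OF refl _ refl, where g="\<lambda>x. Re (g (of_real x))"])
         (use elim(2) i in \<open>auto elim!: eventually_mono\<close>)
    ultimately show ?case by (simp add: complex_eq_iff)
  qed
  have "real_analytic_at (\<lambda>t. Re (deriv g (of_real t))) s"
    unfolding real_analytic_at_def
    by (rule exI[of _ "deriv g"]) (use * analytic_deriv[OF g(1)] in \<open>auto elim!: eventually_mono\<close>)
  with * show ?thesis by (intro exI[of _ "\<lambda>t. Re (deriv g (of_real t))"]) (auto elim!: eventually_mono)
qed

lemma has_fps_expansion_imp_real_analytic: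
  assumes "f has_fps_expansion F" shows "real_analytic_at f 0"
proof -
  define G where "G = Abs_fps (\<lambda>n. complex_of_real (fps_nth F n))"
  have R: "fps_conv_radius F > 0" and ev: "\<forall>\<^sub>F z in nhds 0. eval_fps F z = f z"
    using assms by (auto simp: has_fps_expansion_def)
  have G: "fps_conv_radius G = fps_conv_radius F"
    unfolding fps_conv_radius_def by (rule conv_radius_cong) (auto simp: G_def)
  have eq: "eval_fps G (of_real t) = of_real (eval_fps F t)" if "ereal (norm t) < fps_conv_radius F" for t
  proof -
    have "summable (\<lambda>n. fps_nth F n * t ^ n)"
      using that by (rule summable_fps)
    from suminf_of_real[OF this, where 'a=complex] show ?thesis
      by (simp add: eval_fps_def G_def)
  qed
  have "\<forall>\<^sub>F t in nhds 0. t \<in> eball (0::real) (fps_conv_radius F)"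
    using R by (intro eventually_nhds_in_open) (auto simp: zero_ereal_def)
  then have "\<forall>\<^sub>F t in nhds 0. eval_fps G (of_real t) = of_real (f t)"
    using ev by eventually_elim (auto simp: eq in_eball_iff)
  moreover have "eval_fps G analytic_on {of_real 0}"
    using R G by (intro analytic_intros) (auto simp: zero_ereal_def)
  ultimately show ?thesis unfolding real_analytic_at_def by blast
qed

text \<open>Real parts of the complex coefficients suffice: the extension takes real values on the
  axis, and the radius of convergence does not shrink.\<close>

lemma real_analytic_imp_has_fps_expansion:
  assumes "real_analytic_at f s" shows "\<exists>F. (\<lambda>t. f (s + t)) has_fps_expansion F"
proof -
  have "real_analytic_at (\<lambda>t. f (s + t)) 0"
    using real_analytic_compose[of "\<lambda>t. s + t" 0 f] real_analytic_add[OF real_analytic_const real_analytic_ident] assms by simp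
  then obtain g where g: "g analytic_on {0}"
     "\<forall>\<^sub>F t in nhds 0. g (of_real t) = complex_of_real (f (s + t))"
    by (auto simp: real_analytic_at_def)
  obtain G where G: "g has_fps_expansion G"
    using analytic_at_imp_has_fps_expansion_0[OF g(1)] by blast
  define F where "F = Abs_fps (\<lambda>n. Re (fps_nth G n))"
  have R: "fps_conv_radius G > 0" and ev: "\<forall>\<^sub>F z in nhds 0. eval_fps G z = g z"
    using G by (auto simp: has_fps_expansion_def)
  have F: "fps_conv_radius F \<ge> fps_conv_radius G"
    unfolding fps_conv_radius_def[of F]
  proof (rule conv_radius_geI_ex')
    fix r :: real assume r: "0 < r" "ereal r < fps_conv_radius G"
    then have "summable (\<lambda>n. fps_nth G n * (of_real r) ^ n)" by (intro summable_fps) auto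
    from bounded_linear.summable[OF bounded_linear_Re this]
    show "summable (\<lambda>n. fps_nth F n * of_real r ^ n)" by (simp add: F_def flip: of_real_power)
  qed
  have eq: "eval_fps F t = Re (eval_fps G (of_real t))" if "ereal (norm t) < fps_conv_radius G" for t
  proof -
    have "summable (\<lambda>n. fps_nth G n * (of_real t) ^ n)"
      using that by (intro summable_fps) auto
    from bounded_linear.suminf[OF bounded_linear_Re this] show ?thesis
      by (simp add: eval_fps_def F_def flip: of_real_power)
  qed
  have "\<forall>\<^sub>F t in nhds 0. t \<in> eball (0::real) (fps_conv_radius G)"
    using R by (intro eventually_nhds_in_open) (auto simp: zero_ereal_def)
  moreover have "filterlim complex_of_real (nhds 0) (nhds 0)"
    using tendsto_of_real[OF filterlim_ident, of "0::real", where ?'a=complex] by simp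
  then have "\<forall>\<^sub>F t in nhds 0. eval_fps G (of_real t) = g (complex_of_real t)"
    using ev by (auto simp: filterlim_iff)
  ultimately have "\<forall>\<^sub>F t in nhds 0. eval_fps F t = f (s + t)"
    using g(2) by eventually_elim (auto simp: eq in_eball_iff)
  then have "(\<lambda>t. f (s + t)) has_fps_expansion F"
    using R F by (auto simp: has_fps_expansion_def)
  then show ?thesis by blast
qed

text \<open>The exponent is the subdegree of the expansion, which is nonzero because
  \<open>f\<close> does not vanish near 0; shifting by it leaves a series with nonzero constant
  term.\<close>

lemma real_analytic_factor:
  assumes "real_analytic_at f 0" and nz: "\<not> (\<forall>\<^sub>F t in nhds 0. f t = 0)"
  obtains m h where "real_analytic_at h 0" "h 0 \<noteq> 0" "\<forall>\<^sub>F t in nhds 0. f t = t ^ m * h t"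
proof -
  obtain F where F: "f has_fps_expansion F"
    using real_analytic_imp_has_fps_expansion[OF assms(1)] by auto
  have R: "fps_conv_radius F > 0" and ev: "\<forall>\<^sub>F z in nhds 0. eval_fps F z = f z"
    using F by (auto simp: has_fps_expansion_def)
  have "F \<noteq> 0" using ev nz by auto
  define m where "m = subdegree F"
  define h where "h = eval_fps (fps_shift m F)"
  have "h has_fps_expansion fps_shift m F"
    unfolding h_def by (rule eval_fps_has_fps_expansion) (use R in auto)
  then have "real_analytic_at h 0" by (rule has_fps_expansion_imp_real_analytic)
  moreover have "h 0 \<noteq> 0" using \<open>F \<noteq> 0\<close> by (simp add: h_def eval_fps_at_0 m_def)
  moreover have "\<forall>\<^sub>F t in nhds 0. t \<in> eball (0::real) (fps_conv_radius F)"
    using R by (intro eventually_nhds_in_open) (auto simp: zero_ereal_def)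
  then have "\<forall>\<^sub>F t in nhds 0. f t = t ^ m * h t"
    using ev
  proof eventually_elim
    case (elim t)
    have "eval_fps F t = eval_fps (fps_shift m F * fps_X ^ m) t"
      unfolding m_def by (rule arg_cong[OF subdegree_decompose])
    also have "\<dots> = h t * t ^ m"
      using elim by (subst eval_fps_mult) (auto simp: h_def in_eball_iff)
    finally show ?case using elim by simp
  qed
  ultimately show ?thesis using that by blast
qed

lemma real_analytic_isolated_zeros:
  assumes "real_analytic_at f 0" "\<not> (\<forall>\<^sub>F t in nhds 0. f t = 0)"
  shows "\<forall>\<^sub>F t in at 0. f t \<noteq> 0"
proof -
  obtain m h where h: "real_analytic_at h 0" "h 0 \<noteq> 0" "\<forall>\<^sub>F t in nhds 0. f t = t ^ m * h t"
    by (rule real_analytic_factor[OF assms])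
  have "\<forall>\<^sub>F t in nhds 0. h t \<noteq> 0"
    using real_analytic_isCont[OF h(1)] h(2)
    by (auto simp: isCont_def tendsto_at_iff_tendsto_nhds intro: tendsto_imp_eventually_ne)
  with h(3) have "\<forall>\<^sub>F t in nhds 0. t \<noteq> 0 \<longrightarrow> f t \<noteq> 0"
    by eventually_elim simp
  then show ?thesis by (simp add: eventually_at_filter)
qed

section \<open>Arcs that share infinitely many points\<close>

lemma isCont_imp_tendsto_nhds: "isCont f a \<Longrightarrow> f a = b \<Longrightarrow> filterlim f (nhds b) (nhds a)"
  by (metis isCont_def tendsto_at_iff_tendsto_nhds)

text \<open>The holomorphic extension has a holomorphic local inverse. What needs an argument is
  that this inverse is real at real points.\<close>

lemma real_analytic_local_inverse:
  assumes "real_analytic_at \<xi> 0" "\<xi> 0 = 0" "(\<xi> has_real_derivative d) (at 0)" "d \<noteq> 0"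
  shows "\<exists>\<psi>. real_analytic_at \<psi> 0 \<and> \<psi> 0 = 0 \<and> (\<forall>\<^sub>F z in nhds 0. \<xi> (\<psi> z) = z) \<and> (\<forall>\<^sub>F s in nhds 0. \<psi> (\<xi> s) = s)"
proof -
  obtain g where g: "g analytic_on {0}" "\<forall>\<^sub>F t in nhds 0. g (of_real t) = complex_of_real (\<xi> t)"
    using assms(1) by (auto simp: real_analytic_at_def)
  obtain e where e: "e > 0" "g holomorphic_on ball 0 e"
    using g(1) by (auto simp: analytic_on_def)
  have "(g has_field_derivative deriv g (of_real 0)) (at (of_real 0))"
    using e by (metis centre_in_ball holomorphic_derivI of_real_0 open_ball)
  then have "((\<lambda>x. g (of_real x)) has_vector_derivative deriv g 0) (at 0)"
    by (metis has_vector_derivative_real_field of_real_0)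
  moreover have "((\<lambda>x. of_real (\<xi> x)) has_vector_derivative complex_of_real d) (at 0)"
    using assms(3) by (rule has_vector_derivative_of_real[unfolded has_real_derivative_iff_has_vector_derivative[symmetric]])
  moreover have "((\<lambda>x. g (of_real x)) has_vector_derivative complex_of_real d) (at 0)"
  proof -
    have "((\<lambda>x. g (of_real x)) has_vector_derivative complex_of_real d) (at 0) \<longleftrightarrow>
       ((\<lambda>x. complex_of_real (\<xi> x)) has_vector_derivative complex_of_real d) (at 0)"
      by (rule has_vector_derivative_cong_ev) (use g(2) eventually_nhds_x_imp_x[OF g(2)] in auto)
    with calculation(2) show ?thesis by simp
  qed
  ultimately have "deriv g 0 = of_real d"
    using vector_derivative_unique_at by blast
  then have d: "deriv g 0 \<noteq> 0" using assms(4) by simp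
  obtain r where r: "r > 0" "ball 0 r \<subseteq> (ball 0 e :: complex set)" "open (g ` ball 0 r)" "inj_on g (ball 0 r)"
    using e(1) by (auto intro: has_complex_derivative_locally_invertible[OF e(2) _ _ d])
  obtain k where k: "k holomorphic_on (g ` ball 0 r)" "\<And>z. z \<in> ball 0 r \<Longrightarrow> k (g z) = z"
    using holomorphic_has_inverse[of g "ball 0 r"] r e holomorphic_on_subset by (metis open_ball)
  define \<psi> where "\<psi> = (\<lambda>z. Re (k (of_real z)))"
  have "\<forall>\<^sub>F t in nhds 0. isCont \<xi> t \<and> g (of_real t) = complex_of_real (\<xi> t)"
    using real_analytic_eventually[OF assms(1)] g(2) by eventually_elim (simp add: real_analytic_isCont)
  then obtain r0 where r0: "r0 > 0" "\<And>t. dist t 0 < r0 \<Longrightarrow> isCont \<xi> t \<and> g (of_real t) = complex_of_real (\<xi> t)"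
    by (auto simp: eventually_nhds_metric)
  define I where "I = ball (0::real) (min r r0)"
  have I: "open I" "0 \<in> I" using r r0 by (auto simp: I_def)
  have gI: "g (of_real t) = complex_of_real (\<xi> t)" "isCont \<xi> t" "complex_of_real t \<in> ball 0 r" if "t \<in> I" for t
    using r0(2)[of t] that by (auto simp: I_def)
  have kI: "k (of_real (\<xi> t)) = of_real t" if "t \<in> I" for t
    using k(2)[of "of_real t"] gI[OF that] by simp
  have "inj_on \<xi> I"
    by (rule inj_onI) (metis kI of_real_eq_iff)
  then have oI: "open (\<xi> ` I)"
    using gI by (intro invariance_of_domain continuous_at_imp_continuous_on I) auto
  have "0 \<in> \<xi> ` I" using assms(2) I by force
  with oI have ev: "\<forall>\<^sub>F z in nhds 0. z \<in> \<xi> ` I" by (rule eventually_nhds_in_open)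
  have "0 \<in> g ` ball 0 r" using gI(1,3)[OF I(2)] assms(2) by force
  then have "k analytic_on {0}"
    using k(1) r(3) by (meson analytic_on_open analytic_on_subset bot_least insert_subset)
  moreover have "\<forall>\<^sub>F z in nhds 0. k (of_real z) = of_real (\<psi> z)"
    using ev by eventually_elim (auto simp: kI \<psi>_def)
  ultimately have "real_analytic_at \<psi> 0" unfolding real_analytic_at_def by auto
  moreover have "\<forall>\<^sub>F z in nhds 0. \<xi> (\<psi> z) = z"
    using ev by eventually_elim (auto simp: kI \<psi>_def)
  moreover have "\<forall>\<^sub>F s in nhds 0. \<psi> (\<xi> s) = s"
    using eventually_nhds_in_open[OF I] by eventually_elim (auto simp: kI \<psi>_def)
  moreover have "\<psi> 0 = 0" using kI[OF I(2)] assms(2) by (simp add: \<psi>_def)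
  ultimately show ?thesis by blast
qed

lemma real_analytic_tendsto: "real_analytic_at f s \<Longrightarrow> filterlim f (nhds (f s)) (nhds s)"
  using real_analytic_isCont by (metis isCont_def tendsto_at_iff_tendsto_nhds)

text \<open>For changes of parameter: composing a parametrization with \<open>\<psi>\<close> leaves
  its image filter, and hence the branch, unchanged.\<close>

lemma filtermap_nhds_local_inverse:
  fixes \<psi> \<xi> :: "real \<Rightarrow> real"
  assumes "filterlim \<psi> (nhds b) (nhds a)" "filterlim \<xi> (nhds a) (nhds b)" "\<forall>\<^sub>F s in nhds b. \<psi> (\<xi> s) = s"
  shows "filtermap \<psi> (nhds a) = nhds b"
proof (rule antisym)
  show "filtermap \<psi> (nhds a) \<le> nhds b" using assms(1) by (simp add: filterlim_def)
  show "nhds b \<le> filtermap \<psi> (nhds a)"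
  proof (rule filter_leI)
    fix P assume "eventually P (filtermap \<psi> (nhds a))"
    then have "\<forall>\<^sub>F s in nhds b. P (\<psi> (\<xi> s))"
      using assms(2) by (auto simp: eventually_filtermap filterlim_iff)
    with assms(3) show "eventually P (nhds b)" by eventually_elim simp
  qed
qed

text \<open>After \<open>f t = t ^ m * h t\<close>, an \<open>m\<close>-th root of
  \<open>\<bar>h\<bar>\<close> is absorbed into the new parameter \<open>\<xi> t = t * R t\<close>.
  The sign of \<open>h 0\<close> has to stay outside, since it has no real root for even
  \<open>m\<close>.\<close>

lemma real_analytic_power_normal_form:
  assumes "real_analytic_at f 0" "f 0 = 0" "\<not> (\<forall>\<^sub>F t in nhds 0. f t = 0)"
  shows "\<exists>p \<epsilon> \<psi> \<xi>. p \<ge> 1 \<and> \<epsilon> \<noteq> 0 \<and> real_analytic_at \<psi> 0 \<and> real_analytic_at \<xi> 0 \<and> \<psi> 0 = 0 \<and> \<xi> 0 = 0 \<and>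
    (\<forall>\<^sub>F z in nhds 0. \<xi> (\<psi> z) = z) \<and> (\<forall>\<^sub>F s in nhds 0. \<psi> (\<xi> s) = s) \<and>
    (\<forall>\<^sub>F z in nhds 0. f (\<psi> z) = sgn \<epsilon> * z ^ p)"
proof -
  obtain m h where h: "real_analytic_at h 0" "h 0 \<noteq> 0" "\<forall>\<^sub>F t in nhds 0. f t = t ^ m * h t"
    using assms(1,3) by (rule real_analytic_factor)
  have m: "m \<ge> 1"
    using eventually_nhds_x_imp_x[OF h(3)] assms(2) h(2) by (cases m) auto
  define \<epsilon> where "\<epsilon> = sgn (h 0)"
  have \<epsilon>: "\<epsilon> * h 0 > 0" "\<epsilon> * \<epsilon> = 1" "\<epsilon> \<noteq> 0" "sgn \<epsilon> = \<epsilon>" using h(2) by (auto simp: \<epsilon>_def sgn_if)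
  obtain g where g: "g analytic_on {0}" "\<forall>\<^sub>F t in nhds 0. g (of_real t) = complex_of_real (h t)"
    using h(1) by (auto simp: real_analytic_at_def)
  have g0: "g 0 = of_real (h 0)" using eventually_nhds_x_imp_x[OF g(2)] by simp
  define R where "R = (\<lambda>t. exp (ln (\<epsilon> * h t) / m))"
  have pos: "\<forall>\<^sub>F t in nhds 0. \<epsilon> * h t > 0"
    using real_analytic_tendsto[OF real_analytic_mult[OF real_analytic_const h(1)], of \<epsilon>] \<epsilon>(1) by (rule order_tendstoD(1))
  \<comment> \<open>The factor \<open>\<epsilon>\<close> makes the argument positive at 0, away from
    the branch cut of \<open>Ln\<close>.\<close>
  have "(\<lambda>z. exp (Ln (of_real \<epsilon> * g z) / m)) analytic_on {0}"
    using g(1) \<epsilon>(1) m by (intro analytic_intros) (auto simp: g0 complex_nonpos_Reals_iff)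
  moreover have "\<forall>\<^sub>F t in nhds 0. exp (Ln (of_real \<epsilon> * g (of_real t)) / m) = of_real (R t)"
    using g(2) pos
  proof eventually_elim
    case (elim t)
    have "Ln (of_real \<epsilon> * g (of_real t)) = of_real (ln (\<epsilon> * h t))"
      using elim by (simp add: Ln_of_real flip: of_real_mult)
    then show ?case by (simp add: R_def flip: exp_of_real)
  qed
  ultimately have R: "real_analytic_at R 0" unfolding real_analytic_at_def by auto
  have Rm: "\<forall>\<^sub>F t in nhds 0. R t ^ m = \<epsilon> * h t"
    using pos by eventually_elim (use m in \<open>simp add: R_def flip: exp_of_nat_mult\<close>)
  define \<xi> where "\<xi> = (\<lambda>t. t * R t)"
  have \<xi>: "real_analytic_at \<xi> 0" unfolding \<xi>_def using R by (intro real_analytic_mult real_analytic_ident)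
  have der: "(\<xi> has_real_derivative R 0) (at 0)"
  proof -
    have "((\<lambda>t. \<xi> t / t) \<longlongrightarrow> R 0) (at 0)"
      using real_analytic_isCont[OF R, unfolded isCont_def]
      by (rule tendsto_cong[THEN iffD1, rotated]) (auto simp: \<xi>_def eventually_at_filter)
    then show ?thesis by (simp add: DERIV_def \<xi>_def)
  qed
  then obtain \<psi> where \<psi>: "real_analytic_at \<psi> 0" "\<psi> 0 = 0" "\<forall>\<^sub>F z in nhds 0. \<xi> (\<psi> z) = z" "\<forall>\<^sub>F s in nhds 0. \<psi> (\<xi> s) = s"
    using real_analytic_local_inverse[OF \<xi> _ der] by (auto simp: \<xi>_def R_def)
  have "\<forall>\<^sub>F t in nhds 0. f t = \<epsilon> * \<xi> t ^ m"
    using h(3) Rm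
  proof eventually_elim
    case (elim t)
    have "\<epsilon> * \<xi> t ^ m = t ^ m * (\<epsilon> * R t ^ m)" by (simp add: \<xi>_def power_mult_distrib)
    also have "\<dots> = t ^ m * ((\<epsilon> * \<epsilon>) * h t)" using elim by simp
    finally show ?case using elim \<epsilon> by simp
  qed
  moreover have "filterlim \<psi> (nhds 0) (nhds 0)" using real_analytic_tendsto[OF \<psi>(1)] \<psi>(2) by simp
  ultimately have "\<forall>\<^sub>F z in nhds 0. f (\<psi> z) = \<epsilon> * \<xi> (\<psi> z) ^ m" by (auto simp: filterlim_iff)
  with \<psi>(3) have "\<forall>\<^sub>F z in nhds 0. f (\<psi> z) = sgn \<epsilon> * z ^ m" by eventually_elim (simp add: \<epsilon>)
  then show ?thesis using \<psi> \<xi> m \<epsilon> by (intro exI[of _ m] exI[of _ \<epsilon>] exI[of _ \<psi>] exI[of _ \<xi>]) (auto simp: \<xi>_def)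
qed

lemma filtermap_eventually_cong:
  assumes "\<forall>\<^sub>F x in F. f x = g x" shows "filtermap f F = filtermap g F"
  unfolding filter_eq_iff eventually_filtermap
  by (intro allI eventually_subst) (use assms in \<open>auto elim!: eventually_mono\<close>)

text \<open>Odd powers are homeomorphisms of the line, inverted by the real root; an even power
  would only yield a one-sided neighbourhood.\<close>

lemma filtermap_nhds_odd_power:
  fixes \<alpha> :: real
  assumes "odd n" "\<alpha> \<noteq> 0"
  shows "filtermap (\<lambda>\<theta>. \<alpha> * \<theta> ^ n) (nhds 0) = nhds 0"
proof (rule filtermap_nhds_local_inverse[where \<xi>="\<lambda>s. root n (s / \<alpha>)"])
  have n: "n > 0" using assms(1) by (rule odd_pos)
  show "filterlim (\<lambda>\<theta>. \<alpha> * \<theta> ^ n) (nhds 0) (nhds 0)"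
    using n by (intro isCont_imp_tendsto_nhds) auto
  have "isCont (\<lambda>s. root n (s / \<alpha>)) 0"
    using assms(2) by (intro isCont_o2[OF _ isCont_real_root]) auto
  then show "filterlim (\<lambda>s. root n (s / \<alpha>)) (nhds 0) (nhds 0)"
    using n by (intro isCont_imp_tendsto_nhds) auto
  show "\<forall>\<^sub>F s in nhds 0. \<alpha> * root n (s / \<alpha>) ^ n = s"
    using assms by (simp add: odd_real_root_pow)
qed

text \<open>If one exponent were even and the other odd, then \<open>\<theta>\<close> and
  \<open>- \<theta>\<close> would give the same point through the even one and distinct parameters
  through the odd one, against injectivity. Coprimality excludes two even exponents, so both powers
  are homeomorphisms and the image filters agree.\<close>

lemma coprime_powers_share_germ:
  fixes \<Gamma> \<Delta> :: "real \<Rightarrow> real \<times> real"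
  assumes "coprime n m" "n > 0" "m > 0" "\<alpha> \<noteq> 0" "\<beta> \<noteq> 0"
    and "injective_near_0 \<Gamma>" "injective_near_0 \<Delta>"
    and eq: "\<forall>\<^sub>F \<theta> in nhds 0. \<Gamma> (\<alpha> * \<theta> ^ n) = \<Delta> (\<beta> * \<theta> ^ m)"
  shows "filtermap \<Gamma> (nhds 0) = filtermap \<Delta> (nhds 0)"
proof -
  have small: "\<forall>\<^sub>F \<theta> in nhds 0. \<bar>k * \<theta> ^ j\<bar> < r" if "r > 0" "j > 0" for k r :: real and j
  proof -
    have "filterlim (\<lambda>\<theta>. \<bar>k * \<theta> ^ j\<bar>) (nhds 0) (nhds 0)"
      using that by (intro isCont_imp_tendsto_nhds) auto
    from this that(1) show ?thesis by (rule order_tendstoD(2))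
  qed
  have mixed: False
    if mx: "even n'" "odd m'" "n' > 0" "m' > 0" "\<beta>' \<noteq> 0" "injective_near_0 \<Delta>'"
      "\<forall>\<^sub>F \<theta> in nhds 0. \<Gamma>' (\<alpha>' * \<theta> ^ n') = \<Delta>' (\<beta>' * \<theta> ^ m')"
    for n' m' \<alpha>' \<beta>' and \<Gamma>' \<Delta>' :: "real \<Rightarrow> real \<times> real"
  proof -
    obtain r where r: "r > 0" "inj_on \<Delta>' {-r<..<r}" using mx(6) by (auto simp: injective_near_0_def)
    obtain d where d: "d > 0" "\<And>\<theta>. \<bar>\<theta>\<bar> < d \<Longrightarrow> \<bar>\<beta>' * \<theta> ^ m'\<bar> < r \<and> \<Gamma>' (\<alpha>' * \<theta> ^ n') = \<Delta>' (\<beta>' * \<theta> ^ m')"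
      using eventually_conj[OF small[OF r(1) mx(4), of \<beta>'] mx(7)]
      by (auto simp: eventually_nhds_metric dist_real_def)
    have e: "\<Delta>' (\<beta>' * (d/2) ^ m') = \<Delta>' (\<beta>' * (- (d/2)) ^ m')"
      using d(2)[of "d/2"] d(2)[of "-(d/2)"] d(1) mx(1) by simp
    have "\<beta>' * (d/2) ^ m' = \<beta>' * (- (d/2)) ^ m'"
      by (rule inj_onD[OF r(2) e]) (use d(2)[of "d/2"] d(2)[of "-(d/2)"] d(1) in \<open>auto simp: abs_less_iff\<close>)
    then show False using mx d(1) by simp
  qed
  have "odd n"
  proof
    assume "even n"
    moreover from this have "odd m" using assms(1) by (metis coprime_common_divisor odd_one)
    ultimately show False using mixed[of n m \<beta> \<Delta> \<Gamma> \<alpha>] assms by blast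
  qed
  moreover have "odd m"
  proof
    assume "even m"
    moreover have "\<forall>\<^sub>F \<theta> in nhds 0. \<Delta> (\<beta> * \<theta> ^ m) = \<Gamma> (\<alpha> * \<theta> ^ n)"
      using eq by eventually_elim simp
    ultimately show False using mixed[of m n \<alpha> \<Gamma> \<Delta> \<beta>] assms \<open>odd n\<close> by blast
  qed
  ultimately have "filtermap \<Gamma> (filtermap (\<lambda>\<theta>. \<alpha> * \<theta> ^ n) (nhds 0)) = filtermap \<Gamma> (nhds 0)"
    "filtermap \<Delta> (filtermap (\<lambda>\<theta>. \<beta> * \<theta> ^ m) (nhds 0)) = filtermap \<Delta> (nhds 0)"
    using assms by (simp_all add: filtermap_nhds_odd_power)
  moreover have "filtermap \<Gamma> (filtermap (\<lambda>\<theta>. \<alpha> * \<theta> ^ n) (nhds 0)) =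
      filtermap \<Delta> (filtermap (\<lambda>\<theta>. \<beta> * \<theta> ^ m) (nhds 0))"
    unfolding filtermap_filtermap using eq by (intro filtermap_eventually_cong) simp
  ultimately show ?thesis by simp
qed

lemma analytic_arc_iff_real_analytic: "analytic_arc \<gamma> \<longleftrightarrow> real_analytic_at (\<lambda>t. fst (\<gamma> t)) 0 \<and> real_analytic_at (\<lambda>t. snd (\<gamma> t)) 0"
  unfolding analytic_arc_def
  using real_analytic_imp_has_fps_expansion[of "\<lambda>t. fst (\<gamma> t)" 0] real_analytic_imp_has_fps_expansion[of "\<lambda>t. snd (\<gamma> t)" 0]
    has_fps_expansion_imp_real_analytic by auto

lemma injective_near_0_compose:
  assumes "injective_near_0 \<gamma>" "filterlim \<psi> (nhds 0) (nhds 0)" "\<forall>\<^sub>F z in nhds 0. \<xi> (\<psi> z) = z"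
  shows "injective_near_0 (\<lambda>z. \<gamma> (\<psi> z))"
proof -
  obtain r where r: "r > 0" "inj_on \<gamma> {-r<..<r}" using assms(1) by (auto simp: injective_near_0_def)
  have "\<forall>\<^sub>F z in nhds 0. \<psi> z \<in> {-r<..<r} \<and> \<xi> (\<psi> z) = z"
    using assms(3) topological_tendstoD[OF assms(2), of "{-r<..<r}"] r(1) by (auto elim: eventually_elim2)
  then obtain d where d: "d > 0" "\<And>z. \<bar>z\<bar> < d \<Longrightarrow> \<psi> z \<in> {-r<..<r} \<and> \<xi> (\<psi> z) = z"
    by (auto simp: eventually_nhds_metric dist_real_def)
  have "inj_on (\<lambda>z. \<gamma> (\<psi> z)) {-d<..<d}"
  proof (rule inj_onI)
    fix z w assume zw: "z \<in> {-d<..<d}" "w \<in> {-d<..<d}" and e: "\<gamma> (\<psi> z) = \<gamma> (\<psi> w)"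
    have "\<psi> z = \<psi> w"
      by (rule inj_onD[OF r(2) e]) (use d(2)[of z] d(2)[of w] zw in \<open>auto simp: abs_less_iff\<close>)
    then show "z = w" using d(2)[of z] d(2)[of w] zw by (metis abs_less_iff greaterThanLessThan_iff minus_less_iff)
  qed
  with d(1) show ?thesis by (auto simp: injective_near_0_def)
qed

text \<open>A pigeonhole argument over four sign patterns: one of them occurs at every scale. Common
  points can then be sought at positive parameters, where roots are available.\<close>

lemma frequently_sign_cases:
  fixes P :: "real \<Rightarrow> real \<Rightarrow> bool"
  assumes "\<And>r. r > 0 \<Longrightarrow> \<exists>z w. z \<noteq> 0 \<and> w \<noteq> 0 \<and> \<bar>z\<bar> < r \<and> \<bar>w\<bar> < r \<and> P z w"
  shows "\<exists>\<alpha>\<in>{1,-1}. \<exists>\<beta>\<in>{1,-1}. \<forall>r>0. \<exists>z w. 0 < z \<and> 0 < w \<and> z < r \<and> w < r \<and> P (\<alpha> * z) (\<beta> * w)"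
proof (rule ccontr)
  define Q where "Q = (\<lambda>\<alpha> \<beta> (r::real). \<exists>z w. 0 < z \<and> 0 < w \<and> z < r \<and> w < r \<and> P (\<alpha> * z) (\<beta> * w))"
  assume "\<not> ?thesis"
  then have "\<exists>r>0. \<not> Q 1 1 r" "\<exists>r>0. \<not> Q 1 (-1) r" "\<exists>r>0. \<not> Q (-1) 1 r" "\<exists>r>0. \<not> Q (-1) (-1) r"
    by (auto simp: Q_def)
  then obtain r1 r2 r3 r4 where r: "r1 > 0" "r2 > 0" "r3 > 0" "r4 > 0"
    "\<not> Q 1 1 r1" "\<not> Q 1 (-1) r2" "\<not> Q (-1) 1 r3" "\<not> Q (-1) (-1) r4" by blast
  define r where "r = min (min r1 r2) (min r3 r4)"
  have "r > 0" using r by (simp add: r_def)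
  then obtain z w where zw: "z \<noteq> 0" "w \<noteq> 0" "\<bar>z\<bar> < r" "\<bar>w\<bar> < r" "P z w" using assms by blast
  have "Q (sgn z) (sgn w) r"
    unfolding Q_def by (rule exI[of _ "\<bar>z\<bar>"], rule exI[of _ "\<bar>w\<bar>"]) (use zw in \<open>simp add: sgn_mult_abs\<close>)
  moreover have "Q a b r \<Longrightarrow> r \<le> r' \<Longrightarrow> Q a b r'" for a b r'
    unfolding Q_def by (meson order_less_le_trans)
  moreover have "r \<le> r1" "r \<le> r2" "r \<le> r3" "r \<le> r4" by (auto simp: r_def)
  ultimately show False using r zw(1,2) by (auto simp: sgn_if split: if_splits)
qed

text \<open>Two arcs through the same point that meet at points accumulating there have proportional
  normal forms \<open>(\<epsilon> z\<^sup>p, A z)\<close> and \<open>(\<epsilon>' w\<^sup>p', B w)\<close>; the identity theorem in a common root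
  \<open>\<theta>\<close> of \<open>z\<close> and \<open>w\<close> identifies them.\<close>

lemma analytic_arcs_share_germ:
  assumes g: "analytic_arc \<gamma>" "injective_near_0 \<gamma>" and d: "analytic_arc \<delta>" "injective_near_0 \<delta>"
    and "\<gamma> 0 = \<delta> 0"
    and share: "\<And>r. r > 0 \<Longrightarrow> \<exists>s s'. s \<noteq> 0 \<and> s' \<noteq> 0 \<and> \<bar>s\<bar> < r \<and> \<bar>s'\<bar> < r \<and> \<gamma> s = \<delta> s'"
    and nz: "\<not> (\<forall>\<^sub>F t in nhds 0. fst (\<gamma> t) = fst (\<gamma> 0))" "\<not> (\<forall>\<^sub>F t in nhds 0. fst (\<delta> t) = fst (\<delta> 0))"
  shows "branch_germ \<gamma> 0 = branch_germ \<delta> 0"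
proof -
  have rg: "real_analytic_at (\<lambda>t. fst (\<gamma> t) - fst (\<gamma> 0)) 0" "real_analytic_at (\<lambda>t. snd (\<gamma> t)) 0"
    and rd: "real_analytic_at (\<lambda>t. fst (\<delta> t) - fst (\<delta> 0)) 0" "real_analytic_at (\<lambda>t. snd (\<delta> t)) 0"
    using g(1) d(1) by (auto simp: analytic_arc_iff_real_analytic intro: real_analytic_diff)
  obtain p \<epsilon> \<psi> \<xi> where n: "p \<ge> 1" "\<epsilon> \<noteq> 0" "real_analytic_at \<psi> 0" "real_analytic_at \<xi> 0" "\<psi> 0 = 0" "\<xi> 0 = 0"
    "\<forall>\<^sub>F z in nhds 0. \<xi> (\<psi> z) = z" "\<forall>\<^sub>F s in nhds 0. \<psi> (\<xi> s) = s"
    "\<forall>\<^sub>F z in nhds 0. fst (\<gamma> (\<psi> z)) - fst (\<gamma> 0) = sgn \<epsilon> * z ^ p"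
    using real_analytic_power_normal_form[OF rg(1)] nz(1) by auto
  obtain p' \<epsilon>' \<psi>' \<xi>' where n': "p' \<ge> 1" "\<epsilon>' \<noteq> 0" "real_analytic_at \<psi>' 0" "real_analytic_at \<xi>' 0" "\<psi>' 0 = 0" "\<xi>' 0 = 0"
    "\<forall>\<^sub>F z in nhds 0. \<xi>' (\<psi>' z) = z" "\<forall>\<^sub>F s in nhds 0. \<psi>' (\<xi>' s) = s"
    "\<forall>\<^sub>F z in nhds 0. fst (\<delta> (\<psi>' z)) - fst (\<delta> 0) = sgn \<epsilon>' * z ^ p'"
    using real_analytic_power_normal_form[OF rd(1)] nz(2) by auto
  have lim: "filterlim \<psi> (nhds 0) (nhds 0)" "filterlim \<xi> (nhds 0) (nhds 0)"
    "filterlim \<psi>' (nhds 0) (nhds 0)" "filterlim \<xi>' (nhds 0) (nhds 0)"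
    using real_analytic_tendsto[OF n(3)] real_analytic_tendsto[OF n(4)] real_analytic_tendsto[OF n'(3)] real_analytic_tendsto[OF n'(4)] n n' by auto
  define \<Gamma> where "\<Gamma> = (\<lambda>z. \<gamma> (\<psi> z))"
  define \<Delta> where "\<Delta> = (\<lambda>z. \<delta> (\<psi>' z))"
  have inj: "injective_near_0 \<Gamma>" "injective_near_0 \<Delta>"
    unfolding \<Gamma>_def \<Delta>_def using injective_near_0_compose[OF g(2) lim(1) n(7)]
      injective_near_0_compose[OF d(2) lim(3) n'(7)] by auto
  have germ: "filtermap \<Gamma> (nhds 0) = branch_germ \<gamma> 0" "filtermap \<Delta> (nhds 0) = branch_germ \<delta> 0"
    unfolding \<Gamma>_def \<Delta>_def branch_germ_def
    using filtermap_nhds_local_inverse[OF lim(1,2) n(8)] filtermap_nhds_local_inverse[OF lim(3,4) n'(8)]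
    by (metis filtermap_filtermap)+
  have sg: "real_analytic_at (\<lambda>z. snd (\<Gamma> z)) 0" "real_analytic_at (\<lambda>z. snd (\<Delta> z)) 0"
    unfolding \<Gamma>_def \<Delta>_def
    using real_analytic_compose[OF n(3), of "\<lambda>t. snd (\<gamma> t)"] real_analytic_compose[OF n'(3), of "\<lambda>t. snd (\<delta> t)"] rg rd n n' by auto
  have meet: "\<exists>z w. z \<noteq> 0 \<and> w \<noteq> 0 \<and> \<bar>z\<bar> < r \<and> \<bar>w\<bar> < r \<and> (\<Gamma> z = \<Delta> w)" if "r > 0" for r
  proof -
    have "\<forall>\<^sub>F s in nhds 0. \<bar>\<xi> s\<bar> < r \<and> \<psi> (\<xi> s) = s \<and> \<bar>\<xi>' s\<bar> < r \<and> \<psi>' (\<xi>' s) = s"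
      using n(8) n'(8) topological_tendstoD[OF lim(2) open_greaterThanLessThan[of "-r" r]]
        topological_tendstoD[OF lim(4) open_greaterThanLessThan[of "-r" r]] that
      by (simp add: eventually_conj_iff abs_less_iff minus_less_iff conj_ac)
    then obtain e where e: "e > 0"
      "\<And>s. \<bar>s\<bar> < e \<Longrightarrow> \<bar>\<xi> s\<bar> < r \<and> \<psi> (\<xi> s) = s \<and> \<bar>\<xi>' s\<bar> < r \<and> \<psi>' (\<xi>' s) = s"
      by (auto simp: eventually_nhds_metric dist_real_def)
    obtain s s' where s: "s \<noteq> 0" "s' \<noteq> 0" "\<bar>s\<bar> < e" "\<bar>s'\<bar> < e" "\<gamma> s = \<delta> s'" using share[OF e(1)] by blast
    show ?thesis
      by (rule exI[of _ "\<xi> s"], rule exI[of _ "\<xi>' s'"])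
        (use s e(2)[of s] e(2)[of s'] n(5) n'(5) in \<open>auto simp: \<Gamma>_def \<Delta>_def\<close>)
  qed
  obtain \<alpha> \<beta> where ab: "\<alpha> \<in> {1,-1}" "\<beta> \<in> {1,-1}"
    "\<And>r. r > 0 \<Longrightarrow> \<exists>z w. 0 < z \<and> 0 < w \<and> z < r \<and> w < r \<and> \<Gamma> (\<alpha> * z) = \<Delta> (\<beta> * w)"
    using frequently_sign_cases[OF meet] by blast
  \<comment> \<open>With \<open>p' = n0 * e\<close> and \<open>p = m0 * e\<close>, the positive
    solutions of \<open>z ^ p = w ^ p'\<close> are \<open>z = \<theta> ^ n0\<close>,
    \<open>w = \<theta> ^ m0\<close>. This turns the comparison of two parameters into one analytic
    equation in \<open>\<theta>\<close>.\<close>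
  define e where "e = gcd p p'"
  obtain n0 m0 where nm: "p' = n0 * e" "p = m0 * e" "coprime n0 m0"
    using gcd_coprime_exists[of p' p] n(1) by (metis e_def gcd.commute gcd_eq_0_iff not_one_le_zero)
  have pos: "n0 > 0" "m0 > 0" "e > 0" using nm n(1) n'(1) by (auto intro: Nat.gr0I)
  have "\<forall>\<^sub>F z in nhds 0. fst (\<Gamma> z) = fst (\<gamma> 0) + sgn \<epsilon> * z ^ p \<and> fst (\<Delta> z) = fst (\<gamma> 0) + sgn \<epsilon>' * z ^ p'"
    using n(9) n'(9) by eventually_elim (simp add: \<Gamma>_def \<Delta>_def assms(5) algebra_simps)
  then obtain r0 where r0: "r0 > 0" "\<And>z. \<bar>z\<bar> < r0 \<Longrightarrow> fst (\<Gamma> z) = fst (\<gamma> 0) + sgn \<epsilon> * z ^ p \<and>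
      fst (\<Delta> z) = fst (\<gamma> 0) + sgn \<epsilon>' * z ^ p'"
    by (auto simp: eventually_nhds_metric dist_real_def)
  have meet2: "sgn \<epsilon> * \<alpha> ^ p = sgn \<epsilon>' * \<beta> ^ p' \<and> z ^ p = w ^ p'"
    if "0 < z" "0 < w" "z < r0" "w < r0" "\<Gamma> (\<alpha> * z) = \<Delta> (\<beta> * w)" for z w
  proof -
    have "\<bar>\<alpha> * z\<bar> < r0" "\<bar>\<beta> * w\<bar> < r0" using ab that by auto
    then have e: "(sgn \<epsilon> * \<alpha> ^ p) * z ^ p = (sgn \<epsilon>' * \<beta> ^ p') * w ^ p'"
      using r0(2)[of "\<alpha> * z"] r0(2)[of "\<beta> * w"] arg_cong[OF that(5), of fst] by (simp add: power_mult_distrib)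
    have u: "\<bar>sgn \<epsilon> * \<alpha> ^ p\<bar> = 1" "\<bar>sgn \<epsilon>' * \<beta> ^ p'\<bar> = 1"
      using ab n(2) n'(2) by (auto simp: abs_mult power_abs)
    have "z ^ p > 0" "w ^ p' > 0" using that by auto
    moreover have "A = B \<and> a = b" if "\<bar>A\<bar> = 1" "\<bar>B\<bar> = 1" "a > 0" "b > 0" "A * a = B * b" for A B a b :: real
      using that by (cases "A > 0"; cases "B > 0") (auto simp: abs_if split: if_splits)
    ultimately show ?thesis using e u by blast
  qed
  have sgneq: "sgn \<epsilon> * \<alpha> ^ p = sgn \<epsilon>' * \<beta> ^ p'" using ab(3)[OF r0(1)] meet2 by blast
  \<comment> \<open>The first coordinates agree along the \<open>\<theta>\<close>-curve by
    construction, so \<open>H\<close> measures the only remaining difference; its zeros will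
    accumulate at 0.\<close>
  define H where "H = (\<lambda>\<theta>. snd (\<Gamma> (\<alpha> * \<theta> ^ n0)) - snd (\<Delta> (\<beta> * \<theta> ^ m0)))"
  have "real_analytic_at H 0"
    unfolding H_def
    using real_analytic_compose[OF real_analytic_mult[OF real_analytic_const[of \<alpha>] real_analytic_power[OF real_analytic_ident, of n0]], of "\<lambda>z. snd (\<Gamma> z)"]
      real_analytic_compose[OF real_analytic_mult[OF real_analytic_const[of \<beta>] real_analytic_power[OF real_analytic_ident, of m0]], of "\<lambda>z. snd (\<Delta> z)"]
      sg pos by (intro real_analytic_diff) (auto simp: power_0_left)
  moreover have "\<not> (\<forall>\<^sub>F \<theta> in at 0. H \<theta> \<noteq> 0)"
  proof
    assume "\<forall>\<^sub>F \<theta> in at 0. H \<theta> \<noteq> 0"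
    then obtain b where b: "b > 0" "\<And>\<theta>. \<theta> \<noteq> 0 \<Longrightarrow> \<bar>\<theta>\<bar> < b \<Longrightarrow> H \<theta> \<noteq> 0"
      by (auto simp: eventually_at dist_real_def)
    \<comment> \<open>The bound \<open>b ^ n0\<close> on \<open>z\<close> keeps its root
      \<open>\<theta>\<close> below \<open>b\<close>, where \<open>H\<close> is supposed to have no
      zero.\<close>
    define r where "r = min r0 (b ^ n0)"
    have "r > 0" using r0(1) b(1) by (simp add: r_def)
    then obtain z w where zw: "0 < z" "0 < w" "z < r" "w < r" "\<Gamma> (\<alpha> * z) = \<Delta> (\<beta> * w)" using ab(3) by blast
    define \<theta> where "\<theta> = root n0 z"
    have t: "\<theta> > 0" "\<theta> ^ n0 = z" using zw(1) pos(1) by (auto simp: \<theta>_def)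
    have "\<theta> < b"
      using zw(3) t b(1) pos(1) by (intro power_less_imp_less_base[of \<theta> n0 b]) (auto simp: r_def)
    moreover have "w = \<theta> ^ m0"
    proof (rule power_eq_imp_eq_base[of w p'])
      have "w ^ p' = z ^ p" using meet2[of z w] zw by (simp add: r_def)
      also have "\<dots> = \<theta> ^ (n0 * (m0 * e))" by (simp add: nm(2) power_mult flip: t(2))
      also have "\<dots> = \<theta> ^ (m0 * p')" by (simp add: nm(1) mult_ac)
      finally show "w ^ p' = (\<theta> ^ m0) ^ p'" by (simp add: power_mult)
    qed (use zw t n'(1) in auto)
    ultimately show False using b(2)[of \<theta>] t zw(5) by (simp add: H_def)
  qed
  ultimately have H: "\<forall>\<^sub>F \<theta> in nhds 0. H \<theta> = 0" using real_analytic_isolated_zeros by blast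
  have "\<forall>\<^sub>F \<theta> in nhds 0. \<Gamma> (\<alpha> * \<theta> ^ n0) = \<Delta> (\<beta> * \<theta> ^ m0)"
  proof -
    have "filterlim (\<lambda>\<theta>. \<alpha> * \<theta> ^ n0) (nhds 0) (nhds 0)" "filterlim (\<lambda>\<theta>. \<beta> * \<theta> ^ m0) (nhds 0) (nhds 0)"
      using pos by (auto intro!: isCont_imp_tendsto_nhds simp: power_0_left)
    from topological_tendstoD[OF this(1), of "{-r0<..<r0}"] topological_tendstoD[OF this(2), of "{-r0<..<r0}"] r0(1)
    have "\<forall>\<^sub>F \<theta> in nhds 0. \<alpha> * \<theta> ^ n0 \<in> {-r0<..<r0}" "\<forall>\<^sub>F \<theta> in nhds 0. \<beta> * \<theta> ^ m0 \<in> {-r0<..<r0}" by auto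
    with H show ?thesis
    proof eventually_elim
      case (elim \<theta>)
      have "(\<theta> ^ n0) ^ p = (\<theta> ^ m0) ^ p'" by (simp add: nm mult_ac flip: power_mult)
      then have "sgn \<epsilon> * (\<alpha> * \<theta> ^ n0) ^ p = sgn \<epsilon>' * (\<beta> * \<theta> ^ m0) ^ p'"
        using sgneq by (simp add: power_mult_distrib)
      then have "fst (\<Gamma> (\<alpha> * \<theta> ^ n0)) = fst (\<Delta> (\<beta> * \<theta> ^ m0))"
        using r0(2)[of "\<alpha> * \<theta> ^ n0"] r0(2)[of "\<beta> * \<theta> ^ m0"] elim by (simp add: abs_less_iff)
      moreover have "snd (\<Gamma> (\<alpha> * \<theta> ^ n0)) = snd (\<Delta> (\<beta> * \<theta> ^ m0))" using elim by (simp add: H_def)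
      ultimately show ?case by (rule prod_eqI)
    qed
  qed
  from coprime_powers_share_germ[OF nm(3) pos(1,2) _ _ inj this] ab show ?thesis
    using germ by auto
qed

section \<open>Charts of the normalization\<close>

text \<open>The parameter intervals that become charts: each shifted arc is again a branch
  parametrization, so that \<open>branch_germ \<gamma> s\<close> is a point of the normalization for
  every \<open>s\<close> in the interval.\<close>

definition good_radius :: "(real \<times> real) set \<Rightarrow> (real \<Rightarrow> real \<times> real) \<Rightarrow> real \<Rightarrow> bool"
  where "good_radius X \<gamma> r \<longleftrightarrow> r > 0 \<and> inj_on \<gamma> {-r<..<r} \<and>
    (\<forall>s. \<bar>s\<bar> < r \<longrightarrow> isCont \<gamma> s \<and> branch_param X (\<lambda>t. \<gamma> (s + t)))"

lemma good_radius_mono: "good_radius X \<gamma> r \<Longrightarrow> 0 < r' \<Longrightarrow> r' \<le> r \<Longrightarrow> good_radius X \<gamma> r'"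
  unfolding good_radius_def by (auto intro: inj_on_subset)

lemma branch_germ_shift: "branch_germ (\<lambda>t. \<gamma> (s + t)) u = branch_germ \<gamma> (s + u)"
proof -
  have "nhds (s + u) = filtermap (\<lambda>t. s + t) (nhds u)"
    using filtermap_nhds_shift[of "-s" u] by (simp add: add.commute)
  then show ?thesis by (simp add: branch_germ_def filtermap_filtermap)
qed

lemma real_analytic_shift: "real_analytic_at f s \<Longrightarrow> real_analytic_at (\<lambda>t. f (s + t)) 0"
  using real_analytic_compose[where f="\<lambda>t. s + t" and s=0 and k=f] real_analytic_add[OF real_analytic_const real_analytic_ident] by simp

lemma eventually_nhds_shift: "(\<forall>\<^sub>F t in nhds s. P t) \<Longrightarrow> (\<forall>\<^sub>F t in nhds 0. P (s + t))" for s :: real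
proof -
  have "filterlim (\<lambda>t. s + t) (nhds s) (nhds 0)" by (rule isCont_imp_tendsto_nhds) auto
  then show "(\<forall>\<^sub>F t in nhds s. P t) \<Longrightarrow> (\<forall>\<^sub>F t in nhds 0. P (s + t))" by (auto simp: filterlim_iff)
qed

lemma branch_param_imp_good_radius:
  assumes "branch_param X \<gamma>" shows "\<exists>r. good_radius X \<gamma> r"
proof -
  have real_analytic_at: "real_analytic_at (\<lambda>t. fst (\<gamma> t)) 0" "real_analytic_at (\<lambda>t. snd (\<gamma> t)) 0"
    using assms by (auto simp: branch_param_def analytic_arc_iff_real_analytic)
  obtain r0 where r0: "r0 > 0" "inj_on \<gamma> {-r0<..<r0}"
    using assms by (auto simp: branch_param_def injective_near_0_def)
  have "\<forall>\<^sub>F s in nhds 0. (\<forall>\<^sub>F t in nhds s. \<gamma> t \<in> X)"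
    using assms by (simp add: branch_param_def eventually_eventually)
  then have "\<forall>\<^sub>F s in nhds 0. real_analytic_at (\<lambda>t. fst (\<gamma> t)) s \<and> real_analytic_at (\<lambda>t. snd (\<gamma> t)) s \<and> (\<forall>\<^sub>F t in nhds s. \<gamma> t \<in> X)"
    using real_analytic_eventually[OF real_analytic_at(1)] real_analytic_eventually[OF real_analytic_at(2)] by eventually_elim simp
  then obtain d where d: "d > 0" "\<And>s. \<bar>s\<bar> < d \<Longrightarrow> real_analytic_at (\<lambda>t. fst (\<gamma> t)) s \<and> real_analytic_at (\<lambda>t. snd (\<gamma> t)) s \<and> (\<forall>\<^sub>F t in nhds s. \<gamma> t \<in> X)"
    by (auto simp: eventually_nhds_metric dist_real_def)
  define r where "r = min d r0"
  have "isCont \<gamma> s \<and> branch_param X (\<lambda>t. \<gamma> (s + t))" if s: "\<bar>s\<bar> < r" for s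
  proof
    have d': "real_analytic_at (\<lambda>t. fst (\<gamma> t)) s" "real_analytic_at (\<lambda>t. snd (\<gamma> t)) s" "\<forall>\<^sub>F t in nhds s. \<gamma> t \<in> X"
      using d(2)[of s] s by (auto simp: r_def)
    have "isCont (\<lambda>t. (fst (\<gamma> t), snd (\<gamma> t))) s"
      using real_analytic_isCont[OF d'(1)] real_analytic_isCont[OF d'(2)] by (rule isCont_Pair)
    then show "isCont \<gamma> s" by simp
    have "injective_near_0 (\<lambda>t. \<gamma> (s + t))"
      unfolding injective_near_0_def
    proof (intro exI conjI)
      show "r0 - \<bar>s\<bar> > 0" using s by (simp add: r_def)
      show "inj_on (\<lambda>t. \<gamma> (s + t)) {-(r0 - \<bar>s\<bar>)<..<r0 - \<bar>s\<bar>}"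
      proof (rule inj_onI)
        fix a b assume "a \<in> {-(r0 - \<bar>s\<bar>)<..<r0 - \<bar>s\<bar>}" "b \<in> {-(r0 - \<bar>s\<bar>)<..<r0 - \<bar>s\<bar>}" "\<gamma> (s + a) = \<gamma> (s + b)"
        then show "a = b" using inj_onD[OF r0(2), of "s + a" "s + b"] by (auto simp: abs_if split: if_splits)
      qed
    qed
    then show "branch_param X (\<lambda>t. \<gamma> (s + t))"
      using real_analytic_shift[OF d'(1)] real_analytic_shift[OF d'(2)] eventually_nhds_shift[OF d'(3)]
      by (simp add: branch_param_def analytic_arc_iff_real_analytic)
  qed
  then have "good_radius X \<gamma> r"
    unfolding good_radius_def using d(1) r0(1)
    by (intro conjI inj_on_subset[OF r0(2)]) (auto simp: r_def)
  then show ?thesis ..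
qed

lemma centre_branch_germ: assumes "isCont \<gamma> s" shows "centre (branch_germ \<gamma> s) = \<gamma> s"
  unfolding centre_def
proof (rule tendsto_Lim)
  show "branch_germ \<gamma> s \<noteq> bot" by (simp add: branch_germ_def filtermap_bot_iff)
  show "((\<lambda>y. y) \<longlongrightarrow> \<gamma> s) (branch_germ \<gamma> s)"
    using isCont_imp_tendsto_nhds[OF assms refl] by (simp add: branch_germ_def filterlim_def filtermap_filtermap)
qed

lemma branch_germ_in_branches: "good_radius X \<gamma> r \<Longrightarrow> \<bar>s\<bar> < r \<Longrightarrow> branch_germ \<gamma> s \<in> branches X"
  unfolding good_radius_def branches_def using branch_germ_shift[of \<gamma> s 0] by force

lemma branches_obtain:
  assumes "P \<in> branches X" obtains \<gamma> r where "P = branch_germ \<gamma> 0" "branch_param X \<gamma>" "good_radius X \<gamma> r"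
  using assms branch_param_imp_good_radius by (fastforce simp: branches_def)

lemma inj_on_branch_germ: assumes "good_radius X \<gamma> r" shows "inj_on (branch_germ \<gamma>) {-r<..<r}"
proof (rule inj_onI)
  fix a b assume *: "a \<in> {-r<..<r}" "b \<in> {-r<..<r}" "branch_germ \<gamma> a = branch_germ \<gamma> b"
  have "isCont \<gamma> a" "isCont \<gamma> b" using * assms by (auto simp: good_radius_def abs_less_iff)
  then have "\<gamma> a = \<gamma> b" using *(3) centre_branch_germ by metis
  then show "a = b" using * assms by (auto simp: good_radius_def dest: inj_onD)
qed

lemma topspace_normalization: "topspace (normalization X) = branches X"
proof
  show "topspace (normalization X) \<subseteq> branches X"
    using iffD1[OF openin_normalization openin_topspace] by (rule conjunct1)
  have "openin (normalization X) (branches X)"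
    unfolding openin_normalization
  proof (intro conjI allI impI)
    fix \<gamma> assume "branch_param X \<gamma> \<and> branch_germ \<gamma> 0 \<in> branches X"
    then obtain r where r: "good_radius X \<gamma> r" using branch_param_imp_good_radius by blast
    then have "\<forall>\<^sub>F s in nhds 0. s \<in> {-r<..<r}" by (intro eventually_nhds_in_open) (auto simp: good_radius_def)
    then show "\<forall>\<^sub>F s in nhds 0. branch_germ \<gamma> s \<in> branches X"
      by eventually_elim (use branch_germ_in_branches[OF r] in \<open>auto simp: abs_less_iff\<close>)
  qed simp
  then show "branches X \<subseteq> topspace (normalization X)" by (rule openin_subset)
qed

text \<open>Invariance of domain in dimension one: a continuous injection of an open set is open, so
  it carries neighbourhood filters to neighbourhood filters.\<close>

lemma filtermap_nhds_injective:
  fixes \<phi> :: "real \<Rightarrow> real"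
  assumes "open S" "continuous_on S \<phi>" "inj_on \<phi> S" "s \<in> S"
  shows "filtermap \<phi> (nhds s) = nhds (\<phi> s)"
proof (rule antisym)
  show "filtermap \<phi> (nhds s) \<le> nhds (\<phi> s)"
    using isCont_imp_tendsto_nhds[of s \<phi>] assms by (simp add: filterlim_def continuous_on_eq_continuous_at)
  show "nhds (\<phi> s) \<le> filtermap \<phi> (nhds s)"
  proof (rule filter_leI)
    fix P assume "eventually P (filtermap \<phi> (nhds s))"
    then obtain T where T: "open T" "s \<in> T" "\<And>t. t \<in> T \<Longrightarrow> P (\<phi> t)"
      by (auto simp: eventually_filtermap eventually_nhds)
    have "open (\<phi> ` (S \<inter> T))"
      by (rule invariance_of_domain) (use assms T in \<open>auto intro: continuous_on_subset inj_on_subset\<close>)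
    then show "eventually P (nhds (\<phi> s))"
      unfolding eventually_nhds using T assms by (intro exI[of _ "\<phi> ` (S \<inter> T)"]) auto
  qed
qed

text \<open>A branch \<open>\<delta>\<close> with the same germ as \<open>\<gamma>\<close> at
  \<open>s\<close> runs inside the arc \<open>\<gamma>\<close> for a while. The transition
  \<open>\<phi>\<close>, the inverse of \<open>\<gamma>\<close> after \<open>\<delta>\<close>, is
  continuous and injective, hence preserves neighbourhood filters, and nearby germs of
  \<open>\<delta>\<close> are germs of \<open>\<gamma>\<close>.\<close>

lemma openin_branch_chart:
  assumes g: "good_radius X \<gamma> r" and V: "open V" "V \<subseteq> {-r<..<r}"
  shows "openin (normalization X) (branch_germ \<gamma> ` V)"
  unfolding openin_normalization
proof (intro conjI allI impI)
  show "branch_germ \<gamma> ` V \<subseteq> branches X"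
    using branch_germ_in_branches[OF g] V by (fastforce simp: abs_less_iff)
  fix \<delta> assume \<delta>: "branch_param X \<delta> \<and> branch_germ \<delta> 0 \<in> branch_germ \<gamma> ` V"
  then obtain s where s: "s \<in> V" "branch_germ \<delta> 0 = branch_germ \<gamma> s" by blast
  obtain r' where r': "good_radius X \<delta> r'" using \<delta> branch_param_imp_good_radius by blast
  obtain \<eta> where \<eta>: "\<eta> > 0" "cball s \<eta> \<subseteq> V" using V(1) s(1) open_contains_cball by blast
  \<comment> \<open>Compactness of the closed interval is what makes the inverse of the injective
    arc continuous.\<close>
  define K where "K = cball s \<eta>"
  have "\<forall>\<^sub>F t in nhds s. t \<in> ball s \<eta>" using \<eta>(1) by (intro eventually_nhds_in_open) auto
  then have "\<forall>\<^sub>F y in branch_germ \<gamma> s. y \<in> \<gamma> ` ball s \<eta>"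
    by (auto simp: branch_germ_def eventually_filtermap elim: eventually_mono)
  then have "\<forall>\<^sub>F s' in nhds 0. \<delta> s' \<in> \<gamma> ` ball s \<eta>"
    unfolding s(2)[symmetric] by (simp add: branch_germ_def eventually_filtermap)
  moreover have "\<forall>\<^sub>F s' in nhds 0. s' \<in> {-r'<..<r'}"
    using r' by (intro eventually_nhds_in_open) (auto simp: good_radius_def)
  ultimately have "\<forall>\<^sub>F s' in nhds 0. \<delta> s' \<in> \<gamma> ` ball s \<eta> \<and> s' \<in> {-r'<..<r'}" by (rule eventually_conj)
  then obtain S where S: "open S" "0 \<in> S" "\<And>s'. s' \<in> S \<Longrightarrow> \<delta> s' \<in> \<gamma> ` ball s \<eta> \<and> s' \<in> {-r'<..<r'}"
    by (auto simp: eventually_nhds)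
  have KV: "K \<subseteq> {-r<..<r}" using \<eta> V by (auto simp: K_def)
  have K: "compact K" "continuous_on K \<gamma>" "inj_on \<gamma> K"
    using g KV by (auto simp: K_def good_radius_def abs_less_iff intro!: continuous_at_imp_continuous_on intro: inj_on_subset)
  define \<phi> where "\<phi> = (\<lambda>s'. the_inv_into K \<gamma> (\<delta> s'))"
  have bK: "ball s \<eta> \<subseteq> K" by (auto simp: K_def)
  have \<phi>: "\<phi> s' \<in> ball s \<eta>" "\<gamma> (\<phi> s') = \<delta> s'" if "s' \<in> S" for s'
  proof -
    obtain k where k: "k \<in> ball s \<eta>" "\<delta> s' = \<gamma> k" using S(3)[OF \<open>s' \<in> S\<close>] by blast
    then have "\<phi> s' = k" unfolding \<phi>_def using K(3) bK by (simp add: the_inv_into_f_f subset_iff)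
    then show "\<phi> s' \<in> ball s \<eta>" "\<gamma> (\<phi> s') = \<delta> s'" using k by auto
  qed
  have "\<delta> ` S \<subseteq> \<gamma> ` K" using S(3) bK by blast
  moreover have cS: "continuous_on S \<delta>"
    using S(3) r' by (intro continuous_at_imp_continuous_on) (auto simp: good_radius_def abs_less_iff minus_less_iff)
  ultimately have c: "continuous_on S \<phi>"
    unfolding \<phi>_def using continuous_on_inv_into[OF K(2,1,3)]
    by (intro continuous_on_compose2[of "\<gamma> ` K" "the_inv_into K \<gamma>" S \<delta>]) auto
  have "inj_on \<delta> S" using r' S(3) by (auto simp: good_radius_def intro: inj_on_subset)
  then have i: "inj_on \<phi> S" by (intro inj_onI) (metis \<phi>(2) inj_onD)
  have "branch_germ \<delta> s' \<in> branch_germ \<gamma> ` V" if s': "s' \<in> S" for s'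
  proof -
    have "\<forall>\<^sub>F t in nhds s'. \<gamma> (\<phi> t) = \<delta> t"
      using eventually_nhds_in_open[OF S(1) s'] by eventually_elim (use \<phi> in auto)
    then have "branch_germ \<delta> s' = filtermap (\<lambda>t. \<gamma> (\<phi> t)) (nhds s')"
      unfolding branch_germ_def by (intro filtermap_eventually_cong) (auto elim: eventually_mono)
    also have "\<dots> = branch_germ \<gamma> (\<phi> s')"
      using filtermap_nhds_injective[OF S(1) c i s'] by (simp add: branch_germ_def flip: filtermap_filtermap)
    finally show ?thesis using \<phi>(1)[OF s'] \<eta>(2) by fastforce
  qed
  then show "\<forall>\<^sub>F s' in nhds 0. branch_germ \<delta> s' \<in> branch_germ \<gamma> ` V"
    unfolding eventually_nhds using S by blast
qed

text \<open>The topology tests openness only at base points of parametrizations; shifting the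
  parameter turns any \<open>s\<close> into a base point.\<close>

lemma continuous_map_branch_germ:
  assumes g: "good_radius X \<gamma> r"
  shows "continuous_map (top_of_set {-r<..<r}) (normalization X) (branch_germ \<gamma>)"
  unfolding continuous_map_def
proof (intro conjI allI impI)
  show "branch_germ \<gamma> \<in> topspace (top_of_set {-r<..<r}) \<rightarrow> topspace (normalization X)"
    using branch_germ_in_branches[OF g] by (auto simp: topspace_normalization abs_less_iff)
  fix W assume W: "openin (normalization X) W"
  have "open {s \<in> {-r<..<r}. branch_germ \<gamma> s \<in> W}"
  proof (subst open_subopen, intro ballI)
    fix s assume "s \<in> {s \<in> {-r<..<r}. branch_germ \<gamma> s \<in> W}"
    then have s: "s \<in> {-r<..<r}" "branch_germ \<gamma> s \<in> W" by auto
    then have "branch_param X (\<lambda>t. \<gamma> (s + t))" using g by (auto simp: good_radius_def abs_less_iff)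
    moreover have "branch_germ (\<lambda>t. \<gamma> (s + t)) 0 \<in> W" using s by (simp add: branch_germ_shift)
    ultimately have "\<forall>\<^sub>F t in nhds 0. branch_germ (\<lambda>t. \<gamma> (s + t)) t \<in> W"
      using W by (auto simp: openin_normalization)
    then have "\<forall>\<^sub>F t in nhds 0. branch_germ \<gamma> (s + t) \<in> W" by (simp add: branch_germ_shift)
    then have "\<forall>\<^sub>F t in nhds s. branch_germ \<gamma> (s + (t - s)) \<in> W"
      using isCont_imp_tendsto_nhds[of s "\<lambda>t. t - s" 0] by (auto simp: filterlim_iff)
    moreover have "\<forall>\<^sub>F t in nhds s. t \<in> {-r<..<r}" using s(1) by (intro eventually_nhds_in_open) auto
    ultimately have "\<forall>\<^sub>F t in nhds s. t \<in> {s \<in> {-r<..<r}. branch_germ \<gamma> s \<in> W}" by eventually_elim simp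
    then show "\<exists>T. open T \<and> s \<in> T \<and> T \<subseteq> {s \<in> {-r<..<r}. branch_germ \<gamma> s \<in> W}"
      by (auto simp: eventually_nhds)
  qed
  then have "openin (top_of_set {-r<..<r}) ({-r<..<r} \<inter> {s \<in> {-r<..<r}. branch_germ \<gamma> s \<in> W})"
    by (rule openin_open_Int)
  also have "{-r<..<r} \<inter> {s \<in> {-r<..<r}. branch_germ \<gamma> s \<in> W} = {s \<in> {-r<..<r}. branch_germ \<gamma> s \<in> W}" by blast
  finally show "openin (top_of_set {-r<..<r}) {s \<in> topspace (top_of_set {-r<..<r}). branch_germ \<gamma> s \<in> W}" by simp
qed

text \<open>Continuity of the chart pulls neighbourhoods in the normalization back to the interval,
  openness pushes them forward; local extrema can thus be computed in a parameter.\<close>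

lemma local_maxima_chart_iff:
  assumes g: "good_radius X \<gamma> r" and s: "s \<in> {-r<..<r}"
  shows "branch_germ \<gamma> s \<in> local_maxima (normalization X) (\<lambda>P. f (centre P)) \<longleftrightarrow>
    s \<in> local_maxima (top_of_set {-r<..<r}) (\<lambda>t. f (\<gamma> t))"
proof -
  have c: "centre (branch_germ \<gamma> t) = \<gamma> t" if "t \<in> {-r<..<r}" for t
    using centre_branch_germ g that by (auto simp: good_radius_def abs_less_iff)
  show ?thesis
  proof
    assume "branch_germ \<gamma> s \<in> local_maxima (normalization X) (\<lambda>P. f (centre P))"
    then obtain W where W: "openin (normalization X) W" "branch_germ \<gamma> s \<in> W"
      "\<And>Q. Q \<in> W \<Longrightarrow> f (centre Q) \<le> f (centre (branch_germ \<gamma> s))" by (auto simp: local_maxima_def)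
    have "openin (top_of_set {-r<..<r}) {t \<in> topspace (top_of_set {-r<..<r}). branch_germ \<gamma> t \<in> W}"
      using continuous_map_branch_germ[OF g] W(1) by (rule openin_continuous_map_preimage)
    moreover have "f (\<gamma> t) \<le> f (\<gamma> s)" if "t \<in> {-r<..<r}" "branch_germ \<gamma> t \<in> W" for t
      using W(3)[OF that(2)] c[OF that(1)] c[OF s] by simp
    ultimately show "s \<in> local_maxima (top_of_set {-r<..<r}) (\<lambda>t. f (\<gamma> t))"
      unfolding local_maxima_def using s W(2) by fastforce
  next
    assume "s \<in> local_maxima (top_of_set {-r<..<r}) (\<lambda>t. f (\<gamma> t))"
    then obtain V where V: "openin (top_of_set {-r<..<r}) V" "s \<in> V" "\<And>t. t \<in> V \<Longrightarrow> f (\<gamma> t) \<le> f (\<gamma> s)"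
      by (auto simp: local_maxima_def)
    then have V': "open V" "V \<subseteq> {-r<..<r}" by (auto simp: openin_open_eq)
    have "openin (normalization X) (branch_germ \<gamma> ` V)" using openin_branch_chart[OF g V'] .
    moreover have "f (centre (branch_germ \<gamma> t)) \<le> f (centre (branch_germ \<gamma> s))" if "t \<in> V" for t
      using V(3)[OF that] V'(2) that c s by (auto simp: subset_iff)
    ultimately show "branch_germ \<gamma> s \<in> local_maxima (normalization X) (\<lambda>P. f (centre P))"
      unfolding local_maxima_def using V(2) by fastforce
  qed
qed

lemma connectedin_branch_chart:
  assumes "good_radius X \<gamma> r" shows "connectedin (normalization X) (branch_germ \<gamma> ` {-r<..<r})"
  using connectedin_continuous_map_image[OF continuous_map_branch_germ[OF assms], of "{-r<..<r}"]
  by (simp add: connectedin_subtopology)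

text \<open>This covers arcs with constant first coordinate, to which the power normal form does not
  apply. The second coordinate is then a local homeomorphism, so the germ is that of the vertical
  line.\<close>

lemma vertical_branch_germ:
  assumes "branch_param X \<gamma>" "\<forall>\<^sub>F t in nhds 0. fst (\<gamma> t) = a"
  shows "branch_germ \<gamma> 0 = filtermap (\<lambda>y. (a, y)) (nhds (snd (\<gamma> 0)))"
proof -
  obtain r where r: "good_radius X \<gamma> r" using assms(1) branch_param_imp_good_radius by blast
  obtain d where d: "d > 0" "\<And>t. \<bar>t\<bar> < d \<Longrightarrow> fst (\<gamma> t) = a"
    using assms(2) by (auto simp: eventually_nhds_metric dist_real_def)
  define S where "S = {- min d r<..<min d r}"
  have S: "open S" "0 \<in> S" using d(1) r by (auto simp: S_def good_radius_def)
  have fS: "fst (\<gamma> t) = a" "isCont \<gamma> t" "t \<in> {-r<..<r}" if "t \<in> S" for t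
    using that d(2)[of t] r by (auto simp: S_def good_radius_def abs_less_iff)
  have "continuous_on S (\<lambda>t. snd (\<gamma> t))"
    using fS(2) by (intro continuous_on_snd continuous_at_imp_continuous_on) auto
  moreover have "inj_on (\<lambda>t. snd (\<gamma> t)) S"
  proof (rule inj_onI)
    fix t u assume *: "t \<in> S" "u \<in> S" "snd (\<gamma> t) = snd (\<gamma> u)"
    then have "\<gamma> t = \<gamma> u" using fS(1) by (metis prod_eqI)
    then show "t = u" using fS(3) * r by (auto simp: good_radius_def dest: inj_onD)
  qed
  ultimately have *: "filtermap (\<lambda>t. snd (\<gamma> t)) (nhds 0) = nhds (snd (\<gamma> 0))"
    using S by (intro filtermap_nhds_injective[of S]) auto
  have "branch_germ \<gamma> 0 = filtermap (\<lambda>t. (a, snd (\<gamma> t))) (nhds 0)"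
    unfolding branch_germ_def using assms(2)
    by (intro filtermap_eventually_cong) (auto simp: prod_eq_iff elim: eventually_mono)
  also have "\<dots> = filtermap (\<lambda>y. (a, y)) (filtermap (\<lambda>t. snd (\<gamma> t)) (nhds 0))" by (simp add: filtermap_filtermap)
  finally show ?thesis by (simp add: *)
qed

lemma branches_share_germ:
  assumes g: "branch_param X \<gamma>" and d: "branch_param X \<delta>" and "\<gamma> 0 = \<delta> 0"
    and share: "\<And>r. r > 0 \<Longrightarrow> \<exists>s s'. s \<noteq> 0 \<and> s' \<noteq> 0 \<and> \<bar>s\<bar> < r \<and> \<bar>s'\<bar> < r \<and> \<gamma> s = \<delta> s'"
  shows "branch_germ \<gamma> 0 = branch_germ \<delta> 0"
proof -
  \<comment> \<open>One branch keeps its first coordinate while the other leaves that value at once,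
    so they cannot share points away from the centre at all scales.\<close>
  have mixed: False
    if mx: "branch_param X \<delta>" "\<gamma> 0 = \<delta> 0" "\<And>r. r > 0 \<Longrightarrow> \<exists>s s'. s \<noteq> 0 \<and> s' \<noteq> 0 \<and> \<bar>s\<bar> < r \<and> \<bar>s'\<bar> < r \<and> \<gamma> s = \<delta> s'"
      "\<forall>\<^sub>F t in nhds 0. fst (\<gamma> t) = fst (\<gamma> 0)" "\<not> (\<forall>\<^sub>F t in nhds 0. fst (\<delta> t) = fst (\<delta> 0))" for \<gamma> \<delta> :: "real \<Rightarrow> real \<times> real"
  proof -
    have "real_analytic_at (\<lambda>t. fst (\<delta> t) - fst (\<delta> 0)) 0"
      using mx(1) by (auto simp: branch_param_def analytic_arc_iff_real_analytic intro: real_analytic_diff)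
    then have "\<forall>\<^sub>F t in at 0. fst (\<delta> t) - fst (\<delta> 0) \<noteq> 0" by (rule real_analytic_isolated_zeros) (use mx(5) in simp)
    then obtain e where e: "e > 0" "\<And>t. t \<noteq> 0 \<Longrightarrow> \<bar>t\<bar> < e \<Longrightarrow> fst (\<delta> t) \<noteq> fst (\<delta> 0)"
      by (auto simp: eventually_at dist_real_def)
    obtain e' where e': "e' > 0" "\<And>t. \<bar>t\<bar> < e' \<Longrightarrow> fst (\<gamma> t) = fst (\<gamma> 0)"
      using mx(4) by (auto simp: eventually_nhds_metric dist_real_def)
    obtain s s' where "s \<noteq> 0" "s' \<noteq> 0" "\<bar>s\<bar> < min e e'" "\<bar>s'\<bar> < min e e'" "\<gamma> s = \<delta> s'"
      using mx(3)[of "min e e'"] e(1) e'(1) by auto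
    then show False using e(2)[of s'] e'(2)[of s] mx(2) by simp
  qed
  have share': "\<exists>s s'. s \<noteq> 0 \<and> s' \<noteq> 0 \<and> \<bar>s\<bar> < r \<and> \<bar>s'\<bar> < r \<and> \<delta> s = \<gamma> s'" if "r > 0" for r
    using share[OF that] by metis
  consider "\<forall>\<^sub>F t in nhds 0. fst (\<gamma> t) = fst (\<gamma> 0)" "\<forall>\<^sub>F t in nhds 0. fst (\<delta> t) = fst (\<delta> 0)"
    | "\<not> (\<forall>\<^sub>F t in nhds 0. fst (\<gamma> t) = fst (\<gamma> 0))" "\<not> (\<forall>\<^sub>F t in nhds 0. fst (\<delta> t) = fst (\<delta> 0))"
    using mixed[OF d assms(3) share] mixed[OF g assms(3)[symmetric] share'] by blast
  then show ?thesis
  proof cases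
    case 1
    show ?thesis
      using vertical_branch_germ[OF g 1(1)] vertical_branch_germ[OF d 1(2)] assms(3) by simp
  next
    case 2
    show ?thesis
      by (rule analytic_arcs_share_germ) (use g d assms(3) share 2 in \<open>auto simp: branch_param_def\<close>)
  qed
qed

text \<open>With a common centre this is the contrapositive of the sharing lemma, with injectivity
  excluding that just one parameter is 0; with different centres it is continuity. The disjunction
  in the premise exempts only the common centre itself.\<close>

lemma distinct_branches_disjoint:
  assumes g: "branch_param X \<gamma>" and d: "branch_param X \<delta>" and ne: "branch_germ \<gamma> 0 \<noteq> branch_germ \<delta> 0"
  shows "\<exists>r>0. \<forall>s s'. \<bar>s\<bar> < r \<and> \<bar>s'\<bar> < r \<and> (\<gamma> 0 \<noteq> \<delta> 0 \<or> s \<noteq> 0 \<or> s' \<noteq> 0) \<longrightarrow> \<gamma> s \<noteq> \<delta> s'"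
proof -
  obtain r1 r2 where r: "good_radius X \<gamma> r1" "good_radius X \<delta> r2"
    using g d branch_param_imp_good_radius by metis
  then have c: "isCont \<gamma> 0" "isCont \<delta> 0" by (auto simp: good_radius_def)
  show ?thesis
  proof (cases "\<gamma> 0 = \<delta> 0")
    case True
    then obtain r where r3: "r > 0" "\<And>s s'. s \<noteq> 0 \<Longrightarrow> s' \<noteq> 0 \<Longrightarrow> \<bar>s\<bar> < r \<Longrightarrow> \<bar>s'\<bar> < r \<Longrightarrow> \<gamma> s \<noteq> \<delta> s'"
      using branches_share_germ[OF g d] ne by blast
    have "\<gamma> s \<noteq> \<delta> s'" if "\<bar>s\<bar> < min r (min r1 r2)" "\<bar>s'\<bar> < min r (min r1 r2)" "s \<noteq> 0 \<or> s' \<noteq> 0" for s s'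
    proof
      assume e: "\<gamma> s = \<delta> s'"
      then have "s = 0 \<or> s' = 0" using r3(2)[of s s'] that by auto
      moreover have "s' = 0" if "s = 0"
        using inj_onD[of \<delta> "{-r2<..<r2}" s' 0] r(2) e True that \<open>\<bar>s'\<bar> < _\<close> by (auto simp: good_radius_def abs_less_iff)
      moreover have "s = 0" if "s' = 0"
        using inj_onD[of \<gamma> "{-r1<..<r1}" s 0] r(1) e True that \<open>\<bar>s\<bar> < _\<close> by (auto simp: good_radius_def abs_less_iff)
      ultimately show False using that(3) by blast
    qed
    then show ?thesis using True r r3(1) by (intro exI[of _ "min r (min r1 r2)"]) (auto simp: good_radius_def)
  next
    case False
    define e where "e = dist (\<gamma> 0) (\<delta> 0) / 2"
    have e: "e > 0" using False by (simp add: e_def)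
    have "\<forall>\<^sub>F s in nhds 0. dist (\<gamma> s) (\<gamma> 0) < e" "\<forall>\<^sub>F s in nhds 0. dist (\<delta> s) (\<delta> 0) < e"
      using isCont_imp_tendsto_nhds[OF c(1) refl] isCont_imp_tendsto_nhds[OF c(2) refl] e by (auto dest: tendstoD)
    then have "\<forall>\<^sub>F s in nhds 0. dist (\<gamma> s) (\<gamma> 0) < e \<and> dist (\<delta> s) (\<delta> 0) < e" by (rule eventually_conj)
    then obtain r where r: "r > 0" "\<And>s. \<bar>s\<bar> < r \<Longrightarrow> dist (\<gamma> s) (\<gamma> 0) < e \<and> dist (\<delta> s) (\<delta> 0) < e"
      by (auto simp: eventually_nhds_metric dist_real_def)
    have "\<gamma> s \<noteq> \<delta> s'" if "\<bar>s\<bar> < r" "\<bar>s'\<bar> < r" for s s'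
    proof
      assume "\<gamma> s = \<delta> s'"
      then have "dist (\<gamma> 0) (\<delta> 0) \<le> dist (\<gamma> s) (\<gamma> 0) + dist (\<delta> s') (\<delta> 0)"
        by (metis dist_commute dist_triangle)
      then show False using r(2)[OF that(1)] r(2)[OF that(2)] by (simp add: e_def)
    qed
    with r(1) show ?thesis by blast
  qed
qed

section \<open>Plane algebraic curves\<close>

lemma poly2_pCons: "poly2 (pCons a P) y = poly a (fst y) + snd y * poly2 P y"
  by (simp add: poly2_def)

lemma poly2_0 [simp]: "poly2 0 y = 0" by (simp add: poly2_def)
lemma poly2_1 [simp]: "poly2 1 y = 1" by (simp add: poly2_def)
lemma poly2_const: "poly2 [:a:] y = poly a (fst y)" by (simp add: poly2_def)
lemma poly2_add: "poly2 (P + Q) y = poly2 P y + poly2 Q y" by (simp add: poly2_def)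
lemma poly2_diff: "poly2 (P - Q) y = poly2 P y - poly2 Q y" by (simp add: poly2_def)
lemma poly2_mult: "poly2 (P * Q) y = poly2 P y * poly2 Q y" by (simp add: poly2_def)

section \<open>Vertical sections and elimination\<close>

definition slice :: "real \<Rightarrow> real poly poly \<Rightarrow> real poly"
  where "slice a P = map_poly (\<lambda>c. poly c a) P"

lemma poly_slice: "poly (slice a P) b = poly2 P (a, b)"
  by (induction P) (auto simp: slice_def map_poly_pCons poly2_pCons)

lemma slice_eq_0_iff: "slice a P = 0 \<longleftrightarrow> [:[:-a, 1:]:] dvd P"
proof -
  have "slice a P = 0 \<longleftrightarrow> (\<forall>n. poly (coeff P n) a = 0)"
    by (simp add: slice_def poly_eq_iff coeff_map_poly)
  then show ?thesis by (simp add: const_poly_dvd_iff poly_eq_0_iff_dvd)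
qed

lemma finite_slice_eq_0: assumes "P \<noteq> 0" shows "finite {a. slice a P = 0}"
proof (rule finite_subset)
  show "{a. slice a P = 0} \<subseteq> {a. poly (lead_coeff P) a = 0}"
    by (auto simp: slice_def poly_eq_iff coeff_map_poly)
  show "finite {a. poly (lead_coeff P) a = 0}" using assms by (simp add: poly_roots_finite)
qed

lemma vertical_section:
  assumes "slice a P \<noteq> 0"
  shows "finite {y \<in> curve P. fst y = a}" "card {y \<in> curve P. fst y = a} \<le> degree P"
proof -
  have eq: "{y \<in> curve P. fst y = a} = Pair a ` {b. poly (slice a P) b = 0}"
    by (auto simp: curve_def poly_slice image_iff)
  show "finite {y \<in> curve P. fst y = a}" unfolding eq using poly_roots_finite[OF assms] by (rule finite_imageI)
  have "card {y \<in> curve P. fst y = a} \<le> card {b. poly (slice a P) b = 0}"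
    unfolding eq using poly_roots_finite[OF assms] by (rule card_image_le)
  also have "\<dots> \<le> degree (slice a P)" using assms by (rule card_poly_roots_bound)
  also have "\<dots> \<le> degree P" unfolding slice_def by (rule degree_le) (simp add: coeff_map_poly coeff_eq_0)
  finally show "card {y \<in> curve P. fst y = a} \<le> degree P" .
qed

text \<open>Elimination of the second variable. The coefficient ring \<open>R[X]\<close> is not a
  field, so an element \<open>\<Delta>\<close> of least degree in the ideal of \<open>\<Psi>\<close>
  and \<open>\<Theta>\<close> divides members only after multiplication by some nonzero
  \<open>k\<close> in \<open>R[X]\<close>; primality of \<open>\<Psi>\<close> removes this factor
  again, in the manner of the lemma of Gauss.\<close>

lemma irreducible_bezout:
  fixes \<Psi> \<Theta> :: "real poly poly"
  assumes "irreducible \<Psi>" "\<not> \<Psi> dvd \<Theta>"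
  shows "\<exists>A B r. r \<noteq> 0 \<and> A * \<Psi> + B * \<Theta> = [:r:]"
proof -
  define I where "I = {\<Delta>. \<Delta> \<noteq> 0 \<and> (\<exists>A B. \<Delta> = A * \<Psi> + B * \<Theta>)}"
  have nz: "\<Psi> \<noteq> 0" using assms(1) by auto
  have id: "\<exists>A B. \<Psi> = A * \<Psi> + B * \<Theta>" "\<exists>A B. \<Theta> = A * \<Psi> + B * \<Theta>"
    by (rule exI[of _ 1], rule exI[of _ 0], simp) (rule exI[of _ 0], rule exI[of _ 1], simp)
  have "\<Psi> \<in> I" unfolding I_def using nz id(1) by blast
  then obtain \<Delta> where \<Delta>: "\<Delta> \<in> I" "\<And>D. D \<in> I \<Longrightarrow> degree \<Delta> \<le> degree D"
    by (metis arg_min_natI[of "\<lambda>D. D \<in> I" \<Psi> degree] arg_min_nat_le[of "\<lambda>D. D \<in> I" _ degree])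
  obtain A B where AB: "\<Delta> = A * \<Psi> + B * \<Theta>" and d0: "\<Delta> \<noteq> 0" using \<Delta>(1) by (auto simp: I_def)
  \<comment> \<open>Pseudo-division leaves a remainder in the ideal of smaller degree than
    \<open>\<Delta>\<close>, which must be 0.\<close>
  have div: "\<exists>k. k \<noteq> 0 \<and> \<Delta> dvd smult k D" if D: "\<exists>A B. D = A * \<Psi> + B * \<Theta>" for D
  proof -
    obtain Q R where QR: "pseudo_divmod D \<Delta> = (Q, R)" by force
    define k where "k = coeff \<Delta> (degree \<Delta>) ^ (Suc (degree D) - degree \<Delta>)"
    have e: "smult k D = \<Delta> * Q + R" "R = 0 \<or> degree R < degree \<Delta>"
      using pseudo_divmod[OF d0 QR] by (auto simp: k_def)
    obtain A' B' where D': "D = A' * \<Psi> + B' * \<Theta>" using D by blast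
    have "R = smult k D - \<Delta> * Q" using e(1) by simp
    also have "\<dots> = (smult k A' - Q * A) * \<Psi> + (smult k B' - Q * B) * \<Theta>"
      by (simp add: D' AB algebra_simps smult_add_right)
    finally have "\<exists>A B. R = A * \<Psi> + B * \<Theta>" by blast
    then have "R = 0" using e(2) \<Delta>(2)[of R] unfolding I_def by (metis (mono_tags, lifting) leD mem_Collect_eq)
    moreover have "k \<noteq> 0" using d0 by (simp add: k_def)
    ultimately show ?thesis using e(1) by (intro exI[of _ k]) auto
  qed
  obtain k where k: "k \<noteq> 0" "\<Delta> dvd smult k \<Psi>" using div[OF id(1)] by blast
  obtain l where l: "l \<noteq> 0" "\<Delta> dvd smult l \<Theta>"
    using div[OF id(2)] by blast
  have prime: "prime_elem \<Psi>" using assms(1) by (simp add: prime_elem_iff_irreducible)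
  show ?thesis
  \<comment> \<open>In degree 0, \<open>\<Psi>\<close> is itself the required polynomial in the
    first variable. Otherwise it divides no nonzero polynomial of that kind, which permits
    cancelling such factors.\<close>
  proof (cases "degree \<Psi> = 0")
    case True
    then obtain r where "\<Psi> = [:r:]" by (rule degree_eq_zeroE)
    moreover from this have "1 * \<Psi> + 0 * \<Theta> = [:r:]" by simp
    ultimately show ?thesis using nz by (metis pCons_0_0)
  next
    case False
    have const: "\<not> \<Psi> dvd [:c:]" if "c \<noteq> 0" for c
    proof
      assume "\<Psi> dvd [:c:]"
      then have "degree \<Psi> \<le> degree [:c:]" using that by (intro dvd_imp_degree_le) auto
      with False show False by simp
    qed
    have cancel: "\<Psi> dvd D" if "\<Psi> dvd smult c D" "c \<noteq> 0" for c D
      using that const[of c] prime_elem_dvd_multD[OF prime, of "[:c:]" D] by auto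
    obtain Q where Q: "smult k \<Psi> = \<Delta> * Q" using k(2) by auto
    have "\<not> \<Psi> dvd \<Delta>"
    proof
      assume "\<Psi> dvd \<Delta>"
      then have "\<Psi> dvd smult l \<Theta>" using l(2) by (rule dvd_trans)
      then show False using cancel l(1) assms(2) by blast
    qed
    \<comment> \<open>Since the prime \<open>\<Psi>\<close> does not divide \<open>\<Delta>\<close>,
      it divides \<open>Q\<close>; cancelling \<open>\<Psi>\<close> makes \<open>\<Delta>\<close> a
      divisor of the nonzero \<open>[:k:]\<close>, hence of degree 0.\<close>
    moreover have "\<Psi> dvd \<Delta> * Q" by (metis Q dvd_refl dvd_smult)
    ultimately have "\<Psi> dvd Q" using prime_elem_dvd_multD[OF prime] by blast
    then obtain Q' where "Q = \<Psi> * Q'" by auto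
    with Q have "\<Psi> * [:k:] = \<Psi> * (\<Delta> * Q')" by (simp add: mult_ac)
    then have "[:k:] = \<Delta> * Q'" using nz by (metis mult_left_cancel)
    then have "degree \<Delta> + degree Q' = 0"
      using k(1) d0 by (metis degree_mult_eq degree_pCons_0 mult_zero_right pCons_eq_0_iff)
    then obtain r where "\<Delta> = [:r:]" by (auto elim: degree_eq_zeroE)
    then show ?thesis using AB d0 by (metis pCons_0_0)
  qed
qed

text \<open>The eliminant \<open>r\<close> bounds the possible first coordinates, and each vertical
  line carries finitely many common zeros because it is not a component of both curves.\<close>

lemma finite_common_zeros:
  fixes \<Psi> \<Theta> :: "real poly poly"
  assumes "irreducible \<Psi>" "\<not> \<Psi> dvd \<Theta>"
  shows "finite (curve \<Psi> \<inter> curve \<Theta>)"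
proof -
  obtain A B r where r: "r \<noteq> 0" "A * \<Psi> + B * \<Theta> = [:r:]" using irreducible_bezout[OF assms] by blast
  have root: "poly r (fst y) = 0" if "y \<in> curve \<Psi> \<inter> curve \<Theta>" for y
    using arg_cong[OF r(2), of "\<lambda>P. poly2 P y"] that by (simp add: poly2_add poly2_mult poly2_const curve_def)
  have fin: "finite {y \<in> curve \<Psi> \<inter> curve \<Theta>. fst y = a}" for a
  proof (cases "slice a \<Psi> = 0")
    case False
    show ?thesis by (rule finite_subset[OF _ vertical_section(1)[OF False]]) auto
  next
    \<comment> \<open>Here \<open>\<Psi>\<close> is, up to a unit, the equation of the vertical
      line; \<open>\<Theta>\<close> is not divisible by it and so has only finitely many zeros on
      that line.\<close>
    case True
    then obtain Q where Q: "\<Psi> = [:[:-a, 1:]:] * Q" unfolding slice_eq_0_iff by (rule dvdE)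
    have "\<not> is_unit [:[:-a, 1:]:]" by (simp add: is_unit_const_poly_iff is_unit_poly_iff)
    then have "is_unit Q" using irreducibleD[OF assms(1) Q] by blast
    then have "\<Psi> dvd [:[:-a, 1:]:]" using Q by (metis dvd_refl dvd_mult_unit_iff)
    then have "slice a \<Theta> \<noteq> 0" using assms(2) unfolding slice_eq_0_iff by (metis dvd_trans)
    then show ?thesis by (intro finite_subset[OF _ vertical_section(1)]) auto
  qed
  have "curve \<Psi> \<inter> curve \<Theta> \<subseteq> (\<Union>a\<in>{a. poly r a = 0}. {y \<in> curve \<Psi> \<inter> curve \<Theta>. fst y = a})"
    using root by auto
  then show ?thesis by (rule finite_subset) (use fin poly_roots_finite[OF r(1)] in auto)
qed

lemma poly2_has_derivative:
  "(poly2 P has_derivative (\<lambda>h. poly2 (map_poly pderiv P) y * fst h + poly2 (pderiv P) y * snd h)) (at y)"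
  for y :: "real \<times> real"
proof (induction P)
  case 0
  have "poly2 0 = (\<lambda>_::real\<times>real. 0)" by auto
  then show ?case by simp
next
  case (pCons a P)
  have eq: "poly2 (pCons a P) = (\<lambda>y. poly a (fst y) + snd y * poly2 P y)" by (auto simp: poly2_pCons)
  have "((\<lambda>y. poly a (fst y)) has_derivative (\<lambda>h. fst h * poly (pderiv a) (fst y))) (at y)"
    using has_derivative_compose[OF has_derivative_fst[OF has_derivative_ident]
      poly_DERIV[of a "fst y", unfolded has_field_derivative_def]] by (simp add: mult.commute)
  from has_derivative_add[OF this has_derivative_mult[OF has_derivative_snd[OF has_derivative_ident] pCons.IH]]
  show ?case unfolding eq
    by (rule has_derivative_eq_rhs)
       (auto simp: map_poly_pCons poly2_pCons pderiv_pCons poly2_add algebra_simps)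
qed

lemma isCont_poly2 [simp]: "isCont (poly2 P) y" for y :: "real \<times> real"
  using poly2_has_derivative has_derivative_continuous by blast

section \<open>Polynomials along branches, and the number of branches at a point\<close>

lemma real_analytic_poly: "real_analytic_at f s \<Longrightarrow> real_analytic_at (\<lambda>t. poly a (f t)) s"
  by (induction a) (auto intro: real_analytic_add real_analytic_mult)

lemma real_analytic_poly2: "real_analytic_at (\<lambda>t. fst (\<gamma> t)) s \<Longrightarrow> real_analytic_at (\<lambda>t. snd (\<gamma> t)) s \<Longrightarrow> real_analytic_at (\<lambda>t. poly2 P (\<gamma> t)) s"
  by (induction P) (auto simp: poly2_pCons intro: real_analytic_add real_analytic_mult real_analytic_poly)

lemma branch_real_analytic:
  assumes "branch_param X \<gamma>"
  shows "real_analytic_at (\<lambda>t. fst (\<gamma> t)) 0" "real_analytic_at (\<lambda>t. snd (\<gamma> t)) 0" "real_analytic_at (\<lambda>t. poly2 P (\<gamma> t)) 0"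
  using assms by (auto simp: branch_param_def analytic_arc_iff_real_analytic intro: real_analytic_poly2)

lemma good_radius_in: "good_radius X \<gamma> r \<Longrightarrow> \<bar>s\<bar> < r \<Longrightarrow> \<gamma> s \<in> X"
  by (auto simp: good_radius_def branch_param_def dest!: spec[of _ s] eventually_nhds_x_imp_x)

text \<open>The intermediate value theorem applied to the distance from the vertical line through
  the centre. The absolute value is taken because the side on which the branch leaves is
  unknown.\<close>

lemma branch_hits_vertical:
  assumes g: "branch_param X \<gamma>" and r: "good_radius X \<gamma> r" and nz: "\<not> (\<forall>\<^sub>F t in nhds 0. fst (\<gamma> t) = fst (\<gamma> 0))"
  shows "\<forall>\<^sub>F \<tau> in at_right 0. \<exists>s. \<bar>s\<bar> < r \<and> s \<noteq> 0 \<and> \<bar>fst (\<gamma> s) - fst (\<gamma> 0)\<bar> = \<tau>"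
proof -
  have "real_analytic_at (\<lambda>t. fst (\<gamma> t) - fst (\<gamma> 0)) 0" using branch_real_analytic[OF g] by (auto intro: real_analytic_diff)
  then have "\<forall>\<^sub>F t in at 0. fst (\<gamma> t) - fst (\<gamma> 0) \<noteq> 0" by (rule real_analytic_isolated_zeros) (use nz in simp)
  then obtain e where e: "e > 0" "\<And>t. t \<noteq> 0 \<Longrightarrow> \<bar>t\<bar> < e \<Longrightarrow> fst (\<gamma> t) \<noteq> fst (\<gamma> 0)"
    by (auto simp: eventually_at dist_real_def)
  define s1 where "s1 = min e r / 2"
  have s1: "0 < s1" "s1 < e" "s1 < r" using e(1) r by (auto simp: s1_def good_radius_def)
  define \<phi> where "\<phi> = (\<lambda>s. \<bar>fst (\<gamma> s) - fst (\<gamma> 0)\<bar>)"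
  have cont: "isCont \<phi> s" if "0 \<le> s" "s \<le> s1" for s
    unfolding \<phi>_def using r s1 that by (intro continuous_intros) (auto simp: good_radius_def)
  have "\<phi> s1 > 0" using e(2)[of s1] s1 by (simp add: \<phi>_def)
  then have "\<forall>\<^sub>F \<tau> in at_right 0. \<tau> \<in> {0<..<\<phi> s1}" by (rule eventually_at_right_real)
  then show ?thesis
  proof eventually_elim
    case (elim \<tau>)
    have "\<exists>s. 0 \<le> s \<and> s \<le> s1 \<and> \<phi> s = \<tau>"
      by (rule IVT) (use elim s1 cont in \<open>auto simp: \<phi>_def\<close>)
    then obtain s where s: "0 \<le> s" "s \<le> s1" "\<phi> s = \<tau>" by blast
    have "s \<noteq> 0" using s(3) elim by (auto simp: \<phi>_def)
    with s s1 show ?case by (intro exI[of _ s]) (auto simp: \<phi>_def)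
  qed
qed

text \<open>Each branch other than the vertical one meets one of the two vertical lines at a small
  distance \<open>\<tau>\<close>, and distinct branches do so in distinct points. Each of these
  lines meets the curve in at most \<open>degree \<Phi>\<close> points, so
  \<open>2 * degree \<Phi> + 1\<close> such branches are too many.\<close>

lemma finite_branches_at:
  assumes "\<Phi> \<noteq> 0" shows "finite {P \<in> branches (curve \<Phi>). centre P = y}"
proof (rule ccontr)
  define V where "V = filtermap (\<lambda>b. (fst y, b)) (nhds (snd y))"
  assume "infinite {P \<in> branches (curve \<Phi>). centre P = y}"
  then have "infinite ({P \<in> branches (curve \<Phi>). centre P = y} - {V})" by simp
  then obtain S where S: "S \<subseteq> {P \<in> branches (curve \<Phi>). centre P = y} - {V}" "finite S" "card S = 2 * degree \<Phi> + 1"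
    by (meson infinite_arbitrarily_large)
  have "\<exists>\<gamma>. P = branch_germ \<gamma> 0 \<and> branch_param (curve \<Phi>) \<gamma>" if "P \<in> S" for P
    using S(1) that by (auto simp: branches_def)
  then obtain g where g: "\<And>P. P \<in> S \<Longrightarrow> P = branch_germ (g P) 0" "\<And>P. P \<in> S \<Longrightarrow> branch_param (curve \<Phi>) (g P)"
    by metis
  have ev: "\<forall>\<^sub>F r in at_right 0. \<forall>P\<in>S. \<forall>Q\<in>S. P \<noteq> Q \<longrightarrow>
      (\<forall>s s'. \<bar>s\<bar> < r \<and> \<bar>s'\<bar> < r \<and> (g P 0 \<noteq> g Q 0 \<or> s \<noteq> 0 \<or> s' \<noteq> 0) \<longrightarrow> g P s \<noteq> g Q s')"
  proof (intro eventually_ball_finite S(2) ballI)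
    fix P Q assume PQ: "P \<in> S" "Q \<in> S"
    show "\<forall>\<^sub>F r in at_right 0. P \<noteq> Q \<longrightarrow>
      (\<forall>s s'. \<bar>s\<bar> < r \<and> \<bar>s'\<bar> < r \<and> (g P 0 \<noteq> g Q 0 \<or> s \<noteq> 0 \<or> s' \<noteq> 0) \<longrightarrow> g P s \<noteq> g Q s')"
    proof (cases "P = Q")
      case False
      then obtain r where r: "r > 0" "\<And>s s'. \<bar>s\<bar> < r \<Longrightarrow> \<bar>s'\<bar> < r \<Longrightarrow> (g P 0 \<noteq> g Q 0 \<or> s \<noteq> 0 \<or> s' \<noteq> 0) \<Longrightarrow> g P s \<noteq> g Q s'"
        using distinct_branches_disjoint[OF g(2)[OF PQ(1)] g(2)[OF PQ(2)]] g(1) PQ by metis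
      have "\<forall>\<^sub>F r' in at_right 0. r' \<in> {0<..<r}" using r(1) by (rule eventually_at_right_real)
      then show ?thesis by eventually_elim (meson greaterThanLessThan_iff order_less_trans r(2))
    qed simp
  qed
  have "\<forall>\<^sub>F r in at_right 0. \<forall>P\<in>S. good_radius (curve \<Phi>) (g P) r"
  proof (intro eventually_ball_finite S(2) ballI)
    fix P assume "P \<in> S"
    then obtain r where r: "good_radius (curve \<Phi>) (g P) r" using g(2) branch_param_imp_good_radius by blast
    then have "\<forall>\<^sub>F r' in at_right 0. r' \<in> {0<..<r}" by (intro eventually_at_right_real) (simp add: good_radius_def)
    then show "\<forall>\<^sub>F r in at_right 0. good_radius (curve \<Phi>) (g P) r"
      by eventually_elim (use good_radius_mono[OF r] in auto)
  qed
  from eventually_happens'[OF trivial_limit_at_right_real eventually_conj[OF ev this]]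
  obtain r where r0: "(\<forall>P\<in>S. \<forall>Q\<in>S. P \<noteq> Q \<longrightarrow>
      (\<forall>s s'. \<bar>s\<bar> < r \<and> \<bar>s'\<bar> < r \<and> (g P 0 \<noteq> g Q 0 \<or> s \<noteq> 0 \<or> s' \<noteq> 0) \<longrightarrow> g P s \<noteq> g Q s')) \<and>
      (\<forall>P\<in>S. good_radius (curve \<Phi>) (g P) r)" by (rule exE)
  have gr: "good_radius (curve \<Phi>) (g P) r" if "P \<in> S" for P
    using conjunct2[OF r0] that by (rule bspec)
  have r: "g P s \<noteq> g Q s'" if "P \<in> S" "Q \<in> S" "P \<noteq> Q" "\<bar>s\<bar> < r" "\<bar>s'\<bar> < r" "s \<noteq> 0" for P Q s s'
    using conjunct1[OF r0, rule_format, of P Q s s'] that by simp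
  have centre: "g P 0 = y" if "P \<in> S" for P
  proof -
    have "isCont (g P) 0" using gr[OF that] by (simp add: good_radius_def)
    from centre_branch_germ[OF this] have "centre P = g P 0" by (simp flip: g(1)[OF that])
    then show ?thesis using S(1) that by auto
  qed
  have "\<forall>\<^sub>F \<tau> in at_right 0. \<forall>P\<in>S. \<exists>s. \<bar>s\<bar> < r \<and> s \<noteq> 0 \<and> \<bar>fst (g P s) - fst y\<bar> = \<tau>"
  proof (intro eventually_ball_finite S(2) ballI)
    fix P assume P: "P \<in> S"
    have "\<not> (\<forall>\<^sub>F t in nhds 0. fst (g P t) = fst (g P 0))"
    proof
      assume "\<forall>\<^sub>F t in nhds 0. fst (g P t) = fst (g P 0)"
      from vertical_branch_germ[OF g(2)[OF P] this] have "P = V"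
        by (simp add: V_def centre[OF P] flip: g(1)[OF P])
      then show False using S(1) P by blast
    qed
    from branch_hits_vertical[OF g(2)[OF P] gr[OF P] this]
    show "\<forall>\<^sub>F \<tau> in at_right 0. \<exists>s. \<bar>s\<bar> < r \<and> s \<noteq> 0 \<and> \<bar>fst (g P s) - fst y\<bar> = \<tau>"
      by (simp add: centre[OF P])
  qed
  moreover have "\<forall>\<^sub>F \<tau> in at_right 0. slice (fst y + \<tau>) \<Phi> \<noteq> 0 \<and> slice (fst y - \<tau>) \<Phi> \<noteq> 0"
  proof -
    \<comment> \<open>The finitely many excluded distances are those at which a whole vertical line
      lies on the curve.\<close>
    define B where "B = (\<lambda>a. a - fst y) ` {a. slice a \<Phi> = 0} \<union> (\<lambda>a. fst y - a) ` {a. slice a \<Phi> = 0}"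
    have "finite B" using finite_slice_eq_0[OF assms] by (simp add: B_def)
    then have "\<forall>\<^sub>F \<tau> in at 0. \<tau> \<notin> B" by (metis islimpt_finite islimpt_iff_eventually)
    then have "\<forall>\<^sub>F \<tau> in at_right 0. \<tau> \<notin> B" by (simp add: eventually_at_split)
    then show ?thesis by eventually_elim (force simp: B_def)
  qed
  ultimately have ev': "\<forall>\<^sub>F \<tau> in at_right 0. (\<forall>P\<in>S. \<exists>s. \<bar>s\<bar> < r \<and> s \<noteq> 0 \<and> \<bar>fst (g P s) - fst y\<bar> = \<tau>) \<and>
    slice (fst y + \<tau>) \<Phi> \<noteq> 0 \<and> slice (fst y - \<tau>) \<Phi> \<noteq> 0" by (rule eventually_conj)
  from eventually_happens'[OF trivial_limit_at_right_real this] obtain \<tau> where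
    \<tau>0: "(\<forall>P\<in>S. \<exists>s. \<bar>s\<bar> < r \<and> s \<noteq> 0 \<and> \<bar>fst (g P s) - fst y\<bar> = \<tau>) \<and>
      slice (fst y + \<tau>) \<Phi> \<noteq> 0 \<and> slice (fst y - \<tau>) \<Phi> \<noteq> 0" by (rule exE)
  then have \<tau>: "\<And>P. P \<in> S \<Longrightarrow> \<exists>s. \<bar>s\<bar> < r \<and> s \<noteq> 0 \<and> \<bar>fst (g P s) - fst y\<bar> = \<tau>"
    "slice (fst y + \<tau>) \<Phi> \<noteq> 0" "slice (fst y - \<tau>) \<Phi> \<noteq> 0" by simp_all
  from bchoice[OF conjunct1[OF \<tau>0]]
  obtain \<theta> where \<theta>: "\<forall>P\<in>S. \<bar>\<theta> P\<bar> < r \<and> \<theta> P \<noteq> 0 \<and> \<bar>fst (g P (\<theta> P)) - fst y\<bar> = \<tau>" by (rule exE)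
  define T where "T = {z \<in> curve \<Phi>. fst z = fst y + \<tau>} \<union> {z \<in> curve \<Phi>. fst z = fst y - \<tau>}"
  have "inj_on (\<lambda>P. g P (\<theta> P)) S"
  proof (rule inj_onI, rule ccontr)
    fix P Q assume *: "P \<in> S" "Q \<in> S" "g P (\<theta> P) = g Q (\<theta> Q)" "P \<noteq> Q"
    show False using r[OF *(1,2,4), of "\<theta> P" "\<theta> Q"] bspec[OF \<theta> *(1)] bspec[OF \<theta> *(2)] *(3) by simp
  qed
  moreover have "(\<lambda>P. g P (\<theta> P)) ` S \<subseteq> T"
  proof
    fix z assume "z \<in> (\<lambda>P. g P (\<theta> P)) ` S"
    then obtain P where P: "P \<in> S" "z = g P (\<theta> P)" by blast
    then show "z \<in> T" using bspec[OF \<theta> P(1)] good_radius_in[OF gr[OF P(1)], of "\<theta> P"]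
      by (auto simp: T_def abs_if split: if_splits)
  qed
  moreover have "finite T" using vertical_section(1)[OF \<tau>(2)] vertical_section(1)[OF \<tau>(3)] by (simp add: T_def)
  ultimately have "card S \<le> card T" by (metis card_image card_mono)
  also have "\<dots> \<le> 2 * degree \<Phi>"
    unfolding T_def using card_Un_le vertical_section(2)[OF \<tau>(2)] vertical_section(2)[OF \<tau>(3)]
    by (smt (verit) add_mono le_trans mult_2)
  finally show False using S(3) by simp
qed

section \<open>Irreducible factors along branches and components\<close>

lemma real_analytic_prod_eq_0:
  assumes "real_analytic_at f 0" "real_analytic_at g 0" "\<forall>\<^sub>F t in nhds 0. f t * g t = 0"
  shows "(\<forall>\<^sub>F t in nhds 0. f t = 0) \<or> (\<forall>\<^sub>F t in nhds 0. g t = 0)"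
proof (rule ccontr)
  assume "\<not> ?thesis"
  then have "\<forall>\<^sub>F t in at 0. f t \<noteq> 0" "\<forall>\<^sub>F t in at 0. g t \<noteq> 0" using real_analytic_isolated_zeros assms by blast+
  moreover have "\<forall>\<^sub>F t in at 0. f t * g t = 0" using assms(3) by (simp add: eventually_at_filter eventually_mono)
  ultimately have "\<forall>\<^sub>F t in at (0::real). False" by eventually_elim simp
  then show False by simp
qed

text \<open>Germs of analytic functions have no zero divisors, so a product that vanishes on a
  branch has a prime factor that does.\<close>

lemma irreducible_factor_on_branch:
  assumes "\<Phi> \<noteq> 0" "branch_param X \<gamma>" "\<forall>\<^sub>F t in nhds 0. poly2 \<Phi> (\<gamma> t) = 0"
  shows "\<exists>\<Psi>. irreducible \<Psi> \<and> (\<forall>\<^sub>F t in nhds 0. poly2 \<Psi> (\<gamma> t) = 0)"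
proof -
  obtain A where A: "\<And>P. P \<in># A \<Longrightarrow> prime_elem P" "normalize (prod_mset A) = normalize \<Phi>"
    using prime_factorization_exists[OF assms(1)] by blast
  have "\<Phi> dvd prod_mset A" using A(2) by (metis associatedD2)
  then obtain Q where "prod_mset A = \<Phi> * Q" by auto
  then have "\<forall>\<^sub>F t in nhds 0. poly2 (prod_mset A) (\<gamma> t) = 0"
    using assms(3) by (auto simp: poly2_mult elim: eventually_mono)
  then have "\<exists>\<Psi>\<in>#A. \<forall>\<^sub>F t in nhds 0. poly2 \<Psi> (\<gamma> t) = 0"
  proof (induction A)
    case (add P A)
    then have "(\<forall>\<^sub>F t in nhds 0. poly2 P (\<gamma> t) = 0) \<or> (\<forall>\<^sub>F t in nhds 0. poly2 (prod_mset A) (\<gamma> t) = 0)"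
      by (intro real_analytic_prod_eq_0 branch_real_analytic[OF assms(2)]) (simp add: poly2_mult)
    with add.IH show ?case by auto
  qed simp
  then show ?thesis using A(1) by (meson prime_elem_iff_irreducible)
qed

text \<open>Analytic continuation: the branches on which \<open>\<Psi>\<close> vanishes form an open
  set, and so do the others because zeros are isolated. A connected set lies on one side.\<close>

lemma connected_branches_vanish:
  assumes C: "connectedin (normalization X) C" and "P0 \<in> C" "\<forall>\<^sub>F y in P0. poly2 \<Psi> y = 0" "P \<in> C"
  shows "\<forall>\<^sub>F y in P. poly2 \<Psi> y = (0::real)"
proof -
  define Z where "Z = {P \<in> branches X. \<forall>\<^sub>F y in P. poly2 \<Psi> y = (0::real)}"
  have open_branches: "openin (normalization X) (branches X)"
    using openin_topspace[of "normalization X"] by (simp add: topspace_normalization)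
  then have near: "\<forall>\<^sub>F s in nhds 0. branch_germ \<gamma> s \<in> branches X" if "branch_param X \<gamma>" for \<gamma>
    using that unfolding openin_normalization branches_def by blast
  have "openin (normalization X) Z"
    unfolding openin_normalization
  proof (intro conjI allI impI)
    fix \<gamma> assume g: "branch_param X \<gamma> \<and> branch_germ \<gamma> 0 \<in> Z"
    then have "\<forall>\<^sub>F s in nhds 0. \<forall>\<^sub>F t in nhds s. poly2 \<Psi> (\<gamma> t) = 0"
      by (simp add: Z_def branch_germ_def eventually_filtermap eventually_eventually)
    with near[of \<gamma>] g show "\<forall>\<^sub>F s in nhds 0. branch_germ \<gamma> s \<in> Z"
      by (auto simp: Z_def branch_germ_def eventually_filtermap elim: eventually_elim2)
  qed (auto simp: Z_def)
  moreover have "openin (normalization X) (branches X - Z)"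
    unfolding openin_normalization
  proof (intro conjI allI impI)
    fix \<gamma> assume g: "branch_param X \<gamma> \<and> branch_germ \<gamma> 0 \<in> branches X - Z"
    then have "\<not> (\<forall>\<^sub>F t in nhds 0. poly2 \<Psi> (\<gamma> t) = 0)"
      by (simp add: Z_def branch_germ_def eventually_filtermap)
    then have "\<forall>\<^sub>F t in at 0. poly2 \<Psi> (\<gamma> t) \<noteq> 0" using g branch_real_analytic by (intro real_analytic_isolated_zeros) auto
    then have "\<forall>\<^sub>F t in nhds 0. t \<noteq> 0 \<longrightarrow> poly2 \<Psi> (\<gamma> t) \<noteq> 0" by (simp add: eventually_at_filter)
    with near[of \<gamma>] g have "\<forall>\<^sub>F s in nhds 0. branch_germ \<gamma> s \<in> branches X \<and> (s \<noteq> 0 \<longrightarrow> poly2 \<Psi> (\<gamma> s) \<noteq> 0)"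
      by (auto intro: eventually_conj)
    then show "\<forall>\<^sub>F s in nhds 0. branch_germ \<gamma> s \<in> branches X - Z"
    proof eventually_elim
      case (elim s)
      have "\<not> (\<forall>\<^sub>F t in nhds s. poly2 \<Psi> (\<gamma> t) = 0)" if "s \<noteq> 0"
        using elim that eventually_nhds_x_imp_x[of "\<lambda>t. poly2 \<Psi> (\<gamma> t) = 0" s] by blast
      then have "branch_germ \<gamma> s \<notin> Z" if "s \<noteq> 0"
        using that by (simp add: Z_def branch_germ_def eventually_filtermap)
      then show ?case using elim g by (cases "s = 0") simp_all
    qed
  qed auto
  then have "closedin (normalization X) Z"
    by (auto simp: closedin_def topspace_normalization Z_def)
  ultimately have "C \<subseteq> Z \<or> disjnt C Z" using connectedin_clopen_cases[OF C] by blast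
  moreover have "P0 \<in> Z"
    using assms(2,3) connectedin_subset_topspace[OF C] by (auto simp: Z_def topspace_normalization)
  ultimately show ?thesis using assms(2,4) by (auto simp: disjnt_def Z_def)
qed

text \<open>The Jacobian determinant of \<open>(P, Q)\<close>; \<open>map_poly pderiv\<close>
  differentiates in the first coordinate and \<open>pderiv\<close> in the second. At smooth points
  of \<open>P = 0\<close> it vanishes where \<open>Q\<close> is critical along the curve.\<close>

definition jac :: "real poly poly \<Rightarrow> real poly poly \<Rightarrow> real poly poly"
  where "jac P Q = map_poly pderiv P * pderiv Q - pderiv P * map_poly pderiv Q"

text \<open>The injectivity part of the inverse function theorem; it requires an inverse of the
  differential at \<open>y\<close> and its continuity in operator norm.\<close>

lemma poly2_locally_injective:
  assumes "poly2 (jac P Q) y \<noteq> 0"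
  shows "\<exists>e>0. inj_on (\<lambda>z. (poly2 P z, poly2 Q z)) (ball y e)"
proof -
  define a b c d where "a = poly2 (map_poly pderiv P)" and "b = poly2 (pderiv P)"
    and "c = poly2 (map_poly pderiv Q)" and "d = poly2 (pderiv Q)"
  note abcd = a_def b_def c_def d_def
  define \<Delta> where "\<Delta> = a y * d y - b y * c y"
  have \<Delta>: "\<Delta> \<noteq> 0" using assms by (simp add: \<Delta>_def jac_def poly2_diff poly2_mult abcd)
  define f' where "f' = (\<lambda>z h. (a z * fst h + b z * snd h, c z * fst h + d z * snd h))"
  \<comment> \<open>The inverse of the differential by Cramer's rule.\<close>
  define g' where "g' = (\<lambda>h. ((d y * fst h - b y * snd h) / \<Delta>, (a y * snd h - c y * fst h) / \<Delta>))"
  have "\<exists>r. r > 0 \<and> ball y r \<subseteq> UNIV \<and> inj_on (\<lambda>z. (poly2 P z, poly2 Q z)) (ball y r)"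
  proof (rule has_derivative_locally_injective[of y UNIV g' f'])
    show "bounded_linear g'"
      unfolding g'_def divide_inverse
      by (intro bounded_linear_Pair bounded_linear_mult_left[THEN bounded_linear_compose[of "\<lambda>x. x * inverse \<Delta>"]]
         bounded_linear_sub bounded_linear_const_mult bounded_linear_fst bounded_linear_snd)
    show "g' \<circ> f' y = id"
      using \<Delta> by (auto simp: fun_eq_iff g'_def f'_def field_simps) (auto simp: \<Delta>_def algebra_simps)
    show "((\<lambda>z. (poly2 P z, poly2 Q z)) has_derivative f' x) (at x)" for x
      unfolding f'_def abcd by (intro has_derivative_Pair poly2_has_derivative)
    show "\<exists>\<delta>>0. \<forall>x. dist y x < \<delta> \<longrightarrow> onorm (\<lambda>v. f' x v - f' y v) < e" if "e > 0" for e
    proof -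
      \<comment> \<open>The sum of the changes of the four matrix entries bounds the operator norm
        of the difference and is continuous.\<close>
      define k where "k = (\<lambda>x. \<bar>a x - a y\<bar> + \<bar>b x - b y\<bar> + (\<bar>c x - c y\<bar> + \<bar>d x - d y\<bar>))"
      have "isCont k y" unfolding k_def abcd by (intro continuous_intros isCont_poly2)
      then have "(k \<longlongrightarrow> 0) (nhds y)" by (rule isCont_imp_tendsto_nhds) (simp add: k_def)
      then have "\<forall>\<^sub>F x in nhds y. k x < e" using that by (rule order_tendstoD)
      then obtain \<delta> where \<delta>: "\<delta> > 0" "\<And>x. dist x y < \<delta> \<Longrightarrow> k x < e" by (auto simp: eventually_nhds_metric)
      have le: "onorm (\<lambda>v. f' x v - f' y v) \<le> k x" for x
      proof (rule onorm_le)
        fix v :: "real \<times> real"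
        have 1: "\<bar>fst v\<bar> \<le> norm v" "\<bar>snd v\<bar> \<le> norm v"
          using norm_fst_le[of "fst v" "snd v"] norm_snd_le[of "snd v" "fst v"] by auto
        have "norm (f' x v - f' y v) = norm ((a x - a y) * fst v + (b x - b y) * snd v, (c x - c y) * fst v + (d x - d y) * snd v)"
          by (simp add: f'_def algebra_simps)
        also have "\<dots> \<le> \<bar>(a x - a y) * fst v + (b x - b y) * snd v\<bar> + \<bar>(c x - c y) * fst v + (d x - d y) * snd v\<bar>"
          using norm_Pair_le by (metis real_norm_def)
        also have "\<dots> \<le> (\<bar>a x - a y\<bar> * \<bar>fst v\<bar> + \<bar>b x - b y\<bar> * \<bar>snd v\<bar>) + (\<bar>c x - c y\<bar> * \<bar>fst v\<bar> + \<bar>d x - d y\<bar> * \<bar>snd v\<bar>)"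
          by (intro add_mono) (simp_all add: abs_mult[symmetric] abs_triangle_ineq)
        also have "\<dots> \<le> (\<bar>a x - a y\<bar> * norm v + \<bar>b x - b y\<bar> * norm v) + (\<bar>c x - c y\<bar> * norm v + \<bar>d x - d y\<bar> * norm v)"
          using 1 by (intro add_mono mult_left_mono) auto
        finally show "norm (f' x v - f' y v) \<le> k x * norm v" by (simp add: k_def algebra_simps)
      qed
      then have "onorm (\<lambda>v. f' x v - f' y v) < e" if "dist y x < \<delta>" for x
        using order_le_less_trans[OF le \<delta>(2)[of x]] that by (simp add: dist_commute)
      then show ?thesis using \<delta>(1) by blast
    qed
  qed auto
  then show ?thesis by blast
qed

section \<open>Finitely many extrema and perturbations of the centre\<close>

text \<open>An injective arc provides infinitely many common zeros, which finiteness allows only if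
  \<open>\<Psi>\<close> divides \<open>\<Theta>\<close>.\<close>

lemma irreducible_dvd_if_vanishes_on_branch:
  assumes "irreducible \<Psi>" "branch_param X \<gamma>"
    and "\<forall>\<^sub>F t in nhds 0. poly2 \<Psi> (\<gamma> t) = 0" "\<forall>\<^sub>F t in nhds 0. poly2 \<Theta> (\<gamma> t) = 0"
  shows "\<Psi> dvd \<Theta>"
proof (rule ccontr)
  assume "\<not> \<Psi> dvd \<Theta>"
  then have fin: "finite (curve \<Psi> \<inter> curve \<Theta>)" using finite_common_zeros assms(1) by blast
  obtain r where r: "good_radius X \<gamma> r" using assms(2) branch_param_imp_good_radius by blast
  have "\<forall>\<^sub>F t in nhds 0. poly2 \<Psi> (\<gamma> t) = 0 \<and> poly2 \<Theta> (\<gamma> t) = 0" using assms(3,4) by (rule eventually_conj)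
  then obtain d where d: "d > 0" "\<And>t. \<bar>t\<bar> < d \<Longrightarrow> poly2 \<Psi> (\<gamma> t) = 0 \<and> poly2 \<Theta> (\<gamma> t) = 0"
    by (auto simp: eventually_nhds_metric dist_real_def)
  define I where "I = {- min d r<..<min d r}"
  have "min d r > 0" using d(1) r by (simp add: good_radius_def)
  then have "infinite I" unfolding I_def by (intro infinite_Ioo) auto
  moreover have "inj_on \<gamma> I"
    unfolding I_def by (rule inj_on_subset[of \<gamma> "{-r<..<r}"]) (use r in \<open>auto simp: good_radius_def\<close>)
  moreover have "\<gamma> ` I \<subseteq> curve \<Psi> \<inter> curve \<Theta>" using d(2) by (auto simp: I_def curve_def abs_less_iff)
  ultimately show False using fin by (metis finite_imageD finite_subset)
qed

text \<open>A derivative has smaller degree unless it vanishes. Divisibility in the second variable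
  therefore makes \<open>\<Psi>\<close> free of it, and divisibility in the first then makes
  \<open>\<Psi>\<close> constant, hence a unit.\<close>

lemma not_dvd_pderiv:
  fixes \<Psi> :: "real poly poly"
  assumes "irreducible \<Psi>" "\<Psi> dvd pderiv \<Psi>" "\<Psi> dvd map_poly pderiv \<Psi>"
  shows False
proof -
  have "pderiv \<Psi> = 0"
  proof (rule ccontr)
    assume nz: "pderiv \<Psi> \<noteq> 0"
    then have "degree \<Psi> \<noteq> 0" by (simp add: pderiv_eq_0_iff)
    moreover have "degree \<Psi> \<le> degree (pderiv \<Psi>)" using assms(2) nz by (rule dvd_imp_degree_le)
    ultimately show False by (simp add: degree_pderiv)
  qed
  then obtain a where a: "\<Psi> = [:a:]" by (auto simp: pderiv_eq_0_iff elim: degree_eq_zeroE)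
  have "map_poly pderiv \<Psi> = [:pderiv a:]" by (simp add: a map_poly_pCons)
  then have "[:a:] dvd [:pderiv a:]" using assms(3) a by simp
  then have "a dvd pderiv a" by (auto simp: const_poly_dvd_iff dest: spec[of _ 0])
  have "pderiv a = 0"
  proof (rule ccontr)
    assume nz: "pderiv a \<noteq> 0"
    then have "degree a \<noteq> 0" by (simp add: pderiv_eq_0_iff)
    moreover have "degree a \<le> degree (pderiv a)" using \<open>a dvd pderiv a\<close> nz by (rule dvd_imp_degree_le)
    ultimately show False by (simp add: degree_pderiv)
  qed
  then obtain b where b: "a = [:b:]" by (auto simp: pderiv_eq_0_iff elim: degree_eq_zeroE)
  have "b \<noteq> 0" using assms(1) a b by auto
  then have "is_unit \<Psi>" by (simp add: a b is_unit_const_poly_iff dvd_field_iff)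
  then show False using assms(1) by (simp add: irreducible_def)
qed

text \<open>The gradient of \<open>\<Psi>\<close> annihilates the velocity of the branch. If the
  Jacobian vanished too, then at points where \<open>Q\<close> changes to first order along the
  branch this gradient would be 0, and \<open>\<Psi>\<close> would divide both of its own partial
  derivatives.\<close>

lemma not_dvd_jac:
  assumes \<Psi>: "irreducible \<Psi>" and g: "branch_param X \<gamma>" and van: "\<forall>\<^sub>F t in nhds 0. poly2 \<Psi> (\<gamma> t) = 0"
    and nc: "\<not> (\<forall>\<^sub>F t in nhds 0. poly2 Q (\<gamma> t) = poly2 Q (\<gamma> 0))"
  shows "\<not> \<Psi> dvd jac \<Psi> Q"
proof
  assume dvd: "\<Psi> dvd jac \<Psi> Q"
  obtain g1 g2 where g': "real_analytic_at g1 0" "\<forall>\<^sub>F t in nhds 0. ((\<lambda>t. fst (\<gamma> t)) has_real_derivative g1 t) (at t)"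
    "real_analytic_at g2 0" "\<forall>\<^sub>F t in nhds 0. ((\<lambda>t. snd (\<gamma> t)) has_real_derivative g2 t) (at t)"
    using real_analytic_deriv[OF branch_real_analytic(1)[OF g]] real_analytic_deriv[OF branch_real_analytic(2)[OF g]] by blast
  define D where "D = (\<lambda>P t. poly2 (map_poly pderiv P) (\<gamma> t) * g1 t + poly2 (pderiv P) (\<gamma> t) * g2 t)"
  have der: "\<forall>\<^sub>F t in nhds 0. ((\<lambda>t. poly2 P (\<gamma> t)) has_real_derivative D P t) (at t)" for P
    using g'(2,4)
  proof eventually_elim
    case (elim t)
    have "(\<gamma> has_derivative (\<lambda>h. (g1 t * h, g2 t * h))) (at t)"
      using has_derivative_Pair[OF elim[unfolded has_field_derivative_def]] by simp
    from has_derivative_compose[OF this poly2_has_derivative] show ?case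
      unfolding has_field_derivative_def D_def by (rule has_derivative_eq_rhs) (auto simp: algebra_simps)
  qed
  have "real_analytic_at (D Q) 0"
    unfolding D_def by (intro real_analytic_add real_analytic_mult g' branch_real_analytic[OF g])
  moreover have "\<not> (\<forall>\<^sub>F t in nhds 0. D Q t = 0)"
  proof
    assume "\<forall>\<^sub>F t in nhds 0. D Q t = 0"
    with der[of Q] have "\<forall>\<^sub>F t in nhds 0. ((\<lambda>t. poly2 Q (\<gamma> t)) has_real_derivative 0) (at t)"
      by eventually_elim simp
    then obtain d where d: "d > 0" "\<And>t. \<bar>t\<bar> < d \<Longrightarrow> ((\<lambda>t. poly2 Q (\<gamma> t)) has_real_derivative 0) (at t)"
      by (auto simp: eventually_nhds_metric dist_real_def)
    have const: "poly2 Q (\<gamma> t) = poly2 Q (\<gamma> 0)" if "\<bar>t\<bar> < d" for t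
      using DERIV_isconst3[of "-d" d t 0 "\<lambda>t. poly2 Q (\<gamma> t)"] d that by (auto simp: abs_less_iff minus_less_iff)
    have "\<forall>\<^sub>F t in nhds 0. poly2 Q (\<gamma> t) = poly2 Q (\<gamma> 0)"
      unfolding eventually_nhds_metric
      by (intro exI[of _ d] conjI allI impI const) (use d(1) in \<open>auto simp: dist_real_def\<close>)
    with nc show False ..
  qed
  ultimately have qz: "\<forall>\<^sub>F t in at 0. D Q t \<noteq> 0" by (rule real_analytic_isolated_zeros)
  have pz: "\<forall>\<^sub>F t in nhds 0. D \<Psi> t = 0"
    using iffD2[OF eventually_eventually van] der[of \<Psi>]
  proof eventually_elim
    case (elim t)
    have "((\<lambda>_. 0) has_real_derivative D \<Psi> t) (at t)"
      by (subst DERIV_cong_ev[OF refl _ refl, where g="\<lambda>t. poly2 \<Psi> (\<gamma> t)"])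
         (use elim in \<open>auto elim!: eventually_mono\<close>)
    then show ?case using DERIV_unique DERIV_const by blast
  qed
  obtain A where "jac \<Psi> Q = \<Psi> * A" using dvd by auto
  then have jz: "\<forall>\<^sub>F t in nhds 0. poly2 (jac \<Psi> Q) (\<gamma> t) = 0"
    using van by (auto simp: poly2_mult elim: eventually_mono)
  have "\<forall>\<^sub>F t in at 0. poly2 (pderiv \<Psi>) (\<gamma> t) = 0 \<and> poly2 (map_poly pderiv \<Psi>) (\<gamma> t) = 0"
  proof -
    have "\<forall>\<^sub>F t in at 0. D \<Psi> t = 0 \<and> poly2 (jac \<Psi> Q) (\<gamma> t) = 0"
      using pz jz by (auto simp: eventually_at_filter elim: eventually_elim2)
    with qz show ?thesis
    proof eventually_elim
      case (elim t)
      define a b c d where "a = poly2 (map_poly pderiv \<Psi>) (\<gamma> t)" and "b = poly2 (pderiv \<Psi>) (\<gamma> t)"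
        and "c = poly2 (map_poly pderiv Q) (\<gamma> t)" and "d = poly2 (pderiv Q) (\<gamma> t)"
      have e: "a * g1 t + b * g2 t = 0" "a * d = b * c" "c * g1 t + d * g2 t \<noteq> 0"
        using elim by (auto simp: D_def jac_def poly2_diff poly2_mult a_def b_def c_def d_def)
      \<comment> \<open>The vector \<open>(a, b)\<close> is orthogonal to the velocity and parallel
        to \<open>(c, d)\<close>, while \<open>(c, d)\<close> is not orthogonal to the velocity;
        hence \<open>(a, b) = 0\<close>.\<close>
      have "a * (c * g1 t + d * g2 t) = c * (a * g1 t + b * g2 t)" using e(2) by algebra
      moreover have "b * (c * g1 t + d * g2 t) = d * (a * g1 t + b * g2 t)" using e(2) by algebra
      ultimately have "a * (c * g1 t + d * g2 t) = 0" "b * (c * g1 t + d * g2 t) = 0" using e(1) by simp_all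
      then have "a = 0" "b = 0" using e(3) by simp_all
      then show ?case by (simp add: a_def b_def)
    qed
  qed
  then have "\<forall>\<^sub>F t in at 0. poly2 (pderiv \<Psi>) (\<gamma> t) = 0" "\<forall>\<^sub>F t in at 0. poly2 (map_poly pderiv \<Psi>) (\<gamma> t) = 0"
    by (auto elim: eventually_mono)
  moreover have "\<forall>\<^sub>F t in nhds 0. poly2 P (\<gamma> t) = 0" if "\<forall>\<^sub>F t in at 0. poly2 P (\<gamma> t) = 0" for P
  proof (rule ccontr)
    assume "\<not> (\<forall>\<^sub>F t in nhds 0. poly2 P (\<gamma> t) = 0)"
    then have "\<forall>\<^sub>F t in at 0. poly2 P (\<gamma> t) \<noteq> 0" using branch_real_analytic[OF g] by (intro real_analytic_isolated_zeros)
    with that have "\<forall>\<^sub>F t in at (0::real). False" by eventually_elim simp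
    then show False by simp
  qed
  ultimately show False
    using not_dvd_pderiv[OF \<Psi>] irreducible_dvd_if_vanishes_on_branch[OF \<Psi> g van] by blast
qed

lemma continuous_injective_no_local_maximum:
  fixes \<phi> :: "real \<Rightarrow> real"
  assumes "open V" "0 \<in> V" "continuous_on V \<phi>" "inj_on \<phi> V"
  shows "\<exists>t\<in>V. \<phi> t > \<phi> 0"
proof -
  have "open (\<phi> ` V)" using assms by (intro invariance_of_domain)
  then obtain e where e: "e > 0" "ball (\<phi> 0) e \<subseteq> \<phi> ` V" using assms(2) open_contains_ball by blast
  then have "\<phi> 0 + e/2 \<in> \<phi> ` V" by (auto simp: dist_real_def subset_iff)
  then show ?thesis using e(1) by force
qed

text \<open>If the Jacobian is nonzero, \<open>(\<Psi>, Q)\<close> is injective near the centre; on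
  the branch \<open>\<Psi> = 0\<close>, so \<open>Q\<close> alone is injective there and takes
  larger values on one side. No regularity of the parametrization is involved.\<close>

lemma local_maximum_jac:
  assumes g: "branch_param X \<gamma>" and van: "\<forall>\<^sub>F t in nhds 0. poly2 \<Psi> (\<gamma> t) = 0" and "\<sigma> \<noteq> 0"
    and max: "branch_germ \<gamma> 0 \<in> local_maxima (normalization X) (\<lambda>P. \<sigma> * poly2 Q (centre P))"
  shows "poly2 (jac \<Psi> Q) (\<gamma> 0) = 0"
proof (rule ccontr)
  assume "poly2 (jac \<Psi> Q) (\<gamma> 0) \<noteq> 0"
  then obtain e where e: "e > 0" "inj_on (\<lambda>z. (poly2 \<Psi> z, poly2 Q z)) (ball (\<gamma> 0) e)"
    using poly2_locally_injective by blast
  obtain r where r: "good_radius X \<gamma> r" using g branch_param_imp_good_radius by blast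
  then have c: "isCont \<gamma> 0" and r0: "0 < r" by (auto simp: good_radius_def)
  obtain W where W: "openin (top_of_set {-r<..<r}) W" "0 \<in> W" "\<And>t. t \<in> W \<Longrightarrow> \<sigma> * poly2 Q (\<gamma> t) \<le> \<sigma> * poly2 Q (\<gamma> 0)"
    using local_maxima_chart_iff[OF r, of 0 "\<lambda>y. \<sigma> * poly2 Q y"] max r0 by (auto simp: local_maxima_def)
  then have W': "open W" "W \<subseteq> {-r<..<r}" by (auto simp: openin_open_eq)
  have "\<forall>\<^sub>F t in nhds 0. \<gamma> t \<in> ball (\<gamma> 0) e"
    using topological_tendstoD[OF isCont_imp_tendsto_nhds[OF c refl] open_ball] e(1) by auto
  moreover have "\<forall>\<^sub>F t in nhds 0. t \<in> W" using W'(1) W(2) by (rule eventually_nhds_in_open)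
  ultimately have "\<forall>\<^sub>F t in nhds 0. \<gamma> t \<in> ball (\<gamma> 0) e \<and> t \<in> W \<and> poly2 \<Psi> (\<gamma> t) = 0"
    using van by eventually_elim simp
  then obtain V where V: "open V" "0 \<in> V" "\<And>t. t \<in> V \<Longrightarrow> \<gamma> t \<in> ball (\<gamma> 0) e \<and> t \<in> W \<and> poly2 \<Psi> (\<gamma> t) = 0"
    by (auto simp: eventually_nhds)
  have Vr: "V \<subseteq> {-r<..<r}" using V(3) W'(2) by blast
  have ct: "isCont \<gamma> t" if "t \<in> V" for t
    using r Vr that by (auto simp: good_radius_def subset_iff abs_less_iff minus_less_iff)
  have "continuous_on V (\<lambda>t. \<sigma> * poly2 Q (\<gamma> t))"
    by (intro continuous_at_imp_continuous_on ballI continuous_intros isCont_o2[OF ct isCont_poly2])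
  moreover have "inj_on (\<lambda>t. \<sigma> * poly2 Q (\<gamma> t)) V"
  proof (rule inj_onI)
    fix s t assume st: "s \<in> V" "t \<in> V" "\<sigma> * poly2 Q (\<gamma> s) = \<sigma> * poly2 Q (\<gamma> t)"
    have "\<gamma> s = \<gamma> t"
      by (rule inj_onD[OF e(2)]) (use st V(3) assms(3) in auto)
    then show "s = t" using r Vr st by (auto simp: good_radius_def dest: inj_onD)
  qed
  ultimately obtain t where "t \<in> V" "\<sigma> * poly2 Q (\<gamma> t) > \<sigma> * poly2 Q (\<gamma> 0)"
    using continuous_injective_no_local_maximum[OF V(1,2)] by blast
  then show False using W(3)[of t] V(3)[of t] by auto
qed

section \<open>Extrema on a connected component\<close>

lemma branch_chart_subset_component:
  assumes C: "C \<in> connected_components_of (normalization X)" and "branch_germ \<gamma> 0 \<in> C"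
    and r: "good_radius X \<gamma> r" and s: "\<bar>s\<bar> < r"
  shows "branch_germ \<gamma> s \<in> C"
proof -
  have "branch_germ \<gamma> 0 \<in> branch_germ \<gamma> ` {-r<..<r}" using r by (auto simp: good_radius_def)
  then have "branch_germ \<gamma> ` {-r<..<r} \<subseteq> C"
    using connected_components_of_maximal[OF C connectedin_branch_chart[OF r]] assms(2) by (auto simp: disjnt_iff)
  then show ?thesis using s by (auto simp: abs_less_iff image_subset_iff minus_less_iff)
qed

text \<open>One irreducible \<open>\<Psi>\<close> vanishes on the entire component, so the centres
  of extrema lie in the finite set \<open>\<Psi> = jac \<Psi> Q = 0\<close>, and each centre carries
  finitely many branches. The factor \<open>\<sigma>\<close> covers minima as well.\<close>

lemma finite_local_maxima_component:
  assumes \<Phi>: "\<Phi> \<noteq> 0" and g: "branch_param (curve \<Phi>) \<gamma>"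
    and C: "C \<in> connected_components_of (normalization (curve \<Phi>))" and P0: "branch_germ \<gamma> 0 \<in> C"
    and nc: "\<not> (\<forall>\<^sub>F t in nhds 0. poly2 Q (\<gamma> t) = poly2 Q (\<gamma> 0))" and "\<sigma> \<noteq> 0"
  shows "finite (local_maxima (normalization (curve \<Phi>)) (\<lambda>P. \<sigma> * poly2 Q (centre P)) \<inter> C)"
proof -
  have "\<forall>\<^sub>F t in nhds 0. poly2 \<Phi> (\<gamma> t) = 0" using g by (simp add: branch_param_def curve_def)
  then obtain \<Psi> where \<Psi>: "irreducible \<Psi>" "\<forall>\<^sub>F t in nhds 0. poly2 \<Psi> (\<gamma> t) = 0"
    using irreducible_factor_on_branch[OF \<Phi> g] by blast
  define Z where "Z = curve \<Psi> \<inter> curve (jac \<Psi> Q)"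
  have "finite Z" unfolding Z_def by (rule finite_common_zeros[OF \<Psi>(1) not_dvd_jac[OF \<Psi>(1) g \<Psi>(2) nc]])
  then have fin: "finite (\<Union>z\<in>Z. {P \<in> branches (curve \<Phi>). centre P = z})" using finite_branches_at[OF \<Phi>] by blast
  have cC: "connectedin (normalization (curve \<Phi>)) C" using C by (rule connectedin_connected_components_of)
  have "P \<in> (\<Union>z\<in>Z. {P \<in> branches (curve \<Phi>). centre P = z})"
    if P: "P \<in> local_maxima (normalization (curve \<Phi>)) (\<lambda>P. \<sigma> * poly2 Q (centre P))" "P \<in> C" for P
  proof -
    have "P \<in> branches (curve \<Phi>)" using connectedin_subset_topspace[OF cC] P(2) by (auto simp: topspace_normalization)
    then obtain \<delta> r where d: "P = branch_germ \<delta> 0" "branch_param (curve \<Phi>) \<delta>" "good_radius (curve \<Phi>) \<delta> r"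
      by (rule branches_obtain)
    have "\<forall>\<^sub>F y in P. poly2 \<Psi> y = 0"
      by (rule connected_branches_vanish[OF cC P0 _ P(2)]) (use \<Psi>(2) in \<open>simp add: branch_germ_def eventually_filtermap\<close>)
    then have van: "\<forall>\<^sub>F t in nhds 0. poly2 \<Psi> (\<delta> t) = 0" by (simp add: d(1) branch_germ_def eventually_filtermap)
    have "poly2 (jac \<Psi> Q) (\<delta> 0) = 0" by (rule local_maximum_jac[OF d(2) van assms(6)]) (use P d in simp)
    moreover have "poly2 \<Psi> (\<delta> 0) = 0" using eventually_nhds_x_imp_x[OF van] .
    moreover have "centre P = \<delta> 0" unfolding d(1) by (rule centre_branch_germ) (use d(3) in \<open>simp add: good_radius_def\<close>)
    ultimately show ?thesis using \<open>P \<in> branches (curve \<Phi>)\<close> by (auto simp: Z_def curve_def)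
  qed
  then show ?thesis by (intro finite_subset[OF _ fin]) blast
qed

text \<open>A piece on which \<open>Q\<close> is constant would consist of infinitely many local
  maxima, contrary to the finiteness obtained from the branch \<open>\<gamma>\<close>.\<close>

lemma nonconstant_on_component:
  assumes "\<Phi> \<noteq> 0" "branch_param (curve \<Phi>) \<gamma>"
    and C: "C \<in> connected_components_of (normalization (curve \<Phi>))" and "branch_germ \<gamma> 0 \<in> C"
    and "\<not> (\<forall>\<^sub>F t in nhds 0. poly2 Q (\<gamma> t) = poly2 Q (\<gamma> 0))"
    and d: "branch_param (curve \<Phi>) \<delta>" "branch_germ \<delta> 0 \<in> C"
  shows "\<not> (\<forall>\<^sub>F t in nhds 0. poly2 Q (\<delta> t) = poly2 Q (\<delta> 0))"
proof
  assume "\<forall>\<^sub>F t in nhds 0. poly2 Q (\<delta> t) = poly2 Q (\<delta> 0)"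
  then obtain e where e: "e > 0" "\<And>t. \<bar>t\<bar> < e \<Longrightarrow> poly2 Q (\<delta> t) = poly2 Q (\<delta> 0)"
    by (auto simp: eventually_nhds_metric dist_real_def)
  obtain r0 where r0: "good_radius (curve \<Phi>) \<delta> r0" using d(1) branch_param_imp_good_radius by blast
  define r where "r = min e r0"
  have r: "good_radius (curve \<Phi>) \<delta> r" using good_radius_mono[OF r0, of r] e(1) r0 by (auto simp: r_def good_radius_def)
  have eq: "poly2 Q (\<delta> t) = poly2 Q (\<delta> s)" if "\<bar>t\<bar> < r" "\<bar>s\<bar> < r" for s t
    using e(2)[of t] e(2)[of s] that unfolding r_def by (simp only: min_less_iff_conj)
  have "s \<in> local_maxima (top_of_set {-r<..<r}) (\<lambda>t. 1 * poly2 Q (\<delta> t))" if "s \<in> {-r<..<r}" for s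
    unfolding local_maxima_def using that
    by (intro CollectI exI[of _ "{-r<..<r}"] conjI ballI eq_refl arg_cong[where f="\<lambda>x. 1 * x"] eq) (auto simp: abs_less_iff)
  then have "branch_germ \<delta> ` {-r<..<r} \<subseteq> local_maxima (normalization (curve \<Phi>)) (\<lambda>P. 1 * poly2 Q (centre P)) \<inter> C"
    using local_maxima_chart_iff[OF r, of _ "\<lambda>y. 1 * poly2 Q y"] branch_chart_subset_component[OF C d(2) r]
    by (auto simp: abs_less_iff)
  then have "finite (branch_germ \<delta> ` {-r<..<r})"
    by (rule finite_subset) (rule finite_local_maxima_component[OF assms(1-5)], simp)
  then have "finite {-r<..<r}" using inj_on_branch_germ[OF r] by (rule finite_imageD)
  then show False using r by (simp add: good_radius_def infinite_Ioo)
qed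

definition sqdist_poly :: "real \<times> real \<Rightarrow> real poly poly"
  where "sqdist_poly u = [: [:(fst u)\<^sup>2 + (snd u)\<^sup>2, - 2 * fst u, 1:], [:- 2 * snd u:], 1 :]"

lemma poly2_sqdist_poly: "poly2 (sqdist_poly u) y = sqdist u y"
proof -
  have "sqdist u y = (fst y - fst u)\<^sup>2 + (snd y - snd u)\<^sup>2"
    unfolding sqdist_def dist_prod_def dist_real_def by simp
  then show ?thesis by (simp add: sqdist_poly_def poly2_def power2_eq_square algebra_simps)
qed

lemma local_minima_eq: "local_minima T f = local_maxima T (\<lambda>x. - 1 * f x)"
  by (simp add: local_maxima_def local_minima_def)

lemma top_equivalent_signed:
  assumes "top_equivalent T f g" "C \<in> connected_components_of T" "\<sigma> \<in> {1, -1::real}"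
  shows "local_maxima T (\<lambda>x. \<sigma> * f x) \<inter> C \<approx> local_maxima T (\<lambda>x. \<sigma> * g x) \<inter> C"
  using assms by (auto simp: top_equivalent_def local_minima_eq)

definition branch_maxima :: "(real \<Rightarrow> real \<times> real) \<Rightarrow> real \<Rightarrow> real \<Rightarrow> real \<times> real \<Rightarrow> real set"
  where "branch_maxima \<gamma> \<sigma> r v = local_maxima (top_of_set {-r<..<r}) (\<lambda>t. \<sigma> * sqdist v (\<gamma> t))"

text \<open>As in \<open>germ_stable\<close>, the interval is fixed before the neighbourhood of
  \<open>u\<close>. A finite subset \<open>S\<close> witnesses the gain, so that nothing need be
  known about finiteness of the maxima for the perturbed centre.\<close>

definition gains_maxima :: "(real \<Rightarrow> real \<times> real) \<Rightarrow> real \<Rightarrow> real \<times> real \<Rightarrow> bool"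
  where "gains_maxima \<gamma> \<sigma> u \<longleftrightarrow> (\<forall>\<^sub>F r in at_right 0. finite (branch_maxima \<gamma> \<sigma> r u) \<and>
     (\<forall>U. open U \<and> u \<in> U \<longrightarrow>
       (\<exists>v\<in>U. \<exists>S\<subseteq>branch_maxima \<gamma> \<sigma> r v. finite S \<and> card (branch_maxima \<gamma> \<sigma> r u) < card S)))"

lemma eventually_at_right_pos_less: "0 < (d::real) \<Longrightarrow> \<forall>\<^sub>F r in at_right 0. 0 < r \<and> r < d"
  using eventually_at_right_real[of 0 d] by simp

text \<open>The maximum over the compact interval is attained in its interior, as both ends lie
  below the value at 0. The radius \<open>2 * r\<close> makes the closed interval part of the
  chart.\<close>

lemma perturbed_maximum:
  assumes r: "good_radius X \<delta> (2 * r)"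
    and "\<sigma> * sqdist v (\<delta> r) < \<sigma> * sqdist v (\<delta> 0)" "\<sigma> * sqdist v (\<delta> (- r)) < \<sigma> * sqdist v (\<delta> 0)"
  shows "\<exists>s. \<bar>s\<bar> < r \<and> branch_germ \<delta> s \<in> local_maxima (normalization X) (\<lambda>P. \<sigma> * sqdist v (centre P))"
proof -
  have r0: "r > 0" using r by (simp add: good_radius_def)
  define \<phi> where "\<phi> = (\<lambda>t. \<sigma> * sqdist v (\<delta> t))"
  have "isCont \<phi> t" if "t \<in> {-r..r}" for t
  proof -
    have "isCont \<delta> t" using r r0 that by (simp add: good_radius_def abs_less_iff)
    then show ?thesis unfolding \<phi>_def sqdist_def by (intro continuous_intros)
  qed
  then have "continuous_on {-r..r} \<phi>" by (intro continuous_at_imp_continuous_on) auto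
  then obtain s where s: "s \<in> {-r..r}" "\<And>t. t \<in> {-r..r} \<Longrightarrow> \<phi> t \<le> \<phi> s"
    using continuous_attains_sup[of "{-r..r}" \<phi>] r0 by auto
  have "\<phi> 0 \<le> \<phi> s" using s(2)[of 0] r0 by simp
  then have "s \<noteq> r" "s \<noteq> - r" using assms(2,3) by (auto simp: \<phi>_def)
  then have s': "s \<in> {-r<..<r}" using s(1) by auto
  have gr: "good_radius X \<delta> r" by (rule good_radius_mono[OF r]) (use r0 in auto)
  have "s \<in> local_maxima (top_of_set {-r<..<r}) (\<lambda>t. \<sigma> * sqdist v (\<delta> t))"
    unfolding local_maxima_def using s' s(2) by (intro CollectI exI[of _ "{-r<..<r}"]) (auto simp: \<phi>_def)
  then have "branch_germ \<delta> s \<in> local_maxima (normalization X) (\<lambda>P. \<sigma> * sqdist v (centre P))"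
    using local_maxima_chart_iff[OF gr s', of "\<lambda>y. \<sigma> * sqdist v y"] by simp
  then show ?thesis using s' by (auto simp: abs_less_iff)
qed

lemma strict_maximum_eventually:
  assumes d: "branch_param X \<delta>" and nc: "\<not> (\<forall>\<^sub>F t in nhds 0. poly2 (sqdist_poly u) (\<delta> t) = poly2 (sqdist_poly u) (\<delta> 0))"
    and max: "branch_germ \<delta> 0 \<in> local_maxima (normalization X) (\<lambda>P. \<sigma> * sqdist u (centre P))" and "\<sigma> \<noteq> 0"
  shows "\<forall>\<^sub>F t in at 0. \<sigma> * sqdist u (\<delta> t) < \<sigma> * sqdist u (\<delta> 0)"
proof -
  obtain r where r: "good_radius X \<delta> r" using d branch_param_imp_good_radius by blast
  then have r0: "0 < r" by (simp add: good_radius_def)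
  obtain W where W: "openin (top_of_set {-r<..<r}) W" "0 \<in> W" "\<And>t. t \<in> W \<Longrightarrow> \<sigma> * sqdist u (\<delta> t) \<le> \<sigma> * sqdist u (\<delta> 0)"
    using local_maxima_chart_iff[OF r, of 0 "\<lambda>y. \<sigma> * sqdist u y"] max r0 by (auto simp: local_maxima_def)
  then have W': "open W" by (auto simp: openin_open_eq)
  have "\<forall>\<^sub>F t in nhds 0. t \<in> W" using W' W(2) by (rule eventually_nhds_in_open)
  then have "\<forall>\<^sub>F t in at 0. t \<in> W" by (simp add: eventually_at_filter eventually_mono)
  moreover have "\<forall>\<^sub>F t in at 0. poly2 (sqdist_poly u) (\<delta> t) - poly2 (sqdist_poly u) (\<delta> 0) \<noteq> 0"
    using nc branch_real_analytic[OF d] by (intro real_analytic_isolated_zeros real_analytic_diff real_analytic_const) auto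
  ultimately show ?thesis
  proof eventually_elim
    case (elim t)
    then show ?case using W(3)[of t] assms(4) by (simp add: poly2_sqdist_poly less_le)
  qed
qed

text \<open>Equipollence of finite sets compares cardinalities: stability would force equal numbers
  of maxima on the component of \<open>\<gamma>\<close>. The local gain, added to the survivors of
  all the other maxima, contradicts this.\<close>

theorem gains_maxima_not_top_stable:
  assumes \<Phi>: "\<Phi> \<noteq> 0" and g: "branch_param (curve \<Phi>) \<gamma>" and \<sigma>: "\<sigma> \<in> {1, -1}"
    and nc: "\<not> (\<forall>\<^sub>F t in nhds 0. sqdist u (\<gamma> t) = sqdist u (\<gamma> 0))"
    and gain: "gains_maxima \<gamma> \<sigma> u"
  shows "\<not> top_stable \<Phi> u"
proof
  define X where "X = curve \<Phi>"
  define T where "T = normalization X"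
  assume "top_stable \<Phi> u"
  then obtain U where U: "open U" "u \<in> U" "\<And>v. v \<in> U \<Longrightarrow> top_equivalent T (\<lambda>P. sqdist v (centre P)) (\<lambda>P. sqdist u (centre P))"
    unfolding top_stable_def T_def X_def by blast
  define P0 where "P0 = branch_germ \<gamma> 0"
  have P0T: "P0 \<in> topspace T" using g by (auto simp: P0_def T_def X_def topspace_normalization branches_def)
  define C where "C = connected_component_of_set T P0"
  have C: "C \<in> connected_components_of T" using P0T by (auto simp: C_def connected_components_of_def)
  have P0C: "P0 \<in> C" using P0T by (simp add: C_def connected_component_of_refl)
  define M where "M = (\<lambda>v. local_maxima T (\<lambda>P. \<sigma> * sqdist v (centre P)) \<inter> C)"
  have s0: "\<sigma> \<noteq> 0" using \<sigma> by auto
  have nc': "\<not> (\<forall>\<^sub>F t in nhds 0. poly2 (sqdist_poly u) (\<gamma> t) = poly2 (sqdist_poly u) (\<gamma> 0))"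
    using nc by (simp add: poly2_sqdist_poly)
  have fin: "finite (M u)"
    using finite_local_maxima_component[OF \<Phi> g C[unfolded T_def X_def] P0C[unfolded P0_def] nc' s0]
    by (simp add: M_def T_def X_def poly2_sqdist_poly)
  have CT: "C \<subseteq> branches X" using connected_components_of_subset[OF C] by (simp add: T_def topspace_normalization)
  have "\<exists>\<delta>. P = branch_germ \<delta> 0 \<and> branch_param X \<delta>" if "P \<in> C" for P
    using CT that by (auto simp: branches_def)
  then obtain G0 where G0: "\<And>P. P \<in> C \<Longrightarrow> P = branch_germ (G0 P) 0 \<and> branch_param X (G0 P)" by metis
  \<comment> \<open>At \<open>P0\<close> the given \<open>\<gamma>\<close> is kept as
    parametrization, because the gain is stated for it.\<close>
  define G where "G = (\<lambda>P. if P = P0 then \<gamma> else G0 P)"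
  have G: "branch_germ (G P) 0 = P" "branch_param X (G P)" if "P \<in> C" for P
    using G0[OF that] g by (auto simp: G_def P0_def X_def)
  \<comment> \<open>The branch \<open>P0\<close> is left out: a maximum there is already counted by
    \<open>branch_maxima \<gamma> \<sigma> r u\<close>.\<close>
  define M' where "M' = M u - {P0}"
  define S where "S = insert P0 M'"
  have S: "finite S" "S \<subseteq> C" "finite M'" "M' \<subseteq> C" "P0 \<in> S" "P0 \<notin> M'"
    using fin P0C by (auto simp: S_def M'_def M_def)
  have ev1: "\<forall>\<^sub>F r in at_right 0. \<forall>P\<in>S. good_radius X (G P) (2 * r)"
  proof (intro eventually_ball_finite S(1) ballI)
    fix P assume "P \<in> S"
    then obtain d where d: "good_radius X (G P) d" using G S branch_param_imp_good_radius by blast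
    then have "\<forall>\<^sub>F r in at_right 0. 0 < r \<and> r < d / 2" by (intro eventually_at_right_pos_less) (simp add: good_radius_def)
    then show "\<forall>\<^sub>F r in at_right 0. good_radius X (G P) (2 * r)"
      by eventually_elim (rule good_radius_mono[OF d], auto)
  qed
  \<comment> \<open>Disjoint charts keep maxima that survive near different branches from being
    counted twice.\<close>
  have ev2: "\<forall>\<^sub>F r in at_right 0. \<forall>P\<in>S. \<forall>Q\<in>S. P \<noteq> Q \<longrightarrow>
      (\<forall>s s'. \<bar>s\<bar> < r \<and> \<bar>s'\<bar> < r \<longrightarrow> branch_germ (G P) s \<noteq> branch_germ (G Q) s')"
  proof (intro eventually_ball_finite S(1) ballI)
    fix P Q assume PQ: "P \<in> S" "Q \<in> S"
    show "\<forall>\<^sub>F r in at_right 0. P \<noteq> Q \<longrightarrow>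
      (\<forall>s s'. \<bar>s\<bar> < r \<and> \<bar>s'\<bar> < r \<longrightarrow> branch_germ (G P) s \<noteq> branch_germ (G Q) s')"
    proof (cases "P = Q")
      case False
      have GP: "branch_germ (G P) 0 = P" "branch_param X (G P)" "branch_germ (G Q) 0 = Q" "branch_param X (G Q)"
        using PQ S(2) G by blast+
      obtain r1 r2 where r12: "good_radius X (G P) r1" "good_radius X (G Q) r2"
        using GP branch_param_imp_good_radius by metis
      obtain r where r: "r > 0" "\<And>s s'. \<bar>s\<bar> < r \<Longrightarrow> \<bar>s'\<bar> < r \<Longrightarrow> (G P 0 \<noteq> G Q 0 \<or> s \<noteq> 0 \<or> s' \<noteq> 0) \<Longrightarrow> G P s \<noteq> G Q s'"
        using distinct_branches_disjoint[OF GP(2,4)] GP(1,3) False by auto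
      have ne: "branch_germ (G P) s \<noteq> branch_germ (G Q) s'" if "\<bar>s\<bar> < min r (min r1 r2)" "\<bar>s'\<bar> < min r (min r1 r2)" for s s'
      proof
        assume e: "branch_germ (G P) s = branch_germ (G Q) s'"
        have "isCont (G P) s" "isCont (G Q) s'" using r12 that by (auto simp: good_radius_def)
        then have "G P s = G Q s'" using e centre_branch_germ by metis
        then have "s = 0" "s' = 0" using r(2)[of s s'] that by auto
        then show False using e GP False by simp
      qed
      have "\<forall>\<^sub>F r' in at_right 0. 0 < r' \<and> r' < min r (min r1 r2)"
        using r(1) r12 by (intro eventually_at_right_pos_less) (auto simp: good_radius_def)
      then show ?thesis by eventually_elim (meson ne order_less_trans)
    qed simp
  qed
  have ev3: "\<forall>\<^sub>F r in at_right 0. \<forall>P\<in>M'. \<sigma> * sqdist u (G P r) < \<sigma> * sqdist u (G P 0) \<and>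
      \<sigma> * sqdist u (G P (- r)) < \<sigma> * sqdist u (G P 0)"
  proof (intro eventually_ball_finite S(3) ballI)
    fix P assume P: "P \<in> M'"
    have PC: "P \<in> C" using P S by blast
    have "branch_germ (G P) 0 \<in> local_maxima (normalization X) (\<lambda>P. \<sigma> * sqdist u (centre P))"
      using P G(1)[OF PC] by (simp add: M'_def M_def T_def)
    moreover have "\<not> (\<forall>\<^sub>F t in nhds 0. poly2 (sqdist_poly u) (G P t) = poly2 (sqdist_poly u) (G P 0))"
      by (rule nonconstant_on_component[OF \<Phi> g C[unfolded T_def X_def] P0C[unfolded P0_def] nc'])
         (use G[OF PC] PC in \<open>auto simp: X_def\<close>)
    ultimately have "\<forall>\<^sub>F t in at 0. \<sigma> * sqdist u (G P t) < \<sigma> * sqdist u (G P 0)"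
      using strict_maximum_eventually[OF G(2)[OF PC]] s0 by blast
    then obtain d where d: "d > 0" "\<And>t. t \<noteq> 0 \<Longrightarrow> \<bar>t\<bar> < d \<Longrightarrow> \<sigma> * sqdist u (G P t) < \<sigma> * sqdist u (G P 0)"
      by (auto simp: eventually_at dist_real_def)
    show "\<forall>\<^sub>F r in at_right 0. \<sigma> * sqdist u (G P r) < \<sigma> * sqdist u (G P 0) \<and>
      \<sigma> * sqdist u (G P (- r)) < \<sigma> * sqdist u (G P 0)"
      using eventually_at_right_pos_less[OF d(1)] by eventually_elim (auto intro!: d(2))
  qed
  obtain r where r1: "\<forall>P\<in>S. good_radius X (G P) (2 * r)"
    and r2: "\<forall>P\<in>S. \<forall>Q\<in>S. P \<noteq> Q \<longrightarrow> (\<forall>s s'. \<bar>s\<bar> < r \<and> \<bar>s'\<bar> < r \<longrightarrow> branch_germ (G P) s \<noteq> branch_germ (G Q) s')"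
    and r3: "\<forall>P\<in>M'. \<sigma> * sqdist u (G P r) < \<sigma> * sqdist u (G P 0) \<and> \<sigma> * sqdist u (G P (- r)) < \<sigma> * sqdist u (G P 0)"
    and r4: "finite (branch_maxima \<gamma> \<sigma> r u)" "\<forall>U. open U \<and> u \<in> U \<longrightarrow>
       (\<exists>v\<in>U. \<exists>S\<subseteq>branch_maxima \<gamma> \<sigma> r v. finite S \<and> card (branch_maxima \<gamma> \<sigma> r u) < card S)"
    using eventually_happens'[OF trivial_limit_at_right_real
      eventually_conj[OF ev1 eventually_conj[OF ev2 eventually_conj[OF ev3 gain[unfolded gains_maxima_def]]]]]
    by (elim exE conjE) (rule that)
  have "\<forall>\<^sub>F v in nhds u. \<forall>P\<in>M'. \<sigma> * sqdist v (G P r) < \<sigma> * sqdist v (G P 0) \<and> \<sigma> * sqdist v (G P (- r)) < \<sigma> * sqdist v (G P 0)"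
  proof (intro eventually_ball_finite S(3) ballI eventually_conj)
    have lt: "\<forall>\<^sub>F v in nhds u. \<sigma> * sqdist v a < \<sigma> * sqdist v b" if "\<sigma> * sqdist u a < \<sigma> * sqdist u b" for a b
    proof -
      have "isCont (\<lambda>v. \<sigma> * sqdist v b - \<sigma> * sqdist v a) u" unfolding sqdist_def by (intro continuous_intros)
      from order_tendstoD(1)[OF isCont_imp_tendsto_nhds[OF this refl], of 0] that show ?thesis by simp
    qed
    fix P assume "P \<in> M'"
    then show "\<forall>\<^sub>F v in nhds u. \<sigma> * sqdist v (G P r) < \<sigma> * sqdist v (G P 0)"
      "\<forall>\<^sub>F v in nhds u. \<sigma> * sqdist v (G P (- r)) < \<sigma> * sqdist v (G P 0)"
      using r3 lt by blast+
  qed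
  then obtain U' where U': "open U'" "u \<in> U'" "\<forall>v\<in>U'. \<forall>P\<in>M'. \<sigma> * sqdist v (G P r) < \<sigma> * sqdist v (G P 0) \<and> \<sigma> * sqdist v (G P (- r)) < \<sigma> * sqdist v (G P 0)"
    by (auto simp: eventually_nhds)
  have "open (U \<inter> U')" "u \<in> U \<inter> U'" using U U' by auto
  then obtain v A where v: "v \<in> U" "v \<in> U'" and A: "A \<subseteq> branch_maxima \<gamma> \<sigma> r v" "finite A" "card (branch_maxima \<gamma> \<sigma> r u) < card A"
    using r4 by blast
  have "M v \<approx> M u"
    unfolding M_def by (rule top_equivalent_signed[OF U(3)[OF v(1)] C \<sigma>])
  then have finv: "finite (M v)" and cardv: "card (M v) = card (M u)"
    using fin eqpoll_finite_iff[of "M v" "M u"] eqpoll_iff_card[of "M v" "M u"] by auto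
  have "\<exists>s. \<bar>s\<bar> < r \<and> branch_germ (G P) s \<in> local_maxima T (\<lambda>P. \<sigma> * sqdist v (centre P))" if "P \<in> M'" for P
    unfolding T_def by (rule perturbed_maximum) (use that r1 U'(3) v(2) S_def in auto)
  then obtain \<theta> where \<theta>: "\<And>P. P \<in> M' \<Longrightarrow> \<bar>\<theta> P\<bar> < r \<and> branch_germ (G P) (\<theta> P) \<in> local_maxima T (\<lambda>P. \<sigma> * sqdist v (centre P))"
    by metis
  have gr: "good_radius X (G P) r" "0 < r" if "P \<in> S" for P
    using good_radius_mono[of X "G P" "2*r" r] bspec[OF r1 that] by (auto simp: good_radius_def)
  have inC: "branch_germ (G P) s \<in> C" if "P \<in> S" "\<bar>s\<bar> < r" for P s
    by (rule branch_chart_subset_component[OF C[unfolded T_def] _ gr(1)[OF that(1)] that(2)])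
       (use G(1) that S(2) in auto)
  have GP0: "G P0 = \<gamma>" by (simp add: G_def)
  have A_range: "A \<subseteq> {-r<..<r}" using A(1) by (auto simp: branch_maxima_def local_maxima_def openin_open_eq dest: openin_subset)
  have grg: "good_radius X \<gamma> r" using gr[OF S(5)] GP0 by simp
  define N1 where "N1 = branch_germ \<gamma> ` A"
  define N2 where "N2 = (\<lambda>P. branch_germ (G P) (\<theta> P)) ` M'"
  have "N1 \<subseteq> M v"
  proof
    fix R assume "R \<in> N1"
    then obtain s where s: "s \<in> A" "R = branch_germ \<gamma> s" by (auto simp: N1_def)
    then have "s \<in> {-r<..<r}" "s \<in> branch_maxima \<gamma> \<sigma> r v" using A A_range by auto
    then show "R \<in> M v"
      using local_maxima_chart_iff[OF grg, of s "\<lambda>y. \<sigma> * sqdist v y"] inC[OF S(5), of s]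
      by (auto simp: M_def T_def s(2) branch_maxima_def GP0 abs_less_iff)
  qed
  moreover have "N2 \<subseteq> M v" using \<theta> inC by (auto simp: N2_def M_def S_def)
  moreover have "N1 \<inter> N2 = {}"
  proof -
    have "branch_germ \<gamma> s \<noteq> branch_germ (G P) (\<theta> P)" if "s \<in> A" "P \<in> M'" for s P
    proof -
      have "\<bar>s\<bar> < r" using A_range that(1) by (auto simp: abs_less_iff)
      moreover have "\<bar>\<theta> P\<bar> < r" "P \<in> S" "P0 \<noteq> P" using \<theta>[OF that(2)] that(2) S(6) by (auto simp: S_def)
      ultimately show ?thesis using r2 S(5) GP0 by metis
    qed
    then show ?thesis by (auto simp: N1_def N2_def)
  qed
  moreover have "card N1 = card A"
    unfolding N1_def by (intro card_image inj_on_subset[OF inj_on_branch_germ[OF grg] A_range])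
  moreover have "card N2 = card M'"
    unfolding N2_def
  proof (intro card_image inj_onI, rule ccontr)
    fix P Q assume *: "P \<in> M'" "Q \<in> M'" "branch_germ (G P) (\<theta> P) = branch_germ (G Q) (\<theta> Q)" "P \<noteq> Q"
    then have "P \<in> S" "Q \<in> S" by (auto simp: S_def)
    then show False using r2 \<theta>[OF *(1)] \<theta>[OF *(2)] *(3,4) by metis
  qed
  moreover have "finite N1" "finite N2" using A(2) S(3) by (auto simp: N1_def N2_def)
  ultimately have "card A + card M' \<le> card (M v)"
    using card_mono[OF finv, of "N1 \<union> N2"] by (simp add: card_Un_disjoint)
  \<comment> \<open>If \<open>P0\<close> is a maximum for \<open>u\<close>, the parameter 0
    contributes at least one to \<open>branch_maxima \<gamma> \<sigma> r u\<close> and makes up for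
    its removal from \<open>M'\<close>.\<close>
  moreover have "card (M u) \<le> card M' + card (branch_maxima \<gamma> \<sigma> r u)"
  proof (cases "P0 \<in> M u")
    case True
    then have "0 \<in> branch_maxima \<gamma> \<sigma> r u"
      using local_maxima_chart_iff[OF grg, of 0 "\<lambda>y. \<sigma> * sqdist u y"] gr(2)[OF S(5)]
      by (simp add: M_def T_def P0_def branch_maxima_def)
    then have "card (branch_maxima \<gamma> \<sigma> r u) \<noteq> 0" using r4 by auto
    moreover have "card M' = card (M u) - 1" using True fin by (simp add: M'_def)
    ultimately show ?thesis by linarith
  next
    case False
    then show ?thesis by (simp add: M'_def)
  qed
  ultimately show False using A(3) cardv by linarith
qed

section \<open>Extrema and sign changes of the derivative\<close>

lemma local_maxima_open_iff:
  fixes f :: "real \<Rightarrow> real"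
  assumes "open I"
  shows "s \<in> local_maxima (top_of_set I) f \<longleftrightarrow> s \<in> I \<and> (\<forall>\<^sub>F t in nhds s. f t \<le> f s)"
proof
  assume "s \<in> local_maxima (top_of_set I) f"
  then obtain W where "openin (top_of_set I) W" "s \<in> W" "\<forall>t\<in>W. f t \<le> f s" by (auto simp: local_maxima_def)
  moreover from this have "open W" "W \<subseteq> I" using assms by (auto simp: openin_open_eq)
  ultimately show "s \<in> I \<and> (\<forall>\<^sub>F t in nhds s. f t \<le> f s)" by (auto simp: eventually_nhds)
next
  assume *: "s \<in> I \<and> (\<forall>\<^sub>F t in nhds s. f t \<le> f s)"
  then obtain W where W: "open W" "s \<in> W" "\<forall>t\<in>W. f t \<le> f s" by (auto simp: eventually_nhds)
  have "openin (top_of_set I) (I \<inter> W)" using W(1) by (rule openin_open_Int)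
  then show "s \<in> local_maxima (top_of_set I) f" using W * by (auto simp: local_maxima_def)
qed

lemma has_derivative_sign_imp_less:
  fixes f D :: "real \<Rightarrow> real"
  assumes der: "\<forall>\<^sub>F t in nhds s. (f has_real_derivative D t) (at t)"
  shows "(\<forall>\<^sub>F t in at_left s. D t > 0) \<Longrightarrow> \<forall>\<^sub>F t in at_left s. f t < f s"
    and "(\<forall>\<^sub>F t in at_right s. D t > 0) \<Longrightarrow> \<forall>\<^sub>F t in at_right s. f s < f t"
proof -
  obtain d where d: "d > 0" "\<And>t. \<bar>t - s\<bar> < d \<Longrightarrow> (f has_real_derivative D t) (at t)"
    using der by (auto simp: eventually_nhds_metric dist_real_def)
  have cont: "continuous_on {a..b} f" if "s - d < a" "b < s + d" for a b
    using that by (intro DERIV_continuous_on[of _ f D] DERIV_subset[OF d(2)]) (auto simp: abs_less_iff)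
  show "\<forall>\<^sub>F t in at_left s. f t < f s" if pos: "\<forall>\<^sub>F t in at_left s. D t > 0"
  proof -
    obtain b where b: "b < s" "\<And>t. b < t \<Longrightarrow> t < s \<Longrightarrow> D t > 0"
      using pos by (auto simp: eventually_at_left[of "s - 1"])
    have "\<forall>\<^sub>F t in at_left s. t \<in> {max b (s - d)<..<s}"
      using b d(1) by (intro eventually_at_left_real) auto
    then show ?thesis
    proof eventually_elim
      case (elim t)
      have "(f has_real_derivative D x) (at x) \<and> 0 < D x" if "t < x" "x < s" for x
        using elim b d(2)[of x] that by auto
      then show ?case
        by (intro DERIV_pos_imp_increasing_open[of t s f]) (use elim cont[of t s] d(1) in auto)
    qed
  qed
  show "\<forall>\<^sub>F t in at_right s. f s < f t" if pos: "\<forall>\<^sub>F t in at_right s. D t > 0"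
  proof -
    obtain b where b: "b > s" "\<And>t. s < t \<Longrightarrow> t < b \<Longrightarrow> D t > 0"
      using pos by (auto simp: eventually_at_right[of s "s + 1"])
    have "\<forall>\<^sub>F t in at_right s. t \<in> {s<..<min b (s + d)}"
      using b d(1) by (intro eventually_at_right_real) auto
    then show ?thesis
    proof eventually_elim
      case (elim t)
      have "(f has_real_derivative D x) (at x) \<and> 0 < D x" if "s < x" "x < t" for x
        using elim b d(2)[of x] that by auto
      then show ?case
        by (intro DERIV_pos_imp_increasing_open[of s t f]) (use elim cont[of s t] d(1) in auto)
    qed
  qed
qed

lemma local_maximum_iff_derivative_sign:
  fixes f D :: "real \<Rightarrow> real"
  assumes der: "\<forall>\<^sub>F t in nhds s. (f has_real_derivative D t) (at t)" and "L \<noteq> 0" "R \<noteq> 0"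
    and L: "\<forall>\<^sub>F t in at_left s. sgn (D t) = sgn L" and R: "\<forall>\<^sub>F t in at_right s. sgn (D t) = sgn R"
  shows "(\<forall>\<^sub>F t in nhds s. f t \<le> f s) \<longleftrightarrow> L > 0 \<and> R < 0"
proof -
  have der': "\<forall>\<^sub>F t in nhds s. ((\<lambda>t. - f t) has_real_derivative - D t) (at t)"
    using der by eventually_elim (rule DERIV_minus)
  have left: "\<forall>\<^sub>F t in at_left s. f t < f s" if "L > 0"
    using L that by (intro has_derivative_sign_imp_less(1)[OF der]) (auto simp: sgn_if elim!: eventually_mono split: if_splits)
  have left': "\<forall>\<^sub>F t in at_left s. f t > f s" if "L < 0"
  proof -
    have "\<forall>\<^sub>F t in at_left s. - D t > 0"
      using L that by (auto simp: sgn_if elim!: eventually_mono split: if_splits)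
    from has_derivative_sign_imp_less(1)[OF der' this] show ?thesis by simp
  qed
  have right: "\<forall>\<^sub>F t in at_right s. f t < f s" if "R < 0"
  proof -
    have "\<forall>\<^sub>F t in at_right s. - D t > 0"
      using R that by (auto simp: sgn_if elim!: eventually_mono split: if_splits)
    from has_derivative_sign_imp_less(2)[OF der' this] show ?thesis by simp
  qed
  have right': "\<forall>\<^sub>F t in at_right s. f t > f s" if "R > 0"
    using R that by (intro has_derivative_sign_imp_less(2)[OF der]) (auto simp: sgn_if elim!: eventually_mono split: if_splits)
  have at: "\<forall>\<^sub>F t in at_left s. f t \<le> f s" "\<forall>\<^sub>F t in at_right s. f t \<le> f s" if "\<forall>\<^sub>F t in nhds s. f t \<le> f s"
    using that by (auto simp: eventually_at_filter elim: eventually_mono)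
  show ?thesis
  proof
    assume max: "\<forall>\<^sub>F t in nhds s. f t \<le> f s"
    have "\<not> L < 0"
    proof
      assume "L < 0"
      from left'[OF this] at(1)[OF max] have "\<forall>\<^sub>F t in at_left s. False" by eventually_elim simp
      then show False by simp
    qed
    moreover have "\<not> R > 0"
    proof
      assume "R > 0"
      from right'[OF this] at(2)[OF max] have "\<forall>\<^sub>F t in at_right s. False" by eventually_elim simp
      then show False by simp
    qed
    ultimately show "L > 0 \<and> R < 0" using assms(2,3) by auto
  next
    assume *: "L > 0 \<and> R < 0"
    have "\<forall>\<^sub>F t in at s. f t < f s"
      unfolding eventually_at_split using left right * by blast
    then have "\<forall>\<^sub>F t in nhds s. t \<noteq> s \<longrightarrow> f t < f s" by (simp add: eventually_at_filter)
    then show "\<forall>\<^sub>F t in nhds s. f t \<le> f s" by eventually_elim force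
  qed
qed

text \<open>Near \<open>s\<close> all factors of the product other than \<open>t - s\<close> keep
  their sign, so the derivative changes sign at points of \<open>Z\<close> and nowhere else, in a
  direction given by the cofactor. The finite set \<open>E\<close> admits points where the
  derivative vanishes without a sign change, as a factor \<open>t ^ (p - 1)\<close> does at
  0.\<close>

lemma local_maxima_by_sign:
  fixes f D :: "real \<Rightarrow> real"
  assumes I: "open I" and Z: "finite Z" "Z \<subseteq> I" and E: "finite E" and "\<tau> \<noteq> 0"
    and der: "\<And>t. t \<in> I \<Longrightarrow> (f has_real_derivative D t) (at t)"
    and sgn: "\<And>t. t \<in> I \<Longrightarrow> t \<notin> E \<Longrightarrow> sgn (D t) = sgn (\<tau> * (\<Prod>z\<in>Z. t - z))"
  shows "local_maxima (top_of_set I) f = {s \<in> Z. \<tau> * (\<Prod>z\<in>Z-{s}. s - z) < 0}"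
proof -
  have max_iff: "s \<in> local_maxima (top_of_set I) f \<longleftrightarrow> s \<in> Z \<and> \<tau> * (\<Prod>z\<in>Z-{s}. s - z) < 0" if s: "s \<in> I" for s
  proof -
    define Rf where "Rf = (\<lambda>t. \<tau> * (\<Prod>z\<in>Z-{s}. t - z))"
    define R where "R = Rf s"
    have R0: "R \<noteq> 0" unfolding R_def Rf_def using Z(1) assms(5) by simp
    have "isCont (\<lambda>t. Rf t * R) s" unfolding Rf_def by (intro continuous_intros)
    moreover have "Rf s * R > 0" using R0 by (metis R_def not_real_square_gt_zero)
    ultimately have "\<forall>\<^sub>F t in nhds s. Rf t * R > 0"
      by (rule order_tendstoD(1)[OF isCont_imp_tendsto_nhds[OF _ refl]])
    moreover have "\<forall>\<^sub>F t in nhds s. t \<in> I" using I s by (rule eventually_nhds_in_open)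
    moreover have "\<forall>\<^sub>F t in nhds s. t \<in> - (E - {s})"
      using E by (intro eventually_nhds_in_open open_Compl finite_imp_closed) auto
    ultimately have ev: "\<forall>\<^sub>F t in nhds s. t \<noteq> s \<longrightarrow> sgn (D t) = sgn ((if s \<in> Z then t - s else 1) * R)"
    proof eventually_elim
      case (elim t)
      have "(\<Prod>z\<in>Z. t - z) = (if s \<in> Z then t - s else 1) * (\<Prod>z\<in>Z-{s}. t - z)"
        using Z(1) by (auto simp: prod.remove)
      then have "\<tau> * (\<Prod>z\<in>Z. t - z) = (if s \<in> Z then t - s else 1) * Rf t" by (simp add: Rf_def)
      moreover have "sgn (Rf t) = sgn R" using elim(1) by (auto simp: sgn_if zero_less_mult_iff)
      ultimately have "sgn (\<tau> * (\<Prod>z\<in>Z. t - z)) = sgn ((if s \<in> Z then t - s else 1) * R)"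
        by (simp only: sgn_mult)
      then show ?case using sgn[of t] elim by auto
    qed
    \<comment> \<open>The signs of the derivative just left and just right of \<open>s\<close>; they
      differ exactly if \<open>s \<in> Z\<close>.\<close>
    define L' R' where "L' = (if s \<in> Z then - R else R)" and "R' = R"
    have "\<forall>\<^sub>F t in at_left s. sgn (D t) = sgn L'"
      unfolding eventually_at_filter using ev by eventually_elim (auto simp: L'_def sgn_mult)
    moreover have "\<forall>\<^sub>F t in at_right s. sgn (D t) = sgn R'"
      unfolding eventually_at_filter using ev by eventually_elim (auto simp: R'_def sgn_mult)
    moreover have "\<forall>\<^sub>F t in nhds s. (f has_real_derivative D t) (at t)"
      using eventually_nhds_in_open[OF I s] by eventually_elim (rule der)
    ultimately have "(\<forall>\<^sub>F t in nhds s. f t \<le> f s) \<longleftrightarrow> L' > 0 \<and> R' < 0"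
      using R0 by (intro local_maximum_iff_derivative_sign) (auto simp: L'_def R'_def)
    moreover have "\<tau> * (\<Prod>z\<in>Z-{s}. s - z) = R" by (simp add: R_def Rf_def)
    ultimately show ?thesis using s by (auto simp: local_maxima_open_iff[OF I] L'_def R'_def)
  qed
  show ?thesis
  proof (intro set_eqI iffI)
    fix s assume "s \<in> local_maxima (top_of_set I) f"
    moreover from this have "s \<in> I" by (simp add: local_maxima_open_iff[OF I])
    ultimately show "s \<in> {s \<in> Z. \<tau> * (\<Prod>z\<in>Z-{s}. s - z) < 0}" using max_iff by simp
  next
    fix s assume "s \<in> {s \<in> Z. \<tau> * (\<Prod>z\<in>Z-{s}. s - z) < 0}"
    moreover from this have "s \<in> I" using Z(2) by auto
    ultimately show "s \<in> local_maxima (top_of_set I) f" using max_iff by simp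
  qed
qed

lemma local_minima_by_sign:
  fixes f D :: "real \<Rightarrow> real"
  assumes I: "open I" and Z: "finite Z" "Z \<subseteq> I" and E: "finite E" and "\<tau> \<noteq> 0"
    and der: "\<And>t. t \<in> I \<Longrightarrow> (f has_real_derivative D t) (at t)"
    and sgn: "\<And>t. t \<in> I \<Longrightarrow> t \<notin> E \<Longrightarrow> sgn (D t) = sgn (\<tau> * (\<Prod>z\<in>Z. t - z))"
  shows "local_minima (top_of_set I) f = {s \<in> Z. \<tau> * (\<Prod>z\<in>Z-{s}. s - z) > 0}"
proof -
  have "local_minima (top_of_set I) f = local_maxima (top_of_set I) (\<lambda>t. - f t)" by (simp add: local_minima_eq)
  also have "\<dots> = {s \<in> Z. - \<tau> * (\<Prod>z\<in>Z-{s}. s - z) < 0}"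
  proof (rule local_maxima_by_sign[OF I Z E])
    show "((\<lambda>t. - f t) has_real_derivative - D t) (at t)" if "t \<in> I" for t using der[OF that] by (rule DERIV_minus)
    show "sgn (- D t) = sgn (- \<tau> * (\<Prod>z\<in>Z. t - z))" if "t \<in> I" "t \<notin> E" for t
      using sgn[OF that] by (simp add: sgn_minus sgn_mult)
  qed (use assms(5) in simp)
  finally show ?thesis by simp
qed

definition extrema_count :: "real set \<Rightarrow> (real \<Rightarrow> real) \<Rightarrow> nat \<times> nat \<Rightarrow> bool"
  where "extrema_count I f n \<longleftrightarrow> finite (local_maxima (top_of_set I) f) \<and> card (local_maxima (top_of_set I) f) = fst n \<and>
    finite (local_minima (top_of_set I) f) \<and> card (local_minima (top_of_set I) f) = snd n"

text \<open>A negative overall sign of the derivative exchanges maxima and minima; this is the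
  interchange of roles in the classification.\<close>

definition oriented :: "real \<Rightarrow> nat \<times> nat \<Rightarrow> nat \<times> nat"
  where "oriented \<tau> n = (if \<tau> > 0 then n else prod.swap n)"

lemma extrema_count_by_sign:
  fixes f D :: "real \<Rightarrow> real"
  assumes I: "open I" and E: "finite E" and "\<tau> \<noteq> 0"
    and der: "\<And>t. t \<in> I \<Longrightarrow> (f has_real_derivative D t) (at t)"
  shows "(\<And>t. t \<in> I \<Longrightarrow> t \<notin> E \<Longrightarrow> sgn (D t) = sgn \<tau>) \<Longrightarrow> extrema_count I f (0, 0)"
    and "z1 \<in> I \<Longrightarrow> (\<And>t. t \<in> I \<Longrightarrow> t \<notin> E \<Longrightarrow> sgn (D t) = sgn (\<tau> * (t - z1))) \<Longrightarrow>
      extrema_count I f (oriented \<tau> (0, 1))"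
    and "z1 \<in> I \<Longrightarrow> z2 \<in> I \<Longrightarrow> z1 < z2 \<Longrightarrow>
      (\<And>t. t \<in> I \<Longrightarrow> t \<notin> E \<Longrightarrow> sgn (D t) = sgn (\<tau> * ((t - z1) * (t - z2)))) \<Longrightarrow> extrema_count I f (1, 1)"
    and "z1 \<in> I \<Longrightarrow> z2 \<in> I \<Longrightarrow> z3 \<in> I \<Longrightarrow> z1 < z2 \<Longrightarrow> z2 < z3 \<Longrightarrow>
      (\<And>t. t \<in> I \<Longrightarrow> t \<notin> E \<Longrightarrow> sgn (D t) = sgn (\<tau> * ((t - z1) * ((t - z2) * (t - z3))))) \<Longrightarrow>
      extrema_count I f (oriented \<tau> (1, 2))"
proof -
  note max = local_maxima_by_sign[OF I _ _ E assms(3) der] and min = local_minima_by_sign[OF I _ _ E assms(3) der]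
  show "extrema_count I f (0, 0)" if "\<And>t. t \<in> I \<Longrightarrow> t \<notin> E \<Longrightarrow> sgn (D t) = sgn \<tau>"
    using max[of "{}"] min[of "{}"] that by (simp add: extrema_count_def)
  show "extrema_count I f (oriented \<tau> (0, 1))"
    if "z1 \<in> I" "\<And>t. t \<in> I \<Longrightarrow> t \<notin> E \<Longrightarrow> sgn (D t) = sgn (\<tau> * (t - z1))"
  proof -
    have "local_maxima (top_of_set I) f = (if \<tau> > 0 then {} else {z1})"
      using max[of "{z1}"] that assms(3) by auto
    moreover have "local_minima (top_of_set I) f = (if \<tau> > 0 then {z1} else {})"
      using min[of "{z1}"] that assms(3) by auto
    ultimately show ?thesis by (simp add: extrema_count_def oriented_def)
  qed
  show "extrema_count I f (1, 1)"
    if "z1 \<in> I" "z2 \<in> I" "z1 < z2" "\<And>t. t \<in> I \<Longrightarrow> t \<notin> E \<Longrightarrow> sgn (D t) = sgn (\<tau> * ((t - z1) * (t - z2)))"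
  proof -
    have d: "{z1, z2} - {z1} = {z2}" "{z1, z2} - {z2} = {z1}" using that(3) by auto
    have P: "(\<Prod>z\<in>{z1,z2}. t - z) = (t - z1) * (t - z2)" for t using that(3) by simp
    have "local_maxima (top_of_set I) f = {s \<in> {z1, z2}. \<tau> * (\<Prod>z\<in>{z1, z2}-{s}. s - z) < 0}"
      by (rule max) (use that P in auto)
    also have "\<dots> = (if \<tau> > 0 then {z1} else {z2})"
      using that(3) assms(3) by (auto simp: d mult_less_0_iff)
    finally have 1: "local_maxima (top_of_set I) f = (if \<tau> > 0 then {z1} else {z2})" .
    have "local_minima (top_of_set I) f = {s \<in> {z1, z2}. \<tau> * (\<Prod>z\<in>{z1, z2}-{s}. s - z) > 0}"
      by (rule min) (use that P in auto)
    also have "\<dots> = (if \<tau> > 0 then {z2} else {z1})"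
      using that(3) assms(3) by (auto simp: d zero_less_mult_iff)
    finally show ?thesis using 1 by (simp add: extrema_count_def)
  qed
  show "extrema_count I f (oriented \<tau> (1, 2))"
    if "z1 \<in> I" "z2 \<in> I" "z3 \<in> I" "z1 < z2" "z2 < z3"
      "\<And>t. t \<in> I \<Longrightarrow> t \<notin> E \<Longrightarrow> sgn (D t) = sgn (\<tau> * ((t - z1) * ((t - z2) * (t - z3))))"
  proof -
    have d: "{z1, z2, z3} - {z1} = {z2, z3}" "{z1, z2, z3} - {z2} = {z1, z3}" "{z1, z2, z3} - {z3} = {z1, z2}"
      using that(4,5) by auto
    have P: "(\<Prod>z\<in>{z1,z2,z3}. t - z) = (t - z1) * ((t - z2) * (t - z3))" for t using that(4,5) by simp
    have pr: "(\<Prod>z\<in>{z2,z3}. z1 - z) > 0" "(\<Prod>z\<in>{z1,z3}. z2 - z) < 0" "(\<Prod>z\<in>{z1,z2}. z3 - z) > 0"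
      using that(4,5) by (auto simp: zero_less_mult_iff mult_less_0_iff)
    have "local_maxima (top_of_set I) f = {s \<in> {z1, z2, z3}. \<tau> * (\<Prod>z\<in>{z1, z2, z3}-{s}. s - z) < 0}"
      by (rule max) (use that P in auto)
    also have "\<dots> = (if \<tau> > 0 then {z2} else {z1, z3})"
      using that(4,5) assms(3) pr by (auto simp: d mult_less_0_iff simp del: prod.insert)
    finally have 1: "local_maxima (top_of_set I) f = (if \<tau> > 0 then {z2} else {z1, z3})" .
    have "local_minima (top_of_set I) f = {s \<in> {z1, z2, z3}. \<tau> * (\<Prod>z\<in>{z1, z2, z3}-{s}. s - z) > 0}"
      by (rule min) (use that P in auto)
    also have "\<dots> = (if \<tau> > 0 then {z1, z3} else {z2})"
      using that(4,5) assms(3) pr by (auto simp: d zero_less_mult_iff simp del: prod.insert)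
    finally show ?thesis using 1 that(4,5) by (simp add: extrema_count_def oriented_def)
  qed
qed

text \<open>The derivative is \<open>t ^ (m - 1)\<close> times \<open>m * h t + t * h' t\<close>,
  and the second factor tends to \<open>m * h 0 > 0\<close>.\<close>

lemma power_times_positive_increasing:
  assumes "real_analytic_at h 0" "h 0 > 0" "m \<ge> 1"
  shows "\<exists>\<epsilon>>0. \<forall>s t. 0 \<le> s \<and> s < t \<and> t < \<epsilon> \<longrightarrow> s ^ m * h s < t ^ m * h t"
proof -
  obtain h' where h': "real_analytic_at h' 0" "\<forall>\<^sub>F t in nhds 0. (h has_real_derivative h' t) (at t)"
    using real_analytic_deriv[OF assms(1)] by blast
  have "real_analytic_at (\<lambda>t. m * h t + t * h' t) 0" by (intro real_analytic_add real_analytic_mult real_analytic_const real_analytic_ident assms h')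
  from order_tendstoD(1)[OF real_analytic_tendsto[OF this], of 0]
  have "\<forall>\<^sub>F t in nhds 0. m * h t + t * h' t > 0" using assms(2,3) by simp
  with h'(2) have "\<forall>\<^sub>F t in nhds 0. (h has_real_derivative h' t) (at t) \<and> m * h t + t * h' t > 0" by (rule eventually_conj)
  then obtain \<epsilon> where \<epsilon>: "\<epsilon> > 0" "\<And>t. \<bar>t\<bar> < \<epsilon> \<Longrightarrow> (h has_real_derivative h' t) (at t) \<and> m * h t + t * h' t > 0"
    by (auto simp: eventually_nhds_metric dist_real_def)
  have der: "((\<lambda>t. t ^ m * h t) has_real_derivative t ^ (m - 1) * (m * h t + t * h' t)) (at t)" if "\<bar>t\<bar> < \<epsilon>" for t
  proof -
    have "t ^ m = t ^ (m - 1) * t" using assms(3) by (metis power_minus_mult less_eq_Suc_le One_nat_def)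
    then show ?thesis using \<epsilon>(2)[OF that] by (auto intro!: derivative_eq_intros simp: algebra_simps)
  qed
  have "s ^ m * h s < t ^ m * h t" if "0 \<le> s" "s < t" "t < \<epsilon>" for s t
  proof (rule DERIV_pos_imp_increasing_open[OF that(2)])
    show "\<exists>y. ((\<lambda>t. t ^ m * h t) has_real_derivative y) (at x) \<and> 0 < y" if "s < x" "x < t" for x
    proof -
      have "0 < x ^ (m - 1) * (m * h x + x * h' x)"
        using \<epsilon>(2)[of x] that \<open>0 \<le> s\<close> \<open>t < \<epsilon>\<close> by (intro mult_pos_pos zero_less_power) auto
      then show ?thesis using der[of x] that \<open>0 \<le> s\<close> \<open>t < \<epsilon>\<close> by auto
    qed
    show "continuous_on {s..t} (\<lambda>t. t ^ m * h t)"
      by (rule DERIV_continuous_on, rule DERIV_subset[OF der]) (use that in auto)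
  qed
  with \<epsilon>(1) show ?thesis by blast
qed

lemma increasing_level:
  fixes \<phi> :: "real \<Rightarrow> real"
  assumes inc: "\<And>s t. 0 \<le> s \<Longrightarrow> s < t \<Longrightarrow> t < \<epsilon>0 \<Longrightarrow> \<phi> s < \<phi> t" and "\<phi> 0 = 0"
    and cont: "\<And>t. 0 \<le> t \<Longrightarrow> t < \<epsilon>0 \<Longrightarrow> isCont \<phi> t" and "0 < \<epsilon>" "\<epsilon> < \<epsilon>0" and A: "0 < A" "A < \<phi> \<epsilon>"
  shows "\<exists>z. 0 < z \<and> z < \<epsilon> \<and> (\<forall>t. 0 \<le> t \<and> t < \<epsilon>0 \<longrightarrow> sgn (\<phi> t - A) = sgn (t - z))"
proof -
  have "\<exists>z. 0 \<le> z \<and> z \<le> \<epsilon> \<and> \<phi> z = A"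
    by (rule IVT) (use assms in auto)
  then obtain z where z: "0 \<le> z" "z \<le> \<epsilon>" "\<phi> z = A" by blast
  have "z \<noteq> 0" "z \<noteq> \<epsilon>" using z A assms(2) by auto
  moreover have "sgn (\<phi> t - A) = sgn (t - z)" if "0 \<le> t" "t < \<epsilon>0" for t
    using inc[of t z] inc[of z t] z that assms(5) by (cases t z rule: linorder_cases) auto
  ultimately show ?thesis using z by (intro exI[of _ z]) auto
qed

text \<open>Both halves of the interval are treated as increasing functions on the positive side,
  the negative half after reflection. A small level \<open>A\<close> is crossed once for odd
  \<open>m\<close>, and for even \<open>m\<close> twice if \<open>A > 0\<close> and not at all away
  from 0 if \<open>A \<le> 0\<close>.\<close>

lemma level_sign_structure:
  assumes h: "real_analytic_at h 0" "h 0 > 0" "m \<ge> 1"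
  shows "\<forall>\<^sub>F \<epsilon> in at_right 0. \<exists>\<delta>>0. \<forall>A. \<bar>A\<bar> < \<delta> \<longrightarrow>
    (odd m \<longrightarrow> (\<exists>z. -\<epsilon> < z \<and> z < \<epsilon> \<and> sgn z = sgn A \<and> (\<forall>t\<in>{-\<epsilon><..<\<epsilon>}. sgn (t ^ m * h t - A) = sgn (t - z)))) \<and>
    (even m \<and> A > 0 \<longrightarrow> (\<exists>z1 z2. -\<epsilon> < z1 \<and> z1 < 0 \<and> 0 < z2 \<and> z2 < \<epsilon> \<and>
        (\<forall>t\<in>{-\<epsilon><..<\<epsilon>}. sgn (t ^ m * h t - A) = sgn ((t - z1) * (t - z2))))) \<and>
    (even m \<and> A \<le> 0 \<longrightarrow> (\<forall>t\<in>{-\<epsilon><..<\<epsilon>}. t \<noteq> 0 \<longrightarrow> t ^ m * h t - A > 0))"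
proof -
  define g where "g = (\<lambda>t. h (- t))"
  have g: "real_analytic_at g 0" "g 0 > 0"
    using real_analytic_compose[of "\<lambda>t. - t" 0 h] real_analytic_diff[OF real_analytic_const[of 0] real_analytic_ident, of 0] h by (auto simp: g_def)
  define \<phi> where "\<phi> = (\<lambda>t. t ^ m * h t)"
  define \<psi> where "\<psi> = (\<lambda>t. t ^ m * g t)"
  have refl: "\<phi> t = (if odd m then - \<psi> (- t) else \<psi> (- t))" for t by (simp add: \<phi>_def \<psi>_def g_def)
  obtain e1 where e1: "e1 > 0" "\<And>s t. 0 \<le> s \<Longrightarrow> s < t \<Longrightarrow> t < e1 \<Longrightarrow> \<phi> s < \<phi> t"
    using power_times_positive_increasing[OF h] by (auto simp: \<phi>_def)
  obtain e2 where e2: "e2 > 0" "\<And>s t. 0 \<le> s \<Longrightarrow> s < t \<Longrightarrow> t < e2 \<Longrightarrow> \<psi> s < \<psi> t"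
    using power_times_positive_increasing[OF g h(3)] by (auto simp: \<psi>_def)
  have "real_analytic_at \<phi> 0" "real_analytic_at \<psi> 0" unfolding \<phi>_def \<psi>_def by (intro real_analytic_mult real_analytic_power real_analytic_ident h g)+
  from real_analytic_eventually[OF this(1)] real_analytic_eventually[OF this(2)]
  have "\<forall>\<^sub>F t in nhds 0. isCont \<phi> t \<and> isCont \<psi> t" by eventually_elim (simp add: real_analytic_isCont)
  then obtain e3 where e3: "e3 > 0" "\<And>t. \<bar>t\<bar> < e3 \<Longrightarrow> isCont \<phi> t \<and> isCont \<psi> t"
    by (auto simp: eventually_nhds_metric dist_real_def)
  define e0 where "e0 = min e1 (min e2 e3)"
  have e0: "e0 > 0" using e1 e2 e3 by (simp add: e0_def)
  have inc: "\<phi> s < \<phi> t" "\<psi> s < \<psi> t" if "0 \<le> s" "s < t" "t < e0" for s t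
    using e1(2)[of s t] e2(2)[of s t] that by (auto simp: e0_def)
  have cont: "isCont \<phi> t" "isCont \<psi> t" if "0 \<le> t" "t < e0" for t using e3(2)[of t] that by (auto simp: e0_def)
  have z0: "\<phi> 0 = 0" "\<psi> 0 = 0" using h(3) by (auto simp: \<phi>_def \<psi>_def)
  have pos: "\<phi> t > 0" "\<psi> t > 0" if "0 < t" "t < e0" for t using inc[of 0 t] that z0 by auto
  show ?thesis
    using eventually_at_right_pos_less[OF e0]
  proof eventually_elim
    case (elim \<epsilon>)
    \<comment> \<open>Levels below the absolute values at both \<open>\<epsilon>/2\<close> and
      \<open>-\<epsilon>/2\<close> are crossed inside the interval.\<close>
    define \<delta> where "\<delta> = min (\<phi> (\<epsilon>/2)) (\<psi> (\<epsilon>/2))"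
    have \<delta>0: "\<delta> > 0" using pos[of "\<epsilon>/2"] elim by (simp add: \<delta>_def)
    have lev1: "\<exists>z. 0 < z \<and> z < \<epsilon> \<and> (\<forall>t. 0 \<le> t \<and> t < e0 \<longrightarrow> sgn (\<phi> t - A) = sgn (t - z))" if "0 < A" "A < \<delta>" for A
      using increasing_level[of e0 \<phi> "\<epsilon>/2" A] inc cont z0 that elim by (fastforce simp: \<delta>_def)
    have lev2: "\<exists>z. 0 < z \<and> z < \<epsilon> \<and> (\<forall>t. 0 \<le> t \<and> t < e0 \<longrightarrow> sgn (\<psi> t - A) = sgn (t - z))" if "0 < A" "A < \<delta>" for A
      using increasing_level[of e0 \<psi> "\<epsilon>/2" A] inc cont z0 that elim by (fastforce simp: \<delta>_def)
    have "(odd m \<longrightarrow> (\<exists>z. -\<epsilon> < z \<and> z < \<epsilon> \<and> sgn z = sgn A \<and> (\<forall>t\<in>{-\<epsilon><..<\<epsilon>}. sgn (\<phi> t - A) = sgn (t - z)))) \<and>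
      (even m \<and> A > 0 \<longrightarrow> (\<exists>z1 z2. -\<epsilon> < z1 \<and> z1 < 0 \<and> 0 < z2 \<and> z2 < \<epsilon> \<and>
        (\<forall>t\<in>{-\<epsilon><..<\<epsilon>}. sgn (\<phi> t - A) = sgn ((t - z1) * (t - z2))))) \<and>
      (even m \<and> A \<le> 0 \<longrightarrow> (\<forall>t\<in>{-\<epsilon><..<\<epsilon>}. t \<noteq> 0 \<longrightarrow> \<phi> t - A > 0))" if A: "\<bar>A\<bar> < \<delta>" for A
    proof (intro conjI impI)
      assume m: "odd m"
      show "\<exists>z. -\<epsilon> < z \<and> z < \<epsilon> \<and> sgn z = sgn A \<and> (\<forall>t\<in>{-\<epsilon><..<\<epsilon>}. sgn (\<phi> t - A) = sgn (t - z))"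
      proof (cases A "0::real" rule: linorder_cases)
        case greater
        then obtain z where z: "0 < z" "z < \<epsilon>" "\<And>t. 0 \<le> t \<Longrightarrow> t < e0 \<Longrightarrow> sgn (\<phi> t - A) = sgn (t - z)"
          using lev1[of A] A by auto
        have "sgn (\<phi> t - A) = sgn (t - z)" if "t \<in> {-\<epsilon><..<\<epsilon>}" for t
          using z(3)[of t] pos(2)[of "- t"] refl[of t] m greater z(1) elim that by (cases "t \<ge> 0") auto
        then show ?thesis using z greater by (intro exI[of _ z]) auto
      next
        case less
        then obtain z where z: "0 < z" "z < \<epsilon>" "\<And>t. 0 \<le> t \<Longrightarrow> t < e0 \<Longrightarrow> sgn (\<psi> t - (- A)) = sgn (t - z)"
          using lev2[of "- A"] A by auto
        have "sgn (\<phi> t - A) = sgn (t - - z)" if "t \<in> {-\<epsilon><..<\<epsilon>}" for t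
        proof (cases "t \<le> 0")
          case True
          then have "sgn (\<psi> (- t) - (- A)) = sgn (- t - z)" using z(3)[of "- t"] elim that by auto
          moreover have "\<phi> t - A = - (\<psi> (- t) - (- A))" "t - - z = - (- t - z)" using refl[of t] m by auto
          ultimately show ?thesis by (simp only: sgn_minus)
        next
          case False
          then show ?thesis using pos(1)[of t] less z(1) elim that by auto
        qed
        then show ?thesis using z less by (intro exI[of _ "- z"]) auto
      next
        case equal
        have "sgn (\<phi> t) = sgn t" if "t \<in> {-\<epsilon><..<\<epsilon>}" for t
          using pos(1)[of t] pos(2)[of "- t"] refl[of t] m z0 elim that by (cases t "0::real" rule: linorder_cases) auto
        then show ?thesis using equal elim by (intro exI[of _ 0]) auto
      qed
    next
      assume m: "even m \<and> A > 0"
      then obtain z where z: "0 < z" "z < \<epsilon>" "\<And>t. 0 \<le> t \<Longrightarrow> t < e0 \<Longrightarrow> sgn (\<phi> t - A) = sgn (t - z)"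
        using lev1[of A] A by auto
      obtain w where w: "0 < w" "w < \<epsilon>" "\<And>t. 0 \<le> t \<Longrightarrow> t < e0 \<Longrightarrow> sgn (\<psi> t - A) = sgn (t - w)"
        using lev2[of A] A m by auto
      have "sgn (\<phi> t - A) = sgn ((t - - w) * (t - z))" if "t \<in> {-\<epsilon><..<\<epsilon>}" for t
      proof (cases "t \<ge> 0")
        case True
        then have "sgn (t - - w) = 1" using w(1) by simp
        then show ?thesis using z(3)[of t] True elim that by (simp add: sgn_mult)
      next
        case False
        then have "sgn (t - z) = -1" using z(1) by simp
        moreover have "sgn (\<phi> t - A) = sgn (- t - w)" using w(3)[of "- t"] refl[of t] m False elim that by auto
        moreover have "sgn (- t - w) = - sgn (t - - w)" by (simp add: sgn_if)
        ultimately show ?thesis by (simp only: sgn_mult)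
      qed
      then show "\<exists>z1 z2. -\<epsilon> < z1 \<and> z1 < 0 \<and> 0 < z2 \<and> z2 < \<epsilon> \<and> (\<forall>t\<in>{-\<epsilon><..<\<epsilon>}. sgn (\<phi> t - A) = sgn ((t - z1) * (t - z2)))"
        using z w by (intro exI[of _ "- w"] exI[of _ z]) auto
    next
      assume m: "even m \<and> A \<le> 0"
      have "\<phi> t > 0" if "t \<in> {-\<epsilon><..<\<epsilon>}" "t \<noteq> 0" for t
        using pos(1)[of t] pos(2)[of "- t"] refl[of t] m elim that by (cases "t > 0") auto
      then show "\<forall>t\<in>{-\<epsilon><..<\<epsilon>}. t \<noteq> 0 \<longrightarrow> \<phi> t - A > 0" using m by fastforce
    qed
    then show ?case using \<delta>0 unfolding \<phi>_def by blast
  qed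
qed

section \<open>Unfoldings\<close>

lemma has_extrema_eq: "has_extrema \<gamma> \<epsilon> u n \<longleftrightarrow> extrema_count {-\<epsilon><..<\<epsilon>} (\<lambda>t. sqdist u (\<gamma> t)) n"
  by (simp add: has_extrema_def extrema_count_def Let_def)

lemma connected_components_of_Ioo:
  "0 < (\<epsilon>::real) \<Longrightarrow> connected_components_of (top_of_set {-\<epsilon><..<\<epsilon>}) = {{-\<epsilon><..<\<epsilon>}}"
  by (subst connected_components_of_eq_singleton)
     (auto simp: connected_space_subtopology simp flip: null_topspace_iff_trivial)

lemma top_equivalent_if_extrema_count:
  assumes "0 < \<epsilon>" "extrema_count {-\<epsilon><..<\<epsilon>} f n" "extrema_count {-\<epsilon><..<\<epsilon>} g n"
  shows "top_equivalent (top_of_set {-\<epsilon><..<\<epsilon>}) f g"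
proof -
  have "local_maxima (top_of_set {-\<epsilon><..<\<epsilon>}) k \<inter> {-\<epsilon><..<\<epsilon>} = local_maxima (top_of_set {-\<epsilon><..<\<epsilon>}) k" for k
    by (auto simp: local_maxima_open_iff)
  then show ?thesis
    using assms by (simp add: top_equivalent_def connected_components_of_Ioo local_minima_eq extrema_count_def eqpoll_iff_card)
qed

lemma gains_maxima_germ_discriminant:
  assumes "gains_maxima \<gamma> 1 u" shows "u \<in> germ_discriminant \<gamma>"
proof (rule ccontr)
  assume "u \<notin> germ_discriminant \<gamma>"
  then have st: "\<forall>\<^sub>F \<epsilon> in at_right 0. \<exists>U. open U \<and> u \<in> U \<and>
       (\<forall>v\<in>U. top_equivalent (top_of_set {-\<epsilon><..<\<epsilon>}) (\<lambda>t. sqdist v (\<gamma> t)) (\<lambda>t. sqdist u (\<gamma> t)))"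
    by (simp add: germ_discriminant_def germ_stable_def)
  have "\<forall>\<^sub>F \<epsilon> in at_right (0::real). 0 < \<epsilon>"
    using eventually_at_right_pos_less[of 1] by (auto elim: eventually_mono)
  from eventually_happens'[OF trivial_limit_at_right_real
      eventually_conj[OF this eventually_conj[OF st assms[unfolded gains_maxima_def]]]]
  obtain \<epsilon> where \<epsilon>': "0 < \<epsilon> \<and> (\<exists>U. open U \<and> u \<in> U \<and>
       (\<forall>v\<in>U. top_equivalent (top_of_set {-\<epsilon><..<\<epsilon>}) (\<lambda>t. sqdist v (\<gamma> t)) (\<lambda>t. sqdist u (\<gamma> t)))) \<and>
    finite (branch_maxima \<gamma> 1 \<epsilon> u) \<and> (\<forall>U. open U \<and> u \<in> U \<longrightarrow>
       (\<exists>v\<in>U. \<exists>S\<subseteq>branch_maxima \<gamma> 1 \<epsilon> v. finite S \<and> card (branch_maxima \<gamma> 1 \<epsilon> u) < card S))"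
    by (rule exE)
  note \<epsilon> = conjunct1[OF \<epsilon>'] and st' = conjunct1[OF conjunct2[OF \<epsilon>']]
    and fin = conjunct1[OF conjunct2[OF conjunct2[OF \<epsilon>']]] and gain = conjunct2[OF conjunct2[OF conjunct2[OF \<epsilon>']]]
  obtain U where U: "open U" "u \<in> U"
    "\<And>v. v \<in> U \<Longrightarrow> top_equivalent (top_of_set {-\<epsilon><..<\<epsilon>}) (\<lambda>t. sqdist v (\<gamma> t)) (\<lambda>t. sqdist u (\<gamma> t))"
    using st' by blast
  then obtain v S where v: "v \<in> U" "S \<subseteq> branch_maxima \<gamma> 1 \<epsilon> v" "finite S" "card (branch_maxima \<gamma> 1 \<epsilon> u) < card S"
    using gain by blast
  have "branch_maxima \<gamma> 1 \<epsilon> v \<inter> {-\<epsilon><..<\<epsilon>} \<approx> branch_maxima \<gamma> 1 \<epsilon> u \<inter> {-\<epsilon><..<\<epsilon>}"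
    unfolding branch_maxima_def
    by (rule top_equivalent_signed[OF U(3)[OF v(1)]]) (auto simp: connected_components_of_Ioo \<epsilon>)
  moreover have "branch_maxima \<gamma> 1 \<epsilon> w \<inter> {-\<epsilon><..<\<epsilon>} = branch_maxima \<gamma> 1 \<epsilon> w" for w
    by (auto simp: branch_maxima_def local_maxima_open_iff)
  ultimately have "branch_maxima \<gamma> 1 \<epsilon> v \<approx> branch_maxima \<gamma> 1 \<epsilon> u" by simp
  then have "finite (branch_maxima \<gamma> 1 \<epsilon> v)" "card (branch_maxima \<gamma> 1 \<epsilon> v) = card (branch_maxima \<gamma> 1 \<epsilon> u)"
    using fin eqpoll_finite_iff[of "branch_maxima \<gamma> 1 \<epsilon> v"] eqpoll_iff_card[of "branch_maxima \<gamma> 1 \<epsilon> v"] by auto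
  then show False using v card_mono[of "branch_maxima \<gamma> 1 \<epsilon> v" S] by simp
qed

text \<open>Maxima and minima near 0 of a function with derivative \<open>2 t\<^sup>p\<^sup>-\<^sup>1 (G t - p a)\<close>, where \<open>G t \<sim> k t\<^sup>m\<close>
  and \<open>s = k a\<close>; for \<open>k < 0\<close> the two numbers have to be interchanged.\<close>

definition unfolding_count :: "nat \<Rightarrow> nat \<Rightarrow> real \<Rightarrow> nat \<times> nat"
  where "unfolding_count p m s =
    (if odd p then if odd m then (0, 1) else if s > 0 then (1, 1) else (0, 0)
     else if odd m then if s = 0 then (0, 0) else (1, 1) else if s > 0 then (1, 2) else (0, 1))"

definition leading :: "(real \<Rightarrow> real) \<Rightarrow> nat \<Rightarrow> real \<Rightarrow> bool"
  where "leading G m k \<longleftrightarrow> k \<noteq> 0 \<and> m \<ge> 1 \<and> (\<exists>h. real_analytic_at h 0 \<and> h 0 = k \<and> (\<forall>\<^sub>F t in nhds 0. G t = t ^ m * h t))"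

text \<open>Multiplication by the sign of \<open>k\<close> reduces to a positive leading
  coefficient, and the sign of \<open>G t - p * a\<close> is that of a level crossing at
  \<open>A = \<kappa> * (p * a)\<close>. The factor \<open>t ^ (p - 1)\<close> adds a sign change at
  0 precisely when \<open>p\<close> is even.\<close>

lemma leading_unfolding_count:
  assumes lead: "leading G m k" and p: "p \<ge> 1"
    and der: "\<forall>\<^sub>F t in nhds 0. \<forall>a::real. (f a has_real_derivative 2 * t ^ (p - 1) * (G t - p * a)) (at t)"
  shows "\<forall>\<^sub>F \<epsilon> in at_right 0. \<exists>\<delta>>0. \<forall>a. \<bar>a\<bar> < \<delta> \<longrightarrow>
    extrema_count {-\<epsilon><..<\<epsilon>} (f a) (oriented k (unfolding_count p m (k * a)))"
proof -
  obtain h where h: "real_analytic_at h 0" "h 0 = k" "\<forall>\<^sub>F t in nhds 0. G t = t ^ m * h t" and k: "k \<noteq> 0" and m: "m \<ge> 1"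
    using lead by (auto simp: leading_def)
  define \<kappa> where "\<kappa> = sgn k"
  have \<kappa>: "\<kappa> \<noteq> 0" "\<kappa> * k > 0" "sgn \<kappa> = \<kappa>" "\<kappa> * \<kappa> = 1" using k by (auto simp: \<kappa>_def sgn_if)
  have hk: "real_analytic_at (\<lambda>t. \<kappa> * h t) 0" "\<kappa> * h 0 > 0" using h \<kappa> by auto
  obtain d where d: "d > 0" "\<And>t. \<bar>t\<bar> < d \<Longrightarrow> G t = t ^ m * h t \<and> (\<forall>a::real. (f a has_real_derivative 2 * t ^ (p - 1) * (G t - p * a)) (at t))"
    using eventually_conj[OF h(3) der] by (auto simp: eventually_nhds_metric dist_real_def)
  show ?thesis
    using level_sign_structure[OF hk m] eventually_at_right_pos_less[OF d(1)]
  proof eventually_elim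
    case (elim \<epsilon>)
    define I where "I = {-\<epsilon><..<\<epsilon>}"
    obtain \<delta> where \<delta>: "\<delta> > 0" "\<And>A. \<bar>A\<bar> < \<delta> \<Longrightarrow>
      (odd m \<longrightarrow> (\<exists>z. -\<epsilon> < z \<and> z < \<epsilon> \<and> sgn z = sgn A \<and> (\<forall>t\<in>I. sgn (t ^ m * (\<kappa> * h t) - A) = sgn (t - z)))) \<and>
      (even m \<and> A > 0 \<longrightarrow> (\<exists>z1 z2. -\<epsilon> < z1 \<and> z1 < 0 \<and> 0 < z2 \<and> z2 < \<epsilon> \<and>
        (\<forall>t\<in>I. sgn (t ^ m * (\<kappa> * h t) - A) = sgn ((t - z1) * (t - z2))))) \<and>
      (even m \<and> A \<le> 0 \<longrightarrow> (\<forall>t\<in>I. t \<noteq> 0 \<longrightarrow> t ^ m * (\<kappa> * h t) - A > 0))"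
      using elim(1) unfolding I_def by blast
    have I: "open I" "0 \<in> I" using elim(2) by (auto simp: I_def)
    have Id: "\<bar>t\<bar> < d" if "t \<in> I" for t using that elim(2) by (auto simp: I_def)
    have "extrema_count I (f a) (oriented k (unfolding_count p m (k * a)))" if a: "\<bar>a\<bar> < \<delta> / p" for a
    proof -
      define A where "A = \<kappa> * (p * a)"
      have "\<bar>A\<bar> = p * \<bar>a\<bar>" using k by (simp add: A_def \<kappa>_def abs_mult)
      then have "\<bar>A\<bar> < \<delta>" using a p by (simp add: pos_less_divide_eq mult.commute)
      note \<delta>A = \<delta>(2)[OF this]
      have ka: "k * a > 0 \<longleftrightarrow> A > 0" "k * a = 0 \<longleftrightarrow> A = 0"
        using k p by (auto simp: A_def \<kappa>_def sgn_if zero_less_mult_iff mult_less_0_iff)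
      define D where "D = (\<lambda>t. 2 * t ^ (p - 1) * (G t - p * a))"
      have derI: "(f a has_real_derivative D t) (at t)" if "t \<in> I" for t
        using d(2)[OF Id[OF that]] unfolding D_def by blast
      have sD: "sgn (D t) = (if odd p then 1 else sgn t) * (\<kappa> * sgn (t ^ m * (\<kappa> * h t) - A))" if t: "t \<in> I" "t \<notin> {0}" for t
      proof -
        have "sgn (t ^ (p - 1)) = (if odd p then 1 else sgn t)"
          using t p by (auto simp: sgn_if zero_less_power_eq)
        moreover have "t ^ m * (\<kappa> * h t) - A = \<kappa> * (G t - p * a)"
          using d(2)[OF Id[OF t(1)]] by (simp add: A_def algebra_simps)
        then have "\<kappa> * sgn (t ^ m * (\<kappa> * h t) - A) = \<kappa> * \<kappa> * sgn (G t - p * a)"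
          by (simp only: sgn_mult \<kappa>(3) mult.assoc)
        ultimately show ?thesis by (simp add: D_def sgn_mult \<kappa>(4))
      qed
      note cnt = extrema_count_by_sign[OF I(1) finite.insertI[OF finite.emptyI, of 0] \<kappa>(1) derI]
      have or: "oriented k n = oriented \<kappa> n" for n by (simp add: oriented_def \<kappa>_def)
      have or': "oriented k (n, n) = (n, n)" for n by (simp add: oriented_def)
      show ?thesis
      proof (cases "odd m")
        case True
        then obtain z where z: "z \<in> I" "sgn z = sgn A" "\<And>t. t \<in> I \<Longrightarrow> sgn (t ^ m * (\<kappa> * h t) - A) = sgn (t - z)"
          using \<delta>A by (auto simp: I_def)
        show ?thesis
        proof (cases "odd p")
          case odd: True
          have "extrema_count I (f a) (oriented \<kappa> (0, 1))"
            by (rule cnt(2)[OF _ z(1)]) (use sD z(3) odd in \<open>simp_all add: sgn_mult \<kappa>\<close>)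
          then show ?thesis using True odd by (simp add: unfolding_count_def or)
        next
          case even: False
          consider "A = 0" | "z > 0" "A \<noteq> 0" | "z < 0" "A \<noteq> 0" using z(2) by (metis linorder_neqE_linordered_idom sgn_0_0 sgn_zero)
          then show ?thesis
          proof cases
            case 1
            \<comment> \<open>At level 0 the crossing falls on the sign change of
              \<open>t ^ (p - 1)\<close>; the two cancel, and no extremum remains.\<close>
            then have z0: "z = 0" using z(2) by (simp add: sgn_0_0)
            have "sgn (D t) = sgn \<kappa>" if "t \<in> I" "t \<notin> {0}" for t
            proof -
              have "sgn t * sgn t = 1" using that(2) by (simp add: sgn_if)
              then show ?thesis using sD[OF that] z(3)[OF that(1)] even by (simp add: z0 \<kappa>(3))
            qed
            then have "extrema_count I (f a) (0, 0)" by (intro cnt(1)) auto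
            then show ?thesis using True even 1 ka by (simp add: unfolding_count_def or')
          next
            case 2
            have "extrema_count I (f a) (1, 1)"
              by (rule cnt(3)[OF _ I(2) z(1) 2(1)]) (use sD z(3) even in \<open>simp_all add: sgn_mult \<kappa>\<close>)
            then show ?thesis using True even 2 ka by (simp add: unfolding_count_def or')
          next
            case 3
            have "extrema_count I (f a) (1, 1)"
              by (rule cnt(3)[OF _ z(1) I(2) 3(1)]) (use sD z(3) even in \<open>simp_all add: sgn_mult \<kappa>\<close>)
            then show ?thesis using True even 3 ka by (simp add: unfolding_count_def or')
          qed
        qed
      next
        case em: False
        show ?thesis
        proof (cases "A > 0")
          case True
          then obtain z1 z2 where z: "z1 \<in> I" "z1 < 0" "0 < z2" "z2 \<in> I"
            "\<And>t. t \<in> I \<Longrightarrow> sgn (t ^ m * (\<kappa> * h t) - A) = sgn ((t - z1) * (t - z2))"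
            using \<delta>A em by (auto simp: I_def)
          show ?thesis
          proof (cases "odd p")
            case odd: True
            have "extrema_count I (f a) (1, 1)"
              by (rule cnt(3)[OF _ z(1,4)]) (use sD z odd in \<open>simp_all add: sgn_mult \<kappa>\<close>)
            then show ?thesis using True odd ka em by (simp add: unfolding_count_def or')
          next
            case even: False
            have "extrema_count I (f a) (oriented \<kappa> (1, 2))"
              by (rule cnt(4)[OF _ z(1) I(2) z(4,2,3)]) (use sD z even in \<open>simp_all add: sgn_mult \<kappa>\<close>)
            then show ?thesis using True even ka em by (simp add: unfolding_count_def or)
          qed
        next
          case False
          then have z: "sgn (t ^ m * (\<kappa> * h t) - A) = 1" if "t \<in> I" "t \<notin> {0}" for t
            using \<delta>A em that by auto
          show ?thesis
          proof (cases "odd p")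
            case odd: True
            have "extrema_count I (f a) (0, 0)"
              by (rule cnt(1)) (use sD z odd in \<open>simp_all add: \<kappa>\<close>)
            then show ?thesis using False odd ka em by (simp add: unfolding_count_def or')
          next
            case even: False
            have "extrema_count I (f a) (oriented \<kappa> (0, 1))"
              by (rule cnt(2)[OF _ I(2)]) (use sD z even in \<open>simp_all add: sgn_mult \<kappa>\<close>)
            then show ?thesis using False even ka em by (simp add: unfolding_count_def or)
          qed
        qed
      qed
    qed
    then show ?case using \<delta>(1) p unfolding I_def by (intro exI[of _ "\<delta> / p"]) auto
  qed
qed

lemma unfolding_count_sgn: "unfolding_count p m s = unfolding_count p m (sgn s)"
  by (simp add: unfolding_count_def sgn_0_0 sgn_if)

lemma odd_power_times_positive_increasing:
  assumes h: "real_analytic_at h 0" "h 0 > 0" "odd m"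
  shows "\<exists>\<epsilon>>0. \<forall>s t. -\<epsilon> < s \<and> s < t \<and> t < \<epsilon> \<longrightarrow> s ^ m * h s < t ^ m * h t"
proof -
  have m: "m \<ge> 1" using odd_pos[OF h(3)] by simp
  have g: "real_analytic_at (\<lambda>t. h (- t)) 0"
    using real_analytic_compose[of "\<lambda>t. - t" 0 h] real_analytic_diff[OF real_analytic_const[of 0] real_analytic_ident, of 0] h by auto
  obtain e1 where e1: "e1 > 0" "\<And>s t. 0 \<le> s \<Longrightarrow> s < t \<Longrightarrow> t < e1 \<Longrightarrow> s ^ m * h s < t ^ m * h t"
    using power_times_positive_increasing[OF h(1,2) m] by auto
  obtain e2 where e2: "e2 > 0" "\<And>s t. 0 \<le> s \<Longrightarrow> s < t \<Longrightarrow> t < e2 \<Longrightarrow> s ^ m * h (- s) < t ^ m * h (- t)"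
    using power_times_positive_increasing[OF g _ m] h(2) by auto
  have pos: "s ^ m * h s < t ^ m * h t" if "0 \<le> s" "s < t" "t < e1" for s t using e1(2) that .
  have neg: "s ^ m * h s < t ^ m * h t" if "t \<le> 0" "s < t" "- e2 < s" for s t
    using e2(2)[of "- t" "- s"] that h(3) by simp
  have "s ^ m * h s < t ^ m * h t" if "- min e1 e2 < s" "s < t" "t < min e1 e2" for s t
  proof -
    consider "0 \<le> s" | "t \<le> 0" | "s < 0" "0 < t" by linarith
    then show ?thesis
    proof cases
      case 3
      then have "s ^ m * h s < 0 ^ m * h 0" "0 ^ m * h 0 < t ^ m * h t" using neg[of 0 s] pos[of 0 t] that by auto
      then show ?thesis by linarith
    qed (use pos neg that in auto)
  qed
  then show ?thesis using e1(1) e2(1) by (intro exI[of _ "min e1 e2"]) auto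
qed

section \<open>Singular branches\<close>

text \<open>In each of these parity cases both the maxima and the minima increase by one between
  \<open>s = 0\<close> and \<open>s > 0\<close>, so the orientation does not matter.\<close>

lemma oriented_fst_mono: "fst (oriented k (unfolding_count p m 0)) < fst (oriented k (unfolding_count p m s))"
  if "s > 0" "even p \<or> even m"
  using that by (auto simp: oriented_def unfolding_count_def)

locale singular_branch =
  fixes x e1 e2 :: "real \<times> real" and p q :: nat and c :: real and y w :: "real \<Rightarrow> real"
    and \<gamma> :: "real \<Rightarrow> real \<times> real"
  assumes orth: "norm e1 = 1" "norm e2 = 1" "e1 \<bullet> e2 = 0" and pq: "p < q" "2 \<le> p" and c: "0 < c"
    and y: "real_analytic_at y 0" and w: "real_analytic_at w 0" "w 0 = c" "\<forall>\<^sub>F t in nhds 0. y t = t ^ q * w t"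
    and \<gamma>: "\<gamma> = (\<lambda>t. x + t ^ p *\<^sub>R e1 + y t *\<^sub>R e2)"
begin

definition pt :: "real \<Rightarrow> real \<Rightarrow> real \<times> real"
  where "pt a b = x + a *\<^sub>R e1 + b *\<^sub>R e2"

lemma norm_combination: "(norm (a *\<^sub>R e1 + b *\<^sub>R e2))\<^sup>2 = a\<^sup>2 + b\<^sup>2"
proof -
  have "e1 \<bullet> e1 = 1" "e2 \<bullet> e2 = 1" "e2 \<bullet> e1 = 0"
    using orth by (auto simp: dot_square_norm inner_commute)
  then show ?thesis
    unfolding power2_norm_eq_inner using orth(3) by (simp add: inner_add_left inner_add_right power2_eq_square)
qed

lemma sqdist_pt: "sqdist (pt a b) (\<gamma> t) = (t ^ p - a)\<^sup>2 + (y t - b)\<^sup>2"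
proof -
  have "\<gamma> t - pt a b = (t ^ p - a) *\<^sub>R e1 + (y t - b) *\<^sub>R e2"
    by (simp add: \<gamma> pt_def algebra_simps)
  then show ?thesis by (simp add: sqdist_def dist_norm norm_combination)
qed

lemma orthonormal_coordinates: "v = (v \<bullet> e1) *\<^sub>R e1 + (v \<bullet> e2) *\<^sub>R e2"
proof -
  define a1 a2 b1 b2 where "a1 = fst e1" and "a2 = snd e1" and "b1 = fst e2" and "b2 = snd e2"
  have e: "a1 * a1 + a2 * a2 = 1" "b1 * b1 + b2 * b2 = 1" "a1 * b1 + a2 * b2 = 0"
    using orth by (auto simp: norm_eq_1 inner_prod_def a1_def a2_def b1_def b2_def)
  \<comment> \<open>The determinant has square 1 and expresses \<open>e2\<close> as plus or minus
    the rotation of \<open>e1\<close>; orthonormality of the columns of the frame follows.\<close>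
  have "(a1 * b2 - a2 * b1) * (a1 * b2 - a2 * b1) = 1" using e by algebra
  moreover have "b1 = - a2 * (a1 * b2 - a2 * b1)" "b2 = a1 * (a1 * b2 - a2 * b1)" using e by algebra+
  ultimately have "a1 * a1 + b1 * b1 = 1" "a1 * a2 + b1 * b2 = 0" "a2 * a2 + b2 * b2 = 1"
    using e by algebra+
  then have "(s * a1 + t * a2) * a1 + (s * b1 + t * b2) * b1 = s" "(s * a1 + t * a2) * a2 + (s * b1 + t * b2) * b2 = t" for s t
    by algebra+
  then show ?thesis by (simp add: prod_eq_iff inner_prod_def a1_def a2_def b1_def b2_def)
qed

lemma pt_coordinates: "v = pt ((v - x) \<bullet> e1) ((v - x) \<bullet> e2)"
  using orthonormal_coordinates[of "v - x"] by (simp add: pt_def algebra_simps)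

lemma pt_inner: "(pt a b - x) \<bullet> e1 = a" "(pt a b - x) \<bullet> e2 = b"
  using orth by (simp_all add: pt_def inner_add_left inner_add_right inner_commute norm_eq_1)

lemma pt_eq_iff [simp]: "pt a b = pt a' b' \<longleftrightarrow> a = a' \<and> b = b'"
  using pt_inner by metis

lemma normal_line_eq: "normal_line x e1 = range (pt 0)"
proof (intro set_eqI iffI)
  fix v assume "v \<in> normal_line x e1"
  then have "(v - x) \<bullet> e1 = 0" by (simp add: normal_line_def)
  then show "v \<in> range (pt 0)" using pt_coordinates[of v] by (metis rangeI)
qed (auto simp: normal_line_def pt_inner)

lemma continuous_pt: "isCont (\<lambda>a. pt a b) a0" "isCont (\<lambda>b. pt a b) b0"
  unfolding pt_def by (intro continuous_intros)+

lemma y_0: "y 0 = 0"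
  using eventually_nhds_x_imp_x[OF w(3)] pq by simp

definition Y :: "real \<Rightarrow> real"
  where "Y = (SOME Y. real_analytic_at Y 0 \<and> Y 0 = q * c \<and> (\<forall>\<^sub>F t in nhds 0. (y has_real_derivative t ^ (q - 1) * Y t) (at t)))"

lemma Y: "real_analytic_at Y 0" "Y 0 = q * c" "\<forall>\<^sub>F t in nhds 0. (y has_real_derivative t ^ (q - 1) * Y t) (at t)"
proof -
  obtain w' where w': "real_analytic_at w' 0" "\<forall>\<^sub>F t in nhds 0. (w has_real_derivative w' t) (at t)"
    using real_analytic_deriv[OF w(1)] by blast
  have "\<forall>\<^sub>F t in nhds 0. (y has_real_derivative t ^ (q - 1) * (q * w t + t * w' t)) (at t)"
    using w'(2) iffD2[OF eventually_eventually w(3)]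
  proof eventually_elim
    case (elim t)
    have "t ^ q = t ^ (q - 1) * t" using pq by (metis power_minus_mult gr_implies_not0 neq0_conv)
    then have "((\<lambda>t. t ^ q * w t) has_real_derivative t ^ (q - 1) * (q * w t + t * w' t)) (at t)"
      using elim(1) by (auto intro!: derivative_eq_intros simp: algebra_simps)
    then show ?case
      by (subst DERIV_cong_ev[OF refl _ refl, where g="\<lambda>t. t ^ q * w t"]) (use elim(2) in auto)
  qed
  moreover have "real_analytic_at (\<lambda>t. q * w t + t * w' t) 0" by (intro real_analytic_add real_analytic_mult real_analytic_const real_analytic_ident w w')
  ultimately have "\<exists>Y. real_analytic_at Y 0 \<and> Y 0 = q * c \<and> (\<forall>\<^sub>F t in nhds 0. (y has_real_derivative t ^ (q - 1) * Y t) (at t))"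
    using w(2) by (intro exI[of _ "\<lambda>t. q * w t + t * w' t"]) auto
  from someI_ex[OF this] show "real_analytic_at Y 0" "Y 0 = q * c"
    "\<forall>\<^sub>F t in nhds 0. (y has_real_derivative t ^ (q - 1) * Y t) (at t)" by (auto simp: Y_def)
qed

text \<open>What remains of the derivative of the squared distance once
  \<open>2 * t ^ (p - 1)\<close> is taken out and \<open>a\<close> is split off. The coordinate
  \<open>a\<close> enters only as the level \<open>p * a\<close>, so one function \<open>G b\<close>
  governs a whole transversal to the normal line.\<close>

definition G :: "real \<Rightarrow> real \<Rightarrow> real"
  where "G b t = real p * t ^ p + t ^ (q - p) * (Y t * (y t - b))"

lemma real_analytic_G: "real_analytic_at (G b) 0"
  unfolding G_def[abs_def] by (intro real_analytic_add real_analytic_mult real_analytic_diff real_analytic_power real_analytic_const real_analytic_ident Y y)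

lemma G_0: "G b 0 = 0" using pq by (simp add: G_def power_0_left)

lemma sqdist_deriv_uniform:
  "\<forall>\<^sub>F t in nhds 0. \<forall>a b. ((\<lambda>t. sqdist (pt a b) (\<gamma> t)) has_real_derivative 2 * t ^ (p - 1) * (G b t - real p * a)) (at t)"
  using Y(3)
proof eventually_elim
  case (elim t)
  have "t ^ (q - 1) = t ^ (p - 1) * t ^ (q - p)" using pq by (simp flip: power_add)
  then show ?case unfolding sqdist_pt
    using elim by (auto intro!: derivative_eq_intros simp: G_def algebra_simps)
qed

lemma sqdist_deriv:
  "\<forall>\<^sub>F t in nhds 0. \<forall>a::real. ((\<lambda>t. sqdist (pt a b) (\<gamma> t)) has_real_derivative 2 * t ^ (p - 1) * (G b t - real p * a)) (at t)"
  using sqdist_deriv_uniform by eventually_elim blast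

text \<open>The leading coefficient of \<open>G b\<close> from the competition of
  \<open>p * t ^ p\<close> with \<open>- b * (q * c) * t ^ (q - p)\<close>, to be read with the
  exponent \<open>M\<close>. It vanishes at \<open>b = 0\<close> for \<open>q < 2 * p\<close>, at
  \<open>b = 1 / (2 * c)\<close> for \<open>q = 2 * p\<close>, and never for
  \<open>q > 2 * p\<close>: exactly at the focal points.\<close>

definition K :: "real \<Rightarrow> real"
  where "K b = (if q < 2 * p then - (b * (real q * c)) else if q = 2 * p then real p - b * (real q * c) else real p)"

definition M :: nat
  where "M = (if q < 2 * p then q - p else p)"

lemma leading_G: assumes "K b \<noteq> 0" shows "leading (G b) M (K b)"
proof -
  define h where "h = (\<lambda>t. if q < 2 * p then real p * t ^ (2 * p - q) + Y t * (y t - b) else real p + t ^ (q - 2 * p) * (Y t * (y t - b)))"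
  have "real_analytic_at h 0" unfolding h_def
    by (cases "q < 2 * p"; simp; intro real_analytic_add real_analytic_mult real_analytic_diff real_analytic_power real_analytic_const real_analytic_ident Y y)
  moreover have "h 0 = K b" using pq by (simp add: h_def K_def Y(2) y_0 power_0_left)
  moreover have "G b t = t ^ M * h t" for t
  proof (cases "q < 2 * p")
    case True
    then have "t ^ p = t ^ (q - p) * t ^ (2 * p - q)" using pq by (simp flip: power_add)
    then show ?thesis using True by (simp add: G_def h_def M_def algebra_simps)
  next
    case False
    then have "t ^ (q - p) = t ^ p * t ^ (q - 2 * p)" using pq by (simp flip: power_add)
    then show ?thesis using False by (simp add: G_def h_def M_def algebra_simps)
  qed
  moreover have "M \<ge> 1" unfolding M_def using pq by auto
  ultimately show ?thesis using assms unfolding leading_def by (intro conjI exI[of _ h]) auto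
qed

text \<open>At \<open>b = 0\<close> the competing term \<open>t ^ (q - p) * (Y t * y t)\<close> has
  order at least \<open>2 * q - p > p\<close>, so \<open>p * t ^ p\<close> leads whatever the ratio
  of \<open>q\<close> to \<open>p\<close>.\<close>

lemma leading_G_vertex: "leading (G 0) p p"
proof -
  define h where "h = (\<lambda>t. real p + t ^ (2 * q - 2 * p) * (Y t * w t))"
  have "real_analytic_at h 0" unfolding h_def by (intro real_analytic_add real_analytic_mult real_analytic_power real_analytic_const real_analytic_ident Y w)
  moreover have "h 0 = p" using pq by (simp add: h_def)
  moreover have "\<forall>\<^sub>F t in nhds 0. G 0 t = t ^ p * h t"
    using w(3)
  proof eventually_elim
    case (elim t)
    have "(q - p) + q = p + (2 * q - 2 * p)" using pq by linarith
    then have "t ^ (q - p) * t ^ q = t ^ p * t ^ (2 * q - 2 * p)" by (simp only: flip: power_add)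
    then show ?case using elim by (simp add: G_def h_def algebra_simps)
  qed
  ultimately show ?thesis using pq unfolding leading_def by (intro conjI exI[of _ h]) auto
qed

lemma constant_sqdist:
  assumes "\<forall>\<^sub>F t in nhds 0. G b t = 0"
  shows "\<forall>\<^sub>F t in nhds 0. sqdist (pt 0 b) (\<gamma> t) = sqdist (pt 0 b) (\<gamma> 0)"
proof -
  have "\<forall>\<^sub>F t in nhds 0. ((\<lambda>t. sqdist (pt 0 b) (\<gamma> t)) has_real_derivative 0) (at t)"
    using assms sqdist_deriv[of b]
  proof eventually_elim
    case (elim t)
    then show ?case by (metis diff_zero mult_zero_right)
  qed
  then obtain d where d: "d > 0" "\<And>t. \<bar>t\<bar> < d \<Longrightarrow> ((\<lambda>t. sqdist (pt 0 b) (\<gamma> t)) has_real_derivative 0) (at t)"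
    by (auto simp: eventually_nhds_metric dist_real_def)
  have const: "sqdist (pt 0 b) (\<gamma> t) = sqdist (pt 0 b) (\<gamma> 0)" if "\<bar>t\<bar> < d" for t
    using DERIV_isconst3[of "-d" d t 0 "\<lambda>t. sqdist (pt 0 b) (\<gamma> t)"] d that by (auto simp: abs_less_iff minus_less_iff)
  show ?thesis unfolding eventually_nhds_metric
    by (intro exI[of _ d] conjI allI impI const) (use d(1) in \<open>auto simp: dist_real_def\<close>)
qed

lemma sqdist_not_constant:
  assumes "leading (G b) m k"
  shows "\<not> (\<forall>\<^sub>F t in nhds 0. sqdist (pt 0 b) (\<gamma> t) = sqdist (pt 0 b) (\<gamma> 0))"
proof
  assume "\<forall>\<^sub>F t in nhds 0. sqdist (pt 0 b) (\<gamma> t) = sqdist (pt 0 b) (\<gamma> 0)"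
  then have "\<forall>\<^sub>F t in nhds 0. \<forall>\<^sub>F s in nhds t. sqdist (pt 0 b) (\<gamma> s) = sqdist (pt 0 b) (\<gamma> 0)"
    by (simp add: eventually_eventually)
  then have z: "\<forall>\<^sub>F t in nhds 0. t ^ (p - 1) * G b t = 0"
    using sqdist_deriv[of b]
  proof eventually_elim
    case (elim t)
    have "((\<lambda>t. sqdist (pt 0 b) (\<gamma> t)) has_real_derivative 2 * t ^ (p - 1) * (G b t - real p * 0)) (at t)"
      using elim(2) by blast
    moreover have "((\<lambda>t. sqdist (pt 0 b) (\<gamma> t)) has_real_derivative 0) (at t)"
      by (subst DERIV_cong_ev[OF refl elim(1) refl]) simp
    ultimately have "2 * t ^ (p - 1) * (G b t - real p * 0) = 0" by (rule DERIV_unique)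
    then show ?case by simp
  qed
  obtain h where h: "real_analytic_at h 0" "h 0 = k" "\<forall>\<^sub>F t in nhds 0. G b t = t ^ m * h t" "k \<noteq> 0"
    using assms by (auto simp: leading_def)
  have "\<forall>\<^sub>F t in nhds 0. h t \<noteq> 0"
    using real_analytic_tendsto[OF h(1)] h(2,4) by (auto intro: tendsto_imp_eventually_ne)
  with z h(3) have "\<forall>\<^sub>F t in nhds (0::real). t = 0"
    by eventually_elim auto
  then have "\<forall>\<^sub>F t in at (0::real). False" by (simp add: eventually_at_filter)
  then show False by simp
qed

text \<open>If \<open>G\<close> vanishes identically, the branch lies on a circle centred on the normal line, so for even \<open>p\<close>
  the points with parameters \<open>t\<close> and \<open>-t\<close> coincide.\<close>

lemma leading_exists:
  assumes "even p" "injective_near_0 \<gamma>"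
  shows "\<exists>m k. leading (G b) m k"
proof -
  have "\<not> (\<forall>\<^sub>F t in nhds 0. G b t = 0)"
  proof
    assume "\<forall>\<^sub>F t in nhds 0. G b t = 0"
    then have "\<forall>\<^sub>F t in nhds 0. (t ^ p)\<^sup>2 + (y t - b)\<^sup>2 = b\<^sup>2"
      using constant_sqdist[of b] pq by (simp add: sqdist_pt y_0 power_0_left)
    moreover have "\<forall>\<^sub>F t in nhds 0. b \<noteq> 0 \<longrightarrow> \<bar>y t\<bar> < \<bar>b\<bar>"
    proof (cases "b = 0")
      case False
      have "filterlim (\<lambda>t. \<bar>y t\<bar>) (nhds 0) (nhds 0)"
        using tendsto_rabs[OF real_analytic_tendsto[OF y]] by (simp add: y_0)
      from order_tendstoD(2)[OF this, of "\<bar>b\<bar>"] False show ?thesis by (auto elim: eventually_mono)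
    qed simp
    ultimately have "\<forall>\<^sub>F t in nhds 0. (t ^ p)\<^sup>2 + (y t - b)\<^sup>2 = b\<^sup>2 \<and> (b \<noteq> 0 \<longrightarrow> \<bar>y t\<bar> < \<bar>b\<bar>)" by (rule eventually_conj)
    then obtain d where d: "d > 0" "\<And>t. \<bar>t\<bar> < d \<Longrightarrow> (t ^ p)\<^sup>2 + (y t - b)\<^sup>2 = b\<^sup>2 \<and> (b \<noteq> 0 \<longrightarrow> \<bar>y t\<bar> < \<bar>b\<bar>)"
      by (auto simp: eventually_nhds_metric dist_real_def)
    obtain r where r: "r > 0" "inj_on \<gamma> {-r<..<r}" using assms(2) by (auto simp: injective_near_0_def)
    define t where "t = min d r / 2"
    have t: "0 < t" "t < d" "t < r" using d(1) r(1) by (auto simp: t_def)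
    have s: "(t ^ p)\<^sup>2 + (y t - b)\<^sup>2 = b\<^sup>2" "(t ^ p)\<^sup>2 + (y (- t) - b)\<^sup>2 = b\<^sup>2"
      "b \<noteq> 0 \<Longrightarrow> \<bar>y t\<bar> < \<bar>b\<bar>" "b \<noteq> 0 \<Longrightarrow> \<bar>y (- t)\<bar> < \<bar>b\<bar>"
      using d(2)[of t] d(2)[of "- t"] t assms(1) by auto
    have "b \<noteq> 0"
    proof
      assume "b = 0"
      then have "t ^ p = 0" using s(1) by (simp add: sum_power2_eq_zero_iff)
      with t show False by simp
    qed
    \<comment> \<open>Both ordinates are smaller than \<open>\<bar>b\<bar>\<close> in absolute
      value, so the two points lie on the same arc of the circle, where the abscissa determines the
      ordinate.\<close>
    then have "y t + y (- t) - 2 * b \<noteq> 0" using s(3,4) by linarith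
    moreover have "(y t - y (- t)) * (y t + y (- t) - 2 * b) = 0"
      using s(1,2) by (simp add: power2_eq_square algebra_simps)
    ultimately have "y t = y (- t)" by simp
    then have "\<gamma> t = \<gamma> (- t)" using assms(1) by (simp add: \<gamma>)
    then have "t = - t" by (rule inj_onD[OF r(2)]) (use t in auto)
    with t show False by simp
  qed
  with real_analytic_G obtain h m where h: "real_analytic_at h 0" "h 0 \<noteq> 0" "\<forall>\<^sub>F t in nhds 0. G b t = t ^ m * h t"
    by (rule real_analytic_factor)
  have "m \<ge> 1" using eventually_nhds_x_imp_x[OF h(3)] h(2) G_0 by (cases m) auto
  then show ?thesis using h unfolding leading_def by blast
qed

section \<open>Extrema for centres near and across the normal line\<close>

lemma unfolding_extrema:
  assumes "leading (G b) m k"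
  shows "\<forall>\<^sub>F \<epsilon> in at_right 0. \<exists>\<delta>>0. \<forall>a. \<bar>a\<bar> < \<delta> \<longrightarrow>
    has_extrema \<gamma> \<epsilon> (pt a b) (oriented k (unfolding_count p m (k * a)))"
  unfolding has_extrema_eq using leading_unfolding_count[OF assms _ sqdist_deriv] pq by simp

lemma small_parameter:
  assumes "open U" "pt 0 b \<in> U" "0 < \<delta>" "k \<noteq> 0"
  shows "\<exists>a. \<bar>a\<bar> < \<delta> \<and> 0 < k * a \<and> pt a b \<in> U"
proof -
  have "\<forall>\<^sub>F a in nhds 0. pt a b \<in> U"
    using topological_tendstoD[OF isCont_imp_tendsto_nhds[OF continuous_pt(1) refl] assms(1,2)] .
  then obtain d where d: "d > 0" "\<And>a. \<bar>a\<bar> < d \<Longrightarrow> pt a b \<in> U" by (auto simp: eventually_nhds_metric dist_real_def)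
  define a where "a = sgn k * (min d \<delta> / 2)"
  have "\<bar>a\<bar> = min d \<delta> / 2" using assms(3,4) d(1) by (simp add: a_def abs_mult)
  moreover have "k * a = \<bar>k\<bar> * (min d \<delta> / 2)" by (simp add: a_def abs_sgn mult.assoc)
  moreover have "\<bar>k\<bar> * (min d \<delta> / 2) > 0" using assms(3,4) d(1) by simp
  moreover have "min d \<delta> / 2 < d" "min d \<delta> / 2 < \<delta>" using assms(3) d(1) by auto
  ultimately show ?thesis using d(2)[of a] by (intro exI[of _ a]) auto
qed

lemma gains_maxima_leading:
  assumes lead: "leading (G b) m k" and "even p \<or> even m"
  shows "gains_maxima \<gamma> 1 (pt 0 b)"
  unfolding gains_maxima_def
  using unfolding_extrema[OF lead]
proof eventually_elim
  case (elim r)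
  then obtain \<delta> where \<delta>: "\<delta> > 0" "\<And>a. \<bar>a\<bar> < \<delta> \<Longrightarrow>
    has_extrema \<gamma> r (pt a b) (oriented k (unfolding_count p m (k * a)))" by blast
  have k: "k \<noteq> 0" using lead by (simp add: leading_def)
  have cnt: "finite (branch_maxima \<gamma> 1 r (pt a b))"
    "card (branch_maxima \<gamma> 1 r (pt a b)) = fst (oriented k (unfolding_count p m (k * a)))" if "\<bar>a\<bar> < \<delta>" for a
    using \<delta>(2)[OF that] by (auto simp: has_extrema_eq extrema_count_def branch_maxima_def)
  show ?case
  proof (intro conjI allI impI)
    show "finite (branch_maxima \<gamma> 1 r (pt 0 b))" using cnt[of 0] \<delta>(1) by simp
    fix U assume "open U \<and> pt 0 b \<in> U"
    then obtain a where a: "\<bar>a\<bar> < \<delta>" "0 < k * a" "pt a b \<in> U" using small_parameter[OF _ _ \<delta>(1) k] by blast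
    have "card (branch_maxima \<gamma> 1 r (pt 0 b)) < card (branch_maxima \<gamma> 1 r (pt a b))"
      using oriented_fst_mono[OF a(2) assms(2), of k] cnt(2)[of 0] cnt(2)[OF a(1)] \<delta>(1) by simp
    then show "\<exists>v\<in>U. \<exists>S\<subseteq>branch_maxima \<gamma> 1 r v. finite S \<and> card (branch_maxima \<gamma> 1 r (pt 0 b)) < card S"
      using a(3) cnt(1)[OF a(1)] by blast
  qed
qed

text \<open>At \<open>x\<close> the leading exponent is \<open>p\<close>, odd, so there is a single
  minimum and moving \<open>a\<close> cannot help. For any small \<open>b \<noteq> 0\<close> the
  leading exponent is \<open>q - p\<close>, which is even, and a suitable \<open>a\<close> then
  produces a maximum.\<close>

lemma gains_maxima_vertex:
  assumes "odd p" "odd q" "q < 2 * p"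
  shows "gains_maxima \<gamma> 1 (pt 0 0)"
  unfolding gains_maxima_def
  using unfolding_extrema[OF leading_G_vertex] eventually_at_right_pos_less[OF zero_less_one]
proof eventually_elim
  case (elim r)
  from elim(1) obtain \<delta> where \<delta>: "\<delta> > 0" "\<And>a. \<bar>a\<bar> < \<delta> \<Longrightarrow>
    has_extrema \<gamma> r (pt a 0) (oriented (real p) (unfolding_count p p (real p * a)))" by blast
  have "has_extrema \<gamma> r (pt 0 0) (0, 1)"
    using \<delta>(2)[of 0] \<delta>(1) assms(1) pq by (simp add: oriented_def unfolding_count_def)
  then have cnt: "finite (branch_maxima \<gamma> 1 r (pt 0 0))" "card (branch_maxima \<gamma> 1 r (pt 0 0)) = 0"
    by (auto simp: has_extrema_eq extrema_count_def branch_maxima_def)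
  have r0: "0 < r" using elim(2) by simp
  show ?case
  proof (intro conjI allI impI)
    show "finite (branch_maxima \<gamma> 1 r (pt 0 0))" by (rule cnt)
    fix U assume U: "open U \<and> pt 0 0 \<in> U"
    have "\<forall>\<^sub>F b in nhds 0. pt 0 b \<in> U"
      using topological_tendstoD[OF isCont_imp_tendsto_nhds[OF continuous_pt(2) refl]] U by blast
    then obtain d where d: "d > 0" "\<And>b. \<bar>b\<bar> < d \<Longrightarrow> pt 0 b \<in> U" by (auto simp: eventually_nhds_metric dist_real_def)
    define b where "b = d / 2"
    have b: "b \<noteq> 0" "pt 0 b \<in> U" using d by (auto simp: b_def)
    have K: "K b \<noteq> 0" using b(1) assms(3) c pq by (simp add: K_def)
    have M: "even M" using assms pq by (simp add: M_def)
    \<comment> \<open>The admissible intervals depend on \<open>b\<close>, which is chosen after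
      \<open>r\<close>; hence a smaller radius is used for the new maximum.\<close>
    obtain r' where r': "0 < r'" "r' < r" and ex: "\<exists>\<delta>>0. \<forall>a. \<bar>a\<bar> < \<delta> \<longrightarrow>
        has_extrema \<gamma> r' (pt a b) (oriented (K b) (unfolding_count p M (K b * a)))"
      using eventually_happens'[OF trivial_limit_at_right_real
        eventually_conj[OF unfolding_extrema[OF leading_G[OF K]] eventually_at_right_pos_less[OF r0]]] by blast
    then obtain \<delta>' where \<delta>': "\<delta>' > 0" "\<And>a. \<bar>a\<bar> < \<delta>' \<Longrightarrow>
        has_extrema \<gamma> r' (pt a b) (oriented (K b) (unfolding_count p M (K b * a)))" by blast
    obtain a where a: "\<bar>a\<bar> < \<delta>'" "0 < K b * a" "pt a b \<in> U"
      using small_parameter[OF _ b(2) \<delta>'(1) K] U by blast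
    have "has_extrema \<gamma> r' (pt a b) (1, 1)"
      using \<delta>'(2)[OF a(1)] a(2) assms(1) M by (cases "K b > 0") (simp_all add: unfolding_count_def oriented_def)
    then have "branch_maxima \<gamma> 1 r' (pt a b) \<noteq> {}"
      by (auto simp: has_extrema_eq extrema_count_def branch_maxima_def)
    then obtain s where "s \<in> branch_maxima \<gamma> 1 r' (pt a b)" by blast
    \<comment> \<open>Being a local maximum does not depend on the surrounding open
      interval.\<close>
    then have "s \<in> branch_maxima \<gamma> 1 r (pt a b)"
      using r' by (auto simp: branch_maxima_def local_maxima_open_iff)
    then show "\<exists>v\<in>U. \<exists>S\<subseteq>branch_maxima \<gamma> 1 r v. finite S \<and> card (branch_maxima \<gamma> 1 r (pt 0 0)) < card S"
      using a(3) cnt(2) by (intro bexI[of _ "pt a b"] exI[of _ "{s}"]) auto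
  qed
qed

text \<open>For even \<open>p\<close> any leading exponent will do, so the focal point needs no
  special care; for odd \<open>p\<close> it is the vertex \<open>b = 0\<close>.\<close>

theorem normal_line_gains_maxima:
  assumes "(odd p \<and> odd q \<and> q < 2 * p) \<or> even p" "injective_near_0 \<gamma>"
  shows "gains_maxima \<gamma> 1 (pt 0 b) \<and>
    \<not> (\<forall>\<^sub>F t in nhds 0. sqdist (pt 0 b) (\<gamma> t) = sqdist (pt 0 b) (\<gamma> 0))"
proof (cases "even p")
  case True
  then obtain m k where "leading (G b) m k" using leading_exists assms(2) by blast
  then show ?thesis using True gains_maxima_leading sqdist_not_constant by blast
next
  case False
  then have pq': "odd p" "odd q" "q < 2 * p" using assms by auto
  show ?thesis
  proof (cases "b = 0")
    case True
    then show ?thesis using gains_maxima_vertex[OF pq'] sqdist_not_constant[OF leading_G_vertex] by simp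
  next
    case False
    have K: "K b \<noteq> 0" using False pq' c pq by (simp add: K_def)
    have "even M" using pq' pq by (simp add: M_def)
    then show ?thesis using gains_maxima_leading[OF leading_G[OF K]] sqdist_not_constant[OF leading_G[OF K]] by blast
  qed
qed

lemma crossing_changes:
  assumes "leading (G b) m k"
  shows "changes \<gamma> (\<lambda>a. pt a b) (oriented k (unfolding_count p m (- 1))) (oriented k (unfolding_count p m 1))"
proof -
  have k: "k \<noteq> 0" using assms by (simp add: leading_def)
  have "passes \<gamma> (\<lambda>a. pt a b) (oriented k (unfolding_count p m (- sgn k))) (oriented k (unfolding_count p m (sgn k)))"
    unfolding passes_def using unfolding_extrema[OF assms]
  proof eventually_elim
    case (elim \<epsilon>)
    then obtain \<delta> where \<delta>: "\<delta> > 0" "\<And>a. \<bar>a\<bar> < \<delta> \<Longrightarrow>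
      has_extrema \<gamma> \<epsilon> (pt a b) (oriented k (unfolding_count p m (k * a)))" by blast
    have "\<forall>\<^sub>F a in at_left 0. a \<in> {-\<delta><..<0}" using \<delta>(1) by (intro eventually_at_left_real) simp
    then have "\<forall>\<^sub>F a in at_left 0. has_extrema \<gamma> \<epsilon> (pt a b) (oriented k (unfolding_count p m (- sgn k)))"
    proof eventually_elim
      case (elim a)
      then have "sgn (k * a) = sgn (- sgn k)" by (simp add: sgn_mult sgn_minus)
      then show ?case using \<delta>(2)[of a] elim by (simp add: unfolding_count_sgn[of p m "k * a"] sgn_minus)
    qed
    moreover have "\<forall>\<^sub>F a in at_right 0. has_extrema \<gamma> \<epsilon> (pt a b) (oriented k (unfolding_count p m (sgn k)))"
      using eventually_at_right_pos_less[OF \<delta>(1)]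
    proof eventually_elim
      case (elim a)
      then have "sgn (k * a) = sgn k" by (simp add: sgn_mult)
      then show ?case using \<delta>(2)[of a] elim by (simp add: unfolding_count_sgn[of p m "k * a"])
    qed
    ultimately show ?case ..
  qed
  then show ?thesis unfolding changes_def using k by (cases "k > 0") (auto simp: sgn_if)
qed

lemma crossing_persists:
  assumes "leading (G b) m k" "odd p" "odd m"
  shows "persists \<gamma> (\<lambda>a. pt a b) (oriented k (0, 1))"
  unfolding persists_def using unfolding_extrema[OF assms(1)]
proof eventually_elim
  case (elim \<epsilon>)
  then obtain \<delta> where \<delta>: "\<delta> > 0" "\<And>a. \<bar>a\<bar> < \<delta> \<Longrightarrow>
    has_extrema \<gamma> \<epsilon> (pt a b) (oriented k (unfolding_count p m (k * a)))" by blast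
  have "\<forall>\<^sub>F a in nhds 0. a \<in> {-\<delta><..<\<delta>}" using \<delta>(1) by (intro eventually_nhds_in_open) auto
  then show ?case by eventually_elim (use \<delta>(2) assms(2,3) in \<open>force simp: unfolding_count_def\<close>)
qed

text \<open>\<open>K\<close> is continuous, so the interchange of maxima and minima is decided once
  for each connected set of heights that avoids the zeros of \<open>K\<close>.\<close>

lemma K_constant_sign:
  assumes "connected J" "\<And>b. b \<in> J \<Longrightarrow> K b \<noteq> 0"
  shows "(\<forall>b\<in>J. K b > 0) \<or> (\<forall>b\<in>J. K b < 0)"
proof (rule ccontr)
  assume "\<not> ?thesis"
  then obtain b b' where b: "b \<in> J" "b' \<in> J" "K b < 0" "K b' > 0" using assms(2) by (metis linorder_neqE_linordered_idom)
  have "continuous_on J K" unfolding K_def[abs_def] by (cases "q < 2 * p"; cases "q = 2 * p") (auto intro!: continuous_intros)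
  then have "connected (K ` J)" using assms(1) by (rule connected_continuous_image)
  then have "0 \<in> K ` J" using connectedD_interval[of "K ` J" "K b" "K b'" 0] b by auto
  then show False using assms(2) by auto
qed

lemma increasing_G:
  assumes "K b > 0" "odd M"
  shows "\<exists>\<epsilon>>0. \<forall>s t. -\<epsilon> < s \<and> s < t \<and> t < \<epsilon> \<longrightarrow> G b s < G b t"
proof -
  obtain h where h: "real_analytic_at h 0" "h 0 = K b" "\<forall>\<^sub>F t in nhds 0. G b t = t ^ M * h t"
    using leading_G[of b] assms(1) by (auto simp: leading_def)
  obtain e where e: "e > 0" "\<And>s t. -e < s \<Longrightarrow> s < t \<Longrightarrow> t < e \<Longrightarrow> s ^ M * h s < t ^ M * h t"
    using odd_power_times_positive_increasing[OF h(1) _ assms(2)] h(2) assms(1) by auto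
  obtain d where d: "d > 0" "\<And>t. \<bar>t\<bar> < d \<Longrightarrow> G b t = t ^ M * h t"
    using h(3) by (auto simp: eventually_nhds_metric dist_real_def)
  have "G b s < G b t" if "- min d e < s" "s < t" "t < min d e" for s t
    using e(2)[of s t] d(2)[of s] d(2)[of t] that by auto
  then show ?thesis using d(1) e(1) by (intro exI[of _ "min d e"]) auto
qed

text \<open>\<open>G b\<close> is affine in \<open>b\<close>, so it is increasing on an interval that does not depend on \<open>b \<in> {-2<..<-1/2}\<close>.\<close>

lemma germ_stable_point:
  assumes "odd p" "odd M"
  shows "germ_stable \<gamma> (pt 0 (- 1))"
proof -
  \<comment> \<open>For negative \<open>b\<close> both competing leading terms are positive,
    whatever their order; this is why a point with \<open>b = -1\<close> is taken.\<close>
  have Kpos: "K b > 0" if "b < 0" for b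
  proof -
    define X where "X = b * (real q * c)"
    have "X < 0" using that c pq by (simp add: X_def mult_neg_pos)
    then show ?thesis unfolding K_def X_def[symmetric] using pq by auto
  qed
  obtain d1 where d1: "d1 > 0" "\<And>s t. -d1 < s \<Longrightarrow> s < t \<Longrightarrow> t < d1 \<Longrightarrow> G (-2) s < G (-2) t"
    using increasing_G[OF Kpos[of "-2"] assms(2)] by auto
  obtain d2 where d2: "d2 > 0" "\<And>s t. -d2 < s \<Longrightarrow> s < t \<Longrightarrow> t < d2 \<Longrightarrow> G (-1/2) s < G (-1/2) t"
    using increasing_G[OF Kpos[of "-1/2"] assms(2)] by auto
  have "\<forall>\<^sub>F t in nhds 0. isCont Y t \<and> isCont y t"
    using real_analytic_eventually[OF Y(1)] real_analytic_eventually[OF y] by eventually_elim (simp add: real_analytic_isCont)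
  from eventually_conj[OF this sqdist_deriv_uniform]
  obtain d3 where d3: "d3 > 0" "\<And>t. \<bar>t\<bar> < d3 \<Longrightarrow> (isCont Y t \<and> isCont y t) \<and>
     (\<forall>a b. ((\<lambda>t. sqdist (pt a b) (\<gamma> t)) has_real_derivative 2 * t ^ (p - 1) * (G b t - real p * a)) (at t))"
    by (auto simp: eventually_nhds_metric dist_real_def simp del: One_nat_def)
  define e0 where "e0 = min d1 (min d2 d3)"
  have e0: "e0 > 0" using d1 d2 d3 by (simp add: e0_def)
  have inc: "G b s < G b t" if b: "-2 < b" "b < -1/2" and st: "-e0 < s" "s < t" "t < e0" for b s t
  proof -
    \<comment> \<open>The weight of \<open>-1/2\<close> when \<open>b\<close> is written as a convex
      combination of \<open>-2\<close> and \<open>-1/2\<close>; the factor is the reciprocal of the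
      distance \<open>3/2\<close>.\<close>
    define l where "l = (b + 2) * (2/3)"
    have l: "0 < l" "0 < 1 - l" using b by (auto simp: l_def)
    have bl: "b = -2 + l * (3/2)" by (simp add: l_def)
    have G: "G b r = (1 - l) * G (-2) r + l * G (-1/2) r" for r
      unfolding G_def bl by (simp add: algebra_simps)
    have "G (-2) s < G (-2) t" "G (-1/2) s < G (-1/2) t" using d1(2)[of s t] d2(2)[of s t] st by (auto simp: e0_def)
    then show ?thesis unfolding G using l by (intro add_strict_mono mult_strict_left_mono) auto
  qed
  have contG: "isCont (G b) t" if "\<bar>t\<bar> < e0" for b t
    unfolding G_def[abs_def] using d3(2)[of t] that by (intro continuous_intros) (auto simp: e0_def)
  show ?thesis
    unfolding germ_stable_def using eventually_at_right_pos_less[OF e0]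
  proof eventually_elim
    case (elim \<epsilon>)
    \<comment> \<open>The level \<open>p * a\<close> is required to lie strictly between the values
      of \<open>G b\<close> at \<open>-\<epsilon>/2\<close> and \<open>\<epsilon>/2\<close>. This is
      an open condition on the centre, and it forces exactly one crossing within the
      interval.\<close>
    define U where "U = {v. -2 < (v - x) \<bullet> e2 \<and> (v - x) \<bullet> e2 < -1/2 \<and>
      G ((v - x) \<bullet> e2) (- \<epsilon>/2) < real p * ((v - x) \<bullet> e1) \<and> real p * ((v - x) \<bullet> e1) < G ((v - x) \<bullet> e2) (\<epsilon>/2)}"
    have "open U"
      unfolding U_def G_def by (intro open_Collect_conj open_Collect_less continuous_intros)
    moreover have "pt 0 (- 1) \<in> U"
      using inc[of "-1" "- \<epsilon>/2" 0] inc[of "-1" 0 "\<epsilon>/2"] elim by (simp add: U_def pt_inner G_0)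
    moreover have cnt: "extrema_count {-\<epsilon><..<\<epsilon>} (\<lambda>t. sqdist v (\<gamma> t)) (0, 1)" if v: "v \<in> U" for v
    proof -
      define a b where "a = (v - x) \<bullet> e1" and "b = (v - x) \<bullet> e2"
      have ab: "v = pt a b" unfolding a_def b_def by (rule pt_coordinates)
      have U: "-2 < b" "b < -1/2" "G b (- \<epsilon>/2) < real p * a" "real p * a < G b (\<epsilon>/2)"
        using v by (auto simp: U_def a_def b_def)
      have "\<exists>z. - \<epsilon>/2 \<le> z \<and> z \<le> \<epsilon>/2 \<and> G b z = real p * a"
        by (rule IVT) (use U elim contG in auto)
      then obtain z where z: "- \<epsilon>/2 \<le> z" "z \<le> \<epsilon>/2" "G b z = real p * a" by blast
      have sg: "sgn (G b t - real p * a) = sgn (t - z)" if "t \<in> {-\<epsilon><..<\<epsilon>}" for t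
        using inc[OF U(1,2), of t z] inc[OF U(1,2), of z t] z that elim by (cases t z rule: linorder_cases) auto
      have "extrema_count {-\<epsilon><..<\<epsilon>} (\<lambda>t. sqdist v (\<gamma> t)) (oriented 1 (0, 1))"
      proof (rule extrema_count_by_sign(2)[where E="{0}" and \<tau>=1])
        show "z \<in> {-\<epsilon><..<\<epsilon>}" using z elim by auto
        show "((\<lambda>t. sqdist v (\<gamma> t)) has_real_derivative 2 * t ^ (p - 1) * (G b t - real p * a)) (at t)"
          if "t \<in> {-\<epsilon><..<\<epsilon>}" for t
          unfolding ab using d3(2)[of t] that elim by (auto simp: e0_def)
        show "sgn (2 * t ^ (p - 1) * (G b t - real p * a)) = sgn (1 * (t - z))" if "t \<in> {-\<epsilon><..<\<epsilon>}" "t \<notin> {0}" for t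
        proof -
          have "t ^ (p - 1) > 0" using that(2) assms(1) pq by (simp add: zero_less_power_eq)
          then have "sgn (2 * t ^ (p - 1)) = 1" by simp
          then show ?thesis using sg[OF that(1)] by (simp only: sgn_mult mult_1)
        qed
      qed auto
      then show ?thesis by (simp add: oriented_def)
    qed
    ultimately show ?case
      using elim by (intro exI[of _ U] conjI ballI top_equivalent_if_extrema_count[of \<epsilon> _ "(0, 1)"]) auto
  qed
qed

end

section \<open>Focal points\<close>

lemma contact_order_eqI:
  assumes "1 \<le> n" "(deriv ^^ n) (\<lambda>s. sqdist u (\<gamma> s)) t \<noteq> 0"
    and "\<And>k. 1 \<le> k \<Longrightarrow> k < n \<Longrightarrow> (deriv ^^ k) (\<lambda>s. sqdist u (\<gamma> s)) t = 0"
  shows "contact_order \<gamma> t u = enat n"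
  unfolding contact_order_def
proof (rule antisym)
  show "Inf (enat ` {k. 1 \<le> k \<and> (deriv ^^ k) (\<lambda>s. sqdist u (\<gamma> s)) t \<noteq> 0}) \<le> enat n"
    using assms(1,2) by (intro Inf_lower) auto
  show "enat n \<le> Inf (enat ` {k. 1 \<le> k \<and> (deriv ^^ k) (\<lambda>s. sqdist u (\<gamma> s)) t \<noteq> 0})"
    using assms(3) by (intro Inf_greatest) (force simp: not_less[symmetric])
qed

lemma contact_order_neqI:
  assumes "1 \<le> n" "\<And>k. 1 \<le> k \<Longrightarrow> k \<le> n \<Longrightarrow> (deriv ^^ k) (\<lambda>s. sqdist u (\<gamma> s)) t = 0"
  shows "contact_order \<gamma> t u \<noteq> enat n"
proof -
  have "enat (Suc n) \<le> contact_order \<gamma> t u"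
    unfolding contact_order_def using assms(2) by (intro Inf_greatest) (force simp: not_less_eq_eq[symmetric])
  then show ?thesis by auto
qed

text \<open>The order \<open>n\<close> is attained outside the finite set \<open>B\<close>, hence
  infinitely often. Every other order is attained only on the image of \<open>B\<close>, so finitely
  often.\<close>

lemma focal_points_eqI:
  fixes l :: "real \<Rightarrow> real \<times> real"
  assumes line: "normal_line (\<gamma> t) d = range l" and l: "inj l"
    and gen: "\<And>b. b \<in> - B \<Longrightarrow> contact_order \<gamma> t (l b) = enat n"
    and spec: "\<And>b. b \<in> B \<Longrightarrow> contact_order \<gamma> t (l b) \<noteq> enat n" and "finite B"
  shows "focal_points \<gamma> t d = l ` B"
proof -
  have inf: "infinite {w \<in> range l. contact_order \<gamma> t w = enat n}"
  proof
    assume "finite {w \<in> range l. contact_order \<gamma> t w = enat n}"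
    then have "finite (l ` (- B))" by (rule rev_finite_subset) (use gen in auto)
    then have "finite (- B)" by (rule finite_imageD) (use l in \<open>auto intro: inj_on_subset\<close>)
    then show False using \<open>finite B\<close> by (metis finite_compl infinite_UNIV_char_0)
  qed
  have fin: "finite {w \<in> range l. contact_order \<gamma> t w = contact_order \<gamma> t (l b)}" if "b \<in> B" for b
  proof (rule finite_subset)
    show "{w \<in> range l. contact_order \<gamma> t w = contact_order \<gamma> t (l b)} \<subseteq> l ` B"
      using spec[OF that] gen by force
  qed (use \<open>finite B\<close> in simp)
  show ?thesis
    unfolding focal_points_def line
  proof (intro set_eqI iffI)
    fix w assume w: "w \<in> {u \<in> range l. finite {w \<in> range l. contact_order \<gamma> t w = contact_order \<gamma> t u}}"
    then obtain b where b: "w = l b" by auto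
    have "b \<in> B"
    proof (rule ccontr)
      assume "b \<notin> B"
      then have "contact_order \<gamma> t w = enat n" using gen[of b] b by simp
      then show False using w inf by simp
    qed
    then show "w \<in> l ` B" using b by simp
  next
    fix w assume "w \<in> l ` B"
    then show "w \<in> {u \<in> range l. finite {w \<in> range l. contact_order \<gamma> t w = contact_order \<gamma> t u}}" using fin by auto
  qed
qed

lemma has_fps_expansion_funpow_deriv:
  fixes f :: "real \<Rightarrow> real"
  assumes "f has_fps_expansion F" shows "(deriv ^^ k) f 0 = fact k * fps_nth F k"
  using assms
proof (induction k arbitrary: f F)
  case 0
  then show ?case using has_fps_expansion_imp_0_eq_fps_nth_0 by auto
next
  case (Suc k)
  have "(deriv ^^ Suc k) f 0 = (deriv ^^ k) (deriv f) 0" by (simp add: funpow_swap1)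
  also have "\<dots> = fact k * fps_nth (fps_deriv F) k" by (rule Suc.IH) (rule has_fps_expansion_deriv[OF Suc.prems])
  finally show ?case by (simp add: algebra_simps)
qed

context singular_branch
begin

lemma gamma_0: "\<gamma> 0 = x" using pq by (simp add: \<gamma> y_0 power_0_left)

text \<open>From the expansion of \<open>t ^ (2 * p) - 2 * b * y + y ^ 2 + b ^ 2\<close>:
  \<open>A\<close> holds the coefficients of \<open>y\<close> and \<open>B\<close> those of its
  square, which start at degree \<open>2 * q\<close>.\<close>

lemma sqdist_coefficients:
  "\<exists>A B. (\<forall>k\<ge>1. \<forall>b. (deriv ^^ k) (\<lambda>s. sqdist (pt 0 b) (\<gamma> s)) 0 = fact k * ((if k = 2 * p then 1 else 0) - 2 * b * A k + B k)) \<and>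
    (\<forall>k<q. A k = 0) \<and> A q = c \<and> (\<forall>k<2*q. B k = (0::real))"
proof -
  obtain W where W: "w has_fps_expansion W" using real_analytic_imp_has_fps_expansion[OF w(1)] by auto
  define F where "F = fps_X ^ q * W"
  have "(\<lambda>t. t ^ q * w t) has_fps_expansion F"
    unfolding F_def by (intro has_fps_expansion_mult has_fps_expansion_fps_X_power W)
  then have F: "y has_fps_expansion F"
    using w(3) by (subst has_fps_expansion_cong[OF _ refl]) auto
  have W0: "fps_nth W 0 = c" using has_fps_expansion_imp_0_eq_fps_nth_0[OF W] w(2) by simp
  have "(deriv ^^ k) (\<lambda>s. sqdist (pt 0 b) (\<gamma> s)) 0 = fact k * ((if k = 2 * p then 1 else 0) - 2 * b * fps_nth F k + fps_nth (F * F) k)"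
    if k: "k \<ge> 1" for k b
  proof -
    have "(\<lambda>s. s ^ (2 * p) + (y s * y s + (- 2 * b) * y s) + b\<^sup>2) has_fps_expansion
      fps_X ^ (2 * p) + (F * F + fps_const (- 2 * b) * F) + fps_const (b\<^sup>2)"
      by (intro has_fps_expansion_add has_fps_expansion_mult has_fps_expansion_fps_X_power has_fps_expansion_const F)
    moreover have sq: "s ^ (2 * p) = s ^ p * s ^ p" for s :: real by (simp add: mult_2 power_add)
    have "(\<lambda>s. sqdist (pt 0 b) (\<gamma> s)) = (\<lambda>s. s ^ (2 * p) + (y s * y s + (- 2 * b) * y s) + b\<^sup>2)"
      by (rule ext, simp only: sqdist_pt sq power2_eq_square) (simp add: algebra_simps)
    ultimately show ?thesis
      using k has_fps_expansion_funpow_deriv by (simp add: fps_X_power_nth algebra_simps)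
  qed
  moreover have "fps_nth F k = 0" if "k < q" for k using that by (simp add: F_def fps_X_power_mult_nth)
  moreover have "fps_nth F q = c" by (simp add: F_def fps_X_power_mult_nth W0)
  moreover have "fps_nth (F * F) k = 0" if "k < 2 * q" for k
  proof -
    have "fps_X ^ (2 * q) = fps_X ^ q * (fps_X ^ q :: real fps)" by (simp only: mult_2 power_add)
    then have "F * F = fps_X ^ (2 * q) * (W * W)" by (simp only: F_def mult_ac)
    then show ?thesis using that by (simp add: fps_X_power_mult_nth)
  qed
  ultimately show ?thesis by (intro exI[of _ "fps_nth F"] exI[of _ "fps_nth (F * F)"]) auto
qed

text \<open>The orders \<open>2 * p\<close> and \<open>q\<close> compete, and the square of
  \<open>y\<close> is too small to interfere. The generic contact order is the smaller of the two;
  its coefficient \<open>- 2 * b * c\<close>, \<open>1 - 2 * b * c\<close> or \<open>1\<close> shows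
  which \<open>b\<close> is exceptional.\<close>

lemma focal_points_0:
  "focal_points \<gamma> 0 e1 = (if q < 2 * p then {x} else if q = 2 * p then {pt 0 (1 / (2 * c))} else {})"
proof -
  obtain A B where AB: "\<And>k b. k \<ge> 1 \<Longrightarrow> (deriv ^^ k) (\<lambda>s. sqdist (pt 0 b) (\<gamma> s)) 0 = fact k * ((if k = 2 * p then 1 else 0) - 2 * b * A k + B k)"
    "\<And>k. k < q \<Longrightarrow> A k = 0" "A q = c" "\<And>k. k < 2 * q \<Longrightarrow> B k = (0::real)"
    using sqdist_coefficients by blast
  have line: "normal_line (\<gamma> 0) e1 = range (pt 0)" by (simp add: gamma_0 normal_line_eq)
  have inj: "inj (pt 0)" by (auto intro: injI)
  consider "q < 2 * p" | "q = 2 * p" | "q > 2 * p" by linarith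
  then show ?thesis
  proof cases
    case 1
    have "focal_points \<gamma> 0 e1 = pt 0 ` {0}"
    proof (rule focal_points_eqI[of \<gamma> 0 e1 "pt 0", OF line inj])
      show "contact_order \<gamma> 0 (pt 0 b) = enat q" if "b \<in> - {0}" for b
        by (rule contact_order_eqI) (use that 1 pq c in \<open>auto simp: AB simp del: One_nat_def\<close>)
      show "contact_order \<gamma> 0 (pt 0 b) \<noteq> enat q" if "b \<in> {0}" for b
        by (rule contact_order_neqI) (use that 1 pq c in \<open>auto simp: AB simp del: One_nat_def\<close>)
    qed simp
    then show ?thesis using 1 by (simp add: pt_def)
  next
    case 2
    have "focal_points \<gamma> 0 e1 = pt 0 ` {1 / (2 * c)}"
    proof (rule focal_points_eqI[of \<gamma> 0 e1 "pt 0", OF line inj])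
      show "contact_order \<gamma> 0 (pt 0 b) = enat (2 * p)" if "b \<in> - {1 / (2 * c)}" for b
        by (rule contact_order_eqI) (use that 2 pq c AB(3) in \<open>auto simp: AB field_simps simp del: One_nat_def\<close>)
      show "contact_order \<gamma> 0 (pt 0 b) \<noteq> enat (2 * p)" if "b \<in> {1 / (2 * c)}" for b
      proof (rule contact_order_neqI)
        fix k assume k: "1 \<le> k" "k \<le> 2 * p"
        show "(deriv ^^ k) (\<lambda>s. sqdist (pt 0 b) (\<gamma> s)) 0 = 0"
          using AB(1)[OF k(1), of b] AB(2)[of k] AB(3) AB(4)[of k] that k 2 c pq by (cases "k = 2 * p") auto
      qed (use pq in simp)
    qed simp
    then show ?thesis using 2 by simp
  next
    case 3
    have "focal_points \<gamma> 0 e1 = pt 0 ` {}"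
    proof (rule focal_points_eqI[of \<gamma> 0 e1 "pt 0", OF line inj])
      show "contact_order \<gamma> 0 (pt 0 b) = enat (2 * p)" if "b \<in> - {}" for b
        by (rule contact_order_eqI) (use 3 pq c in \<open>auto simp: AB simp del: One_nat_def\<close>)
    qed auto
    then show ?thesis using 3 by simp
  qed
qed

text \<open>The centre of curvature. Along the normal, parametrized by multiples of the rotated
  velocity \<open>(- b, a)\<close>, the first derivative of the squared distance vanishes and the
  second is affine in the multiple; its only zero is the point of higher contact.\<close>

lemma regular_focal_point:
  fixes a a' b b' t :: real
  assumes y1: "\<forall>\<^sub>F s in nhds t. (y has_real_derivative y1 s) (at s)" and y2: "(y1 has_real_derivative b') (at t)"
    and "a = real p * t ^ (p - 1)" "a' = real p * (real p - 1) * t ^ (p - 2)" "b = y1 t" and D: "a * b' - b * a' \<noteq> 0"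
  shows "focal_points \<gamma> t (vector_derivative \<gamma> (at t)) =
    {pt (t ^ p - b * ((a\<^sup>2 + b\<^sup>2) / (a * b' - b * a'))) (y t + a * ((a\<^sup>2 + b\<^sup>2) / (a * b' - b * a')))}"
proof -
  define l where "l = (\<lambda>s. pt (t ^ p - b * s) (y t + a * s))"
  have y': "(y has_real_derivative b) (at t)" using eventually_nhds_x_imp_x[OF y1] assms by simp
  have ab: "a \<noteq> 0 \<or> b \<noteq> 0" using D by auto
  have pp: "((\<lambda>s. s ^ p) has_real_derivative real p * s ^ (p - 1)) (at s)" for s :: real
    by (auto intro!: derivative_eq_intros)
  have pp': "((\<lambda>s. real p * s ^ (p - 1)) has_real_derivative a') (at t)"
    using pq by (auto intro!: derivative_eq_intros simp: assms(4) numeral_2_eq_2 of_nat_diff)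
  have "(\<gamma> has_vector_derivative (a *\<^sub>R e1 + b *\<^sub>R e2)) (at t)"
  proof -
    have "((\<lambda>t. t ^ p *\<^sub>R e1) has_vector_derivative a *\<^sub>R e1) (at t)"
      using has_vector_derivative_scaleR[OF pp has_vector_derivative_const] by (simp add: assms(3))
    moreover have "((\<lambda>t. y t *\<^sub>R e2) has_vector_derivative b *\<^sub>R e2) (at t)"
      using has_vector_derivative_scaleR[OF y' has_vector_derivative_const] by simp
    ultimately show ?thesis unfolding \<gamma>
      using has_vector_derivative_add[OF has_vector_derivative_add[OF has_vector_derivative_const[of x]]] by fastforce
  qed
  then have vd: "vector_derivative \<gamma> (at t) = a *\<^sub>R e1 + b *\<^sub>R e2" by (rule vector_derivative_at)
  have inner: "(pt c d - \<gamma> t) \<bullet> (a *\<^sub>R e1 + b *\<^sub>R e2) = (c - t ^ p) * a + (d - y t) * b" for c d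
  proof -
    have "pt c d - \<gamma> t = pt (c - t ^ p) (d - y t) - x" by (simp add: pt_def \<gamma> algebra_simps)
    then show ?thesis by (simp add: inner_add_right pt_inner)
  qed
  have line: "normal_line (\<gamma> t) (a *\<^sub>R e1 + b *\<^sub>R e2) = range l"
  proof (intro set_eqI iffI)
    fix v assume "v \<in> normal_line (\<gamma> t) (a *\<^sub>R e1 + b *\<^sub>R e2)"
    moreover obtain c d where v: "v = pt c d" using pt_coordinates by blast
    ultimately have e: "(c - t ^ p) * a + (d - y t) * b = 0" by (simp add: normal_line_def inner)
    \<comment> \<open>The component of the offset along \<open>(- b, a)\<close>, in units of that
      vector.\<close>
    define s where "s = (a * (d - y t) - b * (c - t ^ p)) / (a\<^sup>2 + b\<^sup>2)"
    have n: "a\<^sup>2 + b\<^sup>2 \<noteq> 0" using ab by (simp add: sum_power2_eq_zero_iff)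
    have "(a\<^sup>2 + b\<^sup>2) * C = a * (C * a + D * b) - b * (a * D - b * C)"
      "(a\<^sup>2 + b\<^sup>2) * D = b * (C * a + D * b) + a * (a * D - b * C)" for C D
      by (simp_all add: power2_eq_square algebra_simps)
    from this[where C="c - t ^ p" and D="d - y t"] have "(a\<^sup>2 + b\<^sup>2) * (c - t ^ p) = - b * (a * (d - y t) - b * (c - t ^ p))"
      "(a\<^sup>2 + b\<^sup>2) * (d - y t) = a * (a * (d - y t) - b * (c - t ^ p))" by (simp_all add: e)
    then have "c - t ^ p = - b * s" "d - y t = a * s" using n by (auto simp: s_def field_simps)
    then have "v = l s" by (simp add: v l_def algebra_simps)
    then show "v \<in> range l" by simp
  next
    fix v assume "v \<in> range l"
    then show "v \<in> normal_line (\<gamma> t) (a *\<^sub>R e1 + b *\<^sub>R e2)" by (auto simp: l_def normal_line_def inner)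
  qed
  have inj: "inj l" using ab by (auto intro!: injI simp: l_def)
  have d1: "\<forall>\<^sub>F s in nhds t. deriv (\<lambda>s. sqdist (pt c d) (\<gamma> s)) s = 2 * (s ^ p - c) * (real p * s ^ (p - 1)) + 2 * (y s - d) * y1 s" for c d
    using y1
  proof eventually_elim
    case (elim s)
    show ?case unfolding sqdist_pt
      by (rule DERIV_imp_deriv) (use elim pp[of s] in \<open>auto intro!: derivative_eq_intros simp: algebra_simps\<close>)
  qed
  have "deriv (\<lambda>s. sqdist (l s0) (\<gamma> s)) t = 0" for s0
    using eventually_nhds_x_imp_x[OF d1] by (simp add: l_def assms(3,5))
  moreover have "deriv (deriv (\<lambda>s. sqdist (l s0) (\<gamma> s))) t = 2 * (a\<^sup>2 + b\<^sup>2) - 2 * s0 * (a * b' - b * a')" for s0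
  proof -
    have half: "((\<lambda>s. 2 * (u s - c) * u1 s) has_real_derivative 2 * (u1 t * u1 t + (u t - c) * u2)) (at t)"
      if "(u has_real_derivative u1 t) (at t)" "(u1 has_real_derivative u2) (at t)" for u u1 :: "real \<Rightarrow> real" and u2 c
      using that by (auto intro!: derivative_eq_intros simp: algebra_simps)
    have dd: "(deriv (\<lambda>s. sqdist (pt c d) (\<gamma> s)) has_real_derivative
      2 * (a * a + (t ^ p - c) * a') + 2 * (b * b + (y t - d) * b')) (at t)" for c d
      using DERIV_add[OF half[OF pp pp', of c] half[OF y'[unfolded assms(5)] y2, of d]]
        DERIV_cong_ev[OF refl d1[of c d] refl] by (simp add: assms(3,5))
    show ?thesis
      using DERIV_imp_deriv[OF dd[where c="t ^ p - b * s0" and d="y t + a * s0"]]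
      by (simp add: l_def power2_eq_square algebra_simps)
  qed
  ultimately have "focal_points \<gamma> t (a *\<^sub>R e1 + b *\<^sub>R e2) = l ` {(a\<^sup>2 + b\<^sup>2) / (a * b' - b * a')}"
  proof (intro focal_points_eqI[of \<gamma> t "a *\<^sub>R e1 + b *\<^sub>R e2" l _ 2, OF line inj])
    assume d: "\<And>s0. deriv (\<lambda>s. sqdist (l s0) (\<gamma> s)) t = 0"
      "\<And>s0. deriv (deriv (\<lambda>s. sqdist (l s0) (\<gamma> s))) t = 2 * (a\<^sup>2 + b\<^sup>2) - 2 * s0 * (a * b' - b * a')"
    show "contact_order \<gamma> t (l s0) = enat 2" if "s0 \<in> - {(a\<^sup>2 + b\<^sup>2) / (a * b' - b * a')}" for s0
    proof (rule contact_order_eqI)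
      show "(deriv ^^ 2) (\<lambda>s. sqdist (l s0) (\<gamma> s)) t \<noteq> 0" using that D d(2)[of s0] by (simp add: numeral_2_eq_2 field_simps)
      fix k :: nat assume "1 \<le> k" "k < 2"
      then have "k = 1" by simp
      then show "(deriv ^^ k) (\<lambda>s. sqdist (l s0) (\<gamma> s)) t = 0" using d(1) by simp
    qed simp
    show "contact_order \<gamma> t (l s0) \<noteq> enat 2" if "s0 \<in> {(a\<^sup>2 + b\<^sup>2) / (a * b' - b * a')}" for s0
    proof (rule contact_order_neqI)
      fix k :: nat assume "1 \<le> k" "k \<le> 2"
      then consider "k = 1" | "k = 2" by linarith
      then show "(deriv ^^ k) (\<lambda>s. sqdist (l s0) (\<gamma> s)) t = 0"
        using d(1)[of s0] d(2)[of s0] that D by cases (auto simp: numeral_2_eq_2)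
    qed simp
  qed simp
  then show ?thesis by (simp add: vd l_def)
qed

text \<open>The evolute with its powers of \<open>t\<close> extracted: squared speed
  \<open>t ^ (2 * p - 2) * S t\<close> and curvature numerator
  \<open>p * t ^ (p + q - 3) * E t\<close>, with \<open>S\<close> and \<open>E\<close> nonzero at 0.
  The ordinate is thus \<open>y t + t ^ (2 * p - q) * R t\<close>, with a reciprocal power when the
  exponent is negative.\<close>

lemma focal_curve:
  "\<exists>F1 F2 R. (\<forall>\<^sub>F t in at 0. focal_points \<gamma> t (vector_derivative \<gamma> (at t)) = {pt (F1 t) (F2 t)}) \<and>
    (F1 \<longlongrightarrow> 0) (at 0) \<and> (R \<longlongrightarrow> p\<^sup>2 / (q * c * (q - p))) (at 0) \<and>
    (\<forall>\<^sub>F t in at 0. F2 t = y t + (if q \<le> 2 * p then t ^ (2 * p - q) * R t else R t * inverse (t ^ (q - 2 * p))))"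
proof -
  obtain Y' where Y': "real_analytic_at Y' 0" "\<forall>\<^sub>F t in nhds 0. (Y has_real_derivative Y' t) (at t)"
    using real_analytic_deriv[OF Y(1)] by blast
  define y1 where "y1 = (\<lambda>t. t ^ (q - 1) * Y t)"
  define Z where "Z = (\<lambda>t. (real q - 1) * Y t + t * Y' t)"
  define E where "E = (\<lambda>t. Z t - (real p - 1) * Y t)"
  define S where "S = (\<lambda>t. (real p)\<^sup>2 + t ^ (2 * q - 2 * p) * (Y t)\<^sup>2)"
  define R where "R = (\<lambda>t. S t / E t)"
  have lim: "(f \<longlongrightarrow> f 0) (at 0)" if "real_analytic_at f 0" for f using real_analytic_isCont[OF that] by (simp add: isCont_def)
  have rZ: "real_analytic_at E 0" "real_analytic_at S 0" unfolding E_def Z_def S_def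
    by (intro real_analytic_add real_analytic_diff real_analytic_mult real_analytic_power real_analytic_const real_analytic_ident Y Y')+
  have E0: "E 0 = q * c * (q - p)" using pq by (simp add: E_def Z_def Y(2) algebra_simps)
  have S0: "S 0 = p\<^sup>2" using pq by (simp add: S_def)
  have E0': "E 0 \<noteq> 0" using E0 c pq by simp
  have R: "(R \<longlongrightarrow> p\<^sup>2 / (q * c * (q - p))) (at 0)"
    unfolding R_def using tendsto_divide[OF lim[OF rZ(2)] lim[OF rZ(1)] E0'] by (simp add: E0 S0)
  define F1 where "F1 = (\<lambda>t. t ^ p - t ^ p * Y t * R t / p)"
  define F2 where "F2 = (\<lambda>t. y t + (if q \<le> 2 * p then t ^ (2 * p - q) * R t else R t * inverse (t ^ (q - 2 * p))))"
  have "((\<lambda>t. t ^ p - t ^ p * Y t * R t / p) \<longlongrightarrow> 0 ^ p - 0 ^ p * Y 0 * (p\<^sup>2 / (q * c * (q - p))) / p) (at 0)"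
    by (intro tendsto_intros R lim[OF Y(1)]) (use pq in auto)
  then have F1: "(F1 \<longlongrightarrow> 0) (at 0)" using pq by (simp add: F1_def power_0_left)
  have Enz: "\<forall>\<^sub>F t in nhds 0. E t \<noteq> 0" using real_analytic_tendsto[OF rZ(1)] E0' by (rule tendsto_imp_eventually_ne)
  have "\<forall>\<^sub>F t in nhds 0. t \<noteq> 0 \<longrightarrow> focal_points \<gamma> t (vector_derivative \<gamma> (at t)) = {pt (F1 t) (F2 t)}"
    using iffD2[OF eventually_eventually Y(3)] Y'(2) Enz
  proof eventually_elim
    case (elim t)
    show ?case
    proof
    assume t0: "t \<noteq> 0"
    \<comment> \<open>The common power in \<open>a * b'\<close> and \<open>b * a'\<close>; isolating
      it leaves \<open>E\<close>, whose value at 0 is \<open>q * c * (q - p)\<close>.\<close>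
    define T where "T = t ^ (p + q - 3)"
    have T: "T \<noteq> 0" using t0 by (simp add: T_def)
    define a a' b b' where "a = real p * t ^ (p - 1)" and "a' = real p * (real p - 1) * t ^ (p - 2)"
      and "b = y1 t" and "b' = t ^ (q - 2) * Z t"
    have y2: "(y1 has_real_derivative b') (at t)"
    proof -
      have "t ^ (q - 1) = t ^ (q - 2) * t" using pq by (metis One_nat_def Suc_1 Suc_diff_Suc less_le_trans lessI power_Suc2 less_trans)
      moreover have "q - 1 - 1 = q - 2" by simp
      ultimately show ?thesis unfolding y1_def b'_def Z_def using elim(2) pq
        by (auto intro!: derivative_eq_intros simp: algebra_simps of_nat_diff)
    qed
    have e1: "(p - 1) + (q - 2) = p + q - 3" "(q - 1) + (p - 2) = p + q - 3" using pq by linarith+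
    have D: "a * b' - b * a' = real p * T * E t"
    proof -
      have 1: "t ^ (p - 1) * t ^ (q - 2) = T" "t ^ (q - 1) * t ^ (p - 2) = T"
        by (simp_all only: T_def e1 flip: power_add)
      have "a * b' = real p * (t ^ (p - 1) * t ^ (q - 2)) * Z t" by (simp add: a_def b'_def)
      moreover have "b * a' = real p * (real p - 1) * (t ^ (q - 1) * t ^ (p - 2)) * Y t"
        by (simp add: a'_def b_def y1_def)
      ultimately show ?thesis unfolding 1 by (simp add: E_def algebra_simps)
    qed
    have N: "a\<^sup>2 + b\<^sup>2 = t ^ (2 * p - 2) * S t"
    proof -
      have "(p - 1) * 2 = 2 * p - 2" by simp
      then have 1: "(t ^ (p - 1))\<^sup>2 = t ^ (2 * p - 2)" by (simp only: flip: power_mult)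
      have "(q - 1) * 2 = (2 * p - 2) + (2 * q - 2 * p)" using pq by linarith
      then have 2: "(t ^ (q - 1))\<^sup>2 = t ^ (2 * p - 2) * t ^ (2 * q - 2 * p)" by (simp only: flip: power_mult power_add)
      show ?thesis unfolding a_def b_def y1_def S_def power_mult_distrib 1 2 by (simp add: algebra_simps)
    qed
    have nz: "a * b' - b * a' \<noteq> 0" using D T elim(3) pq by simp
    have quot: "(a\<^sup>2 + b\<^sup>2) / (a * b' - b * a') = t ^ (2 * p - 2) * R t / (real p * T)"
      by (simp add: D N R_def)
    have "(q - 1) + (2 * p - 2) = p + (p + q - 3)" using pq by linarith
    then have "t ^ (q - 1) * t ^ (2 * p - 2) = t ^ p * T" by (simp only: T_def flip: power_add)
    then have "b * ((a\<^sup>2 + b\<^sup>2) / (a * b' - b * a')) = t ^ p * Y t * R t / p"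
      unfolding quot using T pq by (simp add: b_def y1_def field_simps)
    then have f1: "t ^ p - b * ((a\<^sup>2 + b\<^sup>2) / (a * b' - b * a')) = F1 t" by (simp add: F1_def)
    have "a * ((a\<^sup>2 + b\<^sup>2) / (a * b' - b * a')) = (if q \<le> 2 * p then t ^ (2 * p - q) * R t else R t * inverse (t ^ (q - 2 * p)))"
    proof (cases "q \<le> 2 * p")
      case True
      then have "(p - 1) + (2 * p - 2) = (2 * p - q) + (p + q - 3)" using pq by linarith
      then have "t ^ (p - 1) * t ^ (2 * p - 2) = t ^ (2 * p - q) * T" by (simp only: T_def flip: power_add)
      then show ?thesis unfolding quot using T pq True by (simp add: a_def field_simps)
    next
      case False
      then have "(q - 2 * p) + ((p - 1) + (2 * p - 2)) = p + q - 3" using pq by linarith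
      then have "t ^ (q - 2 * p) * (t ^ (p - 1) * t ^ (2 * p - 2)) = T" by (simp only: T_def flip: power_add)
      then show ?thesis unfolding quot using T pq False t0 by (simp add: a_def field_simps)
    qed
    then have f2: "y t + a * ((a\<^sup>2 + b\<^sup>2) / (a * b' - b * a')) = F2 t" by (simp add: F2_def)
    show "focal_points \<gamma> t (vector_derivative \<gamma> (at t)) = {pt (F1 t) (F2 t)}"
    proof -
      have "\<forall>\<^sub>F s in nhds t. (y has_real_derivative y1 s) (at s)" using elim(1) by (simp add: y1_def)
      from regular_focal_point[OF this y2 a_def a'_def b_def nz] show ?thesis unfolding f1 f2 .
    qed
    qed
  qed
  then have "\<forall>\<^sub>F t in at 0. focal_points \<gamma> t (vector_derivative \<gamma> (at t)) = {pt (F1 t) (F2 t)}"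
    by (simp add: eventually_at_filter)
  then show ?thesis using F1 R by (intro exI[of _ F1] exI[of _ F2] exI[of _ R]) (auto simp: F2_def)
qed

text \<open>The sign of \<open>2 * p - q\<close> decides between convergence to \<open>x\<close>,
  convergence to a finite point and escape to infinity, while the abscissa always tends to 0. For
  \<open>q = 2 * p\<close> the limit of \<open>R\<close> simplifies to
  \<open>1 / (2 * c)\<close>.\<close>

lemma focal_limit:
  "\<exists>F. (\<forall>\<^sub>F t in at 0. focal_points \<gamma> t (vector_derivative \<gamma> (at t)) = {F t}) \<and>
    (q < 2 * p \<longrightarrow> (F \<longlongrightarrow> x) (at 0)) \<and>
    (q = 2 * p \<longrightarrow> (F \<longlongrightarrow> pt 0 (1 / (2 * c))) (at 0)) \<and>
    (q > 2 * p \<longrightarrow> filterlim F at_infinity (at 0) \<and> ((\<lambda>t. infdist (F t) (normal_line x e1)) \<longlongrightarrow> 0) (at 0))"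
proof -
  obtain F1 F2 R where F: "\<forall>\<^sub>F t in at 0. focal_points \<gamma> t (vector_derivative \<gamma> (at t)) = {pt (F1 t) (F2 t)}"
    "(F1 \<longlongrightarrow> 0) (at 0)" and R: "(R \<longlongrightarrow> p\<^sup>2 / (q * c * (q - p))) (at 0)"
    and F2: "\<forall>\<^sub>F t in at 0. F2 t = y t + (if q \<le> 2 * p then t ^ (2 * p - q) * R t else R t * inverse (t ^ (q - 2 * p)))"
    using focal_curve by blast
  have ly: "(y \<longlongrightarrow> 0) (at 0)" using real_analytic_isCont[OF y] by (simp add: isCont_def y_0)
  have pt_lim: "((\<lambda>t. pt (F1 t) (F2 t)) \<longlongrightarrow> pt 0 b) (at 0)" if "(F2 \<longlongrightarrow> b) (at 0)" for b
    unfolding pt_def by (intro tendsto_intros F that)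
  \<comment> \<open>The convention \<open>0 ^ 0 = 1\<close> lets one formula serve both
    \<open>q < 2 * p\<close> and \<open>q = 2 * p\<close>.\<close>
  have le: "(F2 \<longlongrightarrow> 0 + 0 ^ (2 * p - q) * (p\<^sup>2 / (q * c * (q - p)))) (at 0)" if "q \<le> 2 * p"
  proof -
    have "((\<lambda>t. y t + t ^ (2 * p - q) * R t) \<longlongrightarrow> 0 + 0 ^ (2 * p - q) * (p\<^sup>2 / (q * c * (q - p)))) (at 0)"
      by (intro tendsto_intros R ly)
    then show ?thesis
      by (rule Lim_transform_eventually) (use F2 that in \<open>auto elim: eventually_mono\<close>)
  qed
  show ?thesis
  proof (intro exI[of _ "\<lambda>t. pt (F1 t) (F2 t)"] conjI impI F)
    assume q: "q < 2 * p"
    then show "((\<lambda>t. pt (F1 t) (F2 t)) \<longlongrightarrow> x) (at 0)" using pt_lim[OF le] by (simp add: pt_def power_0_left)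
  next
    assume q: "q = 2 * p"
    have "p\<^sup>2 / (q * c * (q - p)) = 1 / (2 * c)" using q pq c by (simp add: power2_eq_square field_simps)
    then show "((\<lambda>t. pt (F1 t) (F2 t)) \<longlongrightarrow> pt 0 (1 / (2 * c))) (at 0)" using pt_lim[OF le] q by simp
  next
    assume q: "q > 2 * p"
    have "filterlim (\<lambda>t::real. t ^ (q - 2 * p)) (at 0) (at 0)"
    proof (rule filterlim_atI)
      have "((\<lambda>t::real. t ^ (q - 2 * p)) \<longlongrightarrow> 0 ^ (q - 2 * p)) (at 0)" by (intro tendsto_intros)
      then show "((\<lambda>t::real. t ^ (q - 2 * p)) \<longlongrightarrow> 0) (at 0)" using q by (simp add: power_0_left)
      show "\<forall>\<^sub>F t::real in at 0. t ^ (q - 2 * p) \<noteq> 0"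
        using eventually_neq_at_within[of 0 0 UNIV] by eventually_elim simp
    qed
    then have "filterlim (\<lambda>t::real. inverse (t ^ (q - 2 * p))) at_infinity (at 0)"
      by (rule filterlim_compose[OF filterlim_inverse_at_infinity])
    moreover have "p\<^sup>2 / (q * c * (q - p)) \<noteq> 0" using pq c by simp
    ultimately have "filterlim (\<lambda>t. R t * inverse (t ^ (q - 2 * p))) at_infinity (at 0)"
      using R by (intro tendsto_mult_filterlim_at_infinity)
    then have "filterlim (\<lambda>t. y t + R t * inverse (t ^ (q - 2 * p))) at_infinity (at 0)"
      by (rule tendsto_add_filterlim_at_infinity[OF ly])
    then have "filterlim F2 at_infinity (at 0)"
      using filterlim_cong[OF refl refl F2] q by simp
    then have "filterlim (\<lambda>t. norm (F2 t)) at_top (at 0)" by (rule filterlim_at_infinity_imp_norm_at_top)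
    then have at_top: "filterlim (\<lambda>t. - norm x + norm (F2 t)) at_top (at 0)"
      by (rule filterlim_tendsto_add_at_top[OF tendsto_const])
    \<comment> \<open>A large ordinate forces a large norm, because projection to the unit vector
      \<open>e2\<close> does not increase length.\<close>
    have bound: "- norm x + norm (F2 t) \<le> norm (pt (F1 t) (F2 t))" for t
    proof -
      have "\<bar>F2 t\<bar> = \<bar>(pt (F1 t) (F2 t) - x) \<bullet> e2\<bar>" by (simp add: pt_inner)
      also have "\<dots> \<le> norm (pt (F1 t) (F2 t) - x) * norm e2" by (rule Cauchy_Schwarz_ineq2)
      also have "\<dots> \<le> norm (pt (F1 t) (F2 t)) + norm x" using norm_triangle_ineq4 orth by simp
      finally show ?thesis by simp
    qed
    have "filterlim (\<lambda>t. norm (pt (F1 t) (F2 t))) at_top (at 0)"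
      by (rule filterlim_at_top_mono[OF at_top]) (simp only: bound eventually_True)
    then show "filterlim (\<lambda>t. pt (F1 t) (F2 t)) at_infinity (at 0)"
      by (rule filterlim_norm_at_top_imp_at_infinity)
    have b: "infdist (pt (F1 t) (F2 t)) (normal_line x e1) \<le> \<bar>F1 t\<bar>" for t
    proof -
      have "infdist (pt (F1 t) (F2 t)) (normal_line x e1) \<le> dist (pt (F1 t) (F2 t)) (pt 0 (F2 t))"
        by (rule infdist_le) (simp add: normal_line_eq)
      also have "\<dots> = \<bar>F1 t\<bar>" using orth by (simp add: pt_def dist_norm)
      finally show ?thesis .
    qed
    show "((\<lambda>t. infdist (pt (F1 t) (F2 t)) (normal_line x e1)) \<longlongrightarrow> 0) (at 0)"
      by (rule tendsto_sandwich[OF _ _ tendsto_const tendsto_rabs_zero[OF F(2)]]) (use b in \<open>auto simp: infdist_nonneg\<close>)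
  qed
qed

end

section \<open>The classification\<close>

text \<open>Coefficients vanish up to and including degree \<open>q\<close>, so dividing
  \<open>\<sigma>\<close> by \<open>t ^ q\<close> leaves a series without constant term, and the
  cofactor \<open>w\<close> has value \<open>c\<close> at 0.\<close>

lemma fps_branch_normal_form:
  fixes \<sigma> :: "real fps"
  assumes "0 < fps_conv_radius \<sigma>" "\<forall>n\<le>q. fps_nth \<sigma> n = 0"
  shows "\<exists>w. real_analytic_at w 0 \<and> w 0 = c \<and> (\<forall>\<^sub>F t in nhds 0. c * t ^ q + eval_fps \<sigma> t = t ^ q * w t)"
    and "real_analytic_at (\<lambda>t. c * t ^ q + eval_fps \<sigma> t) 0"
proof -
  define g where "g = eval_fps (fps_shift q \<sigma>)"
  have "g has_fps_expansion fps_shift q \<sigma>"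
    unfolding g_def by (rule eval_fps_has_fps_expansion) (use assms(1) in simp)
  then have g: "real_analytic_at g 0" by (rule has_fps_expansion_imp_real_analytic)
  have g0: "g 0 = 0" using assms(2) by (simp add: g_def eval_fps_at_0)
  have \<sigma>: "\<sigma> = fps_shift q \<sigma> * fps_X ^ q"
    by (rule fps_ext) (use assms(2) in \<open>simp add: fps_X_power_mult_right_nth\<close>)
  have "\<forall>\<^sub>F t in nhds 0. t \<in> eball (0::real) (fps_conv_radius \<sigma>)"
    using assms(1) by (intro eventually_nhds_in_open) (auto simp: zero_ereal_def)
  then have ev: "\<forall>\<^sub>F t in nhds 0. c * t ^ q + eval_fps \<sigma> t = t ^ q * (c + g t)"
  proof eventually_elim
    case (elim t)
    have "eval_fps \<sigma> t = eval_fps (fps_shift q \<sigma> * fps_X ^ q) t" by (rule arg_cong[OF \<sigma>])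
    also have "\<dots> = g t * t ^ q"
      using elim by (subst eval_fps_mult) (auto simp: g_def in_eball_iff)
    finally show ?case by (simp add: algebra_simps)
  qed
  moreover have "real_analytic_at (\<lambda>t. c + g t) 0" using g by (intro real_analytic_add real_analytic_const)
  ultimately show "\<exists>w. real_analytic_at w 0 \<and> w 0 = c \<and> (\<forall>\<^sub>F t in nhds 0. c * t ^ q + eval_fps \<sigma> t = t ^ q * w t)"
    using g0 by (intro exI[of _ "\<lambda>t. c + g t"]) simp
  have "real_analytic_at (\<lambda>t. t ^ q * (c + g t)) 0" using g by (intro real_analytic_mult real_analytic_power real_analytic_ident real_analytic_add real_analytic_const)
  then show "real_analytic_at (\<lambda>t. c * t ^ q + eval_fps \<sigma> t) 0"
    by (rule real_analytic_cong) (use ev in \<open>auto elim: eventually_mono\<close>)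
qed

context singular_branch
begin

lemma branch_paramI:
  assumes "injective_near_0 \<gamma>" "\<forall>\<^sub>F t in nhds 0. \<gamma> t \<in> X" shows "branch_param X \<gamma>"
proof -
  have "real_analytic_at (\<lambda>t. fst (\<gamma> t)) 0" "real_analytic_at (\<lambda>t. snd (\<gamma> t)) 0"
    unfolding \<gamma> by (auto intro!: real_analytic_add real_analytic_mult real_analytic_power real_analytic_const real_analytic_ident y)
  then show ?thesis using assms by (simp add: branch_param_def analytic_arc_iff_real_analytic)
qed

lemma K_nonzero: "b \<noteq> 0 \<Longrightarrow> pt 0 b \<notin> focal_points \<gamma> 0 e1 \<Longrightarrow> K b \<noteq> 0"
  using pq c by (auto simp: focal_points_0 K_def field_simps split: if_splits)

text \<open>The table is \<open>unfolding_count\<close> evaluated for the parities of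
  \<open>p\<close> and \<open>M\<close>. Where orientation matters, the constant sign of
  \<open>K\<close> on \<open>J\<close> selects one alternative for all heights at once.\<close>

lemma crossing_list:
  assumes J: "connected J" "J \<subseteq> {b. b \<noteq> 0 \<and> pt 0 b \<notin> focal_points \<gamma> 0 e1}"
  shows "(odd p \<and> odd q \<and> q < 2 * p \<longrightarrow> (\<forall>b\<in>J. changes \<gamma> (\<lambda>a. pt a b) (1, 1) (0, 0))) \<and>
       (odd p \<and> odd q \<and> q > 2 * p \<longrightarrow>
          (\<forall>b\<in>J. persists \<gamma> (\<lambda>a. pt a b) (0, 1)) \<or> (\<forall>b\<in>J. persists \<gamma> (\<lambda>a. pt a b) (1, 0))) \<and>
       (odd p \<and> even q \<longrightarrow>
          (\<forall>b\<in>J. persists \<gamma> (\<lambda>a. pt a b) (0, 1)) \<or> (\<forall>b\<in>J. persists \<gamma> (\<lambda>a. pt a b) (1, 0))) \<and>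
       (even p \<and> odd q \<and> q < 2 * p \<longrightarrow> (\<forall>b\<in>J. changes \<gamma> (\<lambda>a. pt a b) (1, 1) (1, 1))) \<and>
       (even p \<and> odd q \<and> q > 2 * p \<longrightarrow>
          (\<forall>b\<in>J. changes \<gamma> (\<lambda>a. pt a b) (0, 1) (1, 2)) \<or> (\<forall>b\<in>J. changes \<gamma> (\<lambda>a. pt a b) (1, 0) (2, 1))) \<and>
       (even p \<and> even q \<longrightarrow>
          (\<forall>b\<in>J. changes \<gamma> (\<lambda>a. pt a b) (2, 1) (1, 0)) \<or> (\<forall>b\<in>J. changes \<gamma> (\<lambda>a. pt a b) (1, 2) (0, 1)))"
proof -
  have K0: "K b \<noteq> 0" if "b \<in> J" for b using K_nonzero J(2) that by blast
  have sym: "changes \<gamma> h n n' \<longleftrightarrow> changes \<gamma> h n' n" for h n n' by (auto simp: changes_def)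
  have ch: "changes \<gamma> (\<lambda>a. pt a b) (oriented (K b) (unfolding_count p M (- 1))) (oriented (K b) (unfolding_count p M 1))"
    if "b \<in> J" for b by (rule crossing_changes[OF leading_G[OF K0[OF that]]])
  have pe: "persists \<gamma> (\<lambda>a. pt a b) (oriented (K b) (0, 1))" if "b \<in> J" "odd p" "odd M" for b
    by (rule crossing_persists[OF leading_G[OF K0[OF that(1)]] that(2,3)])
  \<comment> \<open>For \<open>q < 2 * p\<close> the exponent is \<open>q - p\<close>, otherwise it
    is \<open>p\<close>; hence \<open>q\<close> influences the type in the second range only through
    its size.\<close>
  have parity: "q < 2 * p \<Longrightarrow> even M \<longleftrightarrow> (even p \<longleftrightarrow> even q)" "\<not> q < 2 * p \<Longrightarrow> even M \<longleftrightarrow> even p"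
    using pq by (auto simp: M_def)
  have sgn: "(\<forall>b\<in>J. K b > 0) \<or> (\<forall>b\<in>J. K b < 0)" using K_constant_sign[OF J(1) K0] .
  have persist: "(\<forall>b\<in>J. persists \<gamma> (\<lambda>a. pt a b) (0, 1)) \<or> (\<forall>b\<in>J. persists \<gamma> (\<lambda>a. pt a b) (1, 0))"
    if "odd p" "odd M"
    using sgn
  proof
    assume "\<forall>b\<in>J. K b > 0"
    then have "persists \<gamma> (\<lambda>a. pt a b) (0, 1)" if "b \<in> J" for b
      using pe[OF that \<open>odd p\<close> \<open>odd M\<close>] that by (simp add: oriented_def)
    then show ?thesis by blast
  next
    assume "\<forall>b\<in>J. K b < 0"
    then have "persists \<gamma> (\<lambda>a. pt a b) (1, 0)" if "b \<in> J" for b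
      using pe[OF that \<open>odd p\<close> \<open>odd M\<close>] that by (force simp: oriented_def)
    then show ?thesis by blast
  qed
  have cross: "(\<forall>b\<in>J. changes \<gamma> (\<lambda>a. pt a b) (0, 1) (1, 2)) \<or> (\<forall>b\<in>J. changes \<gamma> (\<lambda>a. pt a b) (1, 0) (2, 1))"
    if "even p" "even M"
    using sgn
  proof
    assume "\<forall>b\<in>J. K b > 0"
    then have "changes \<gamma> (\<lambda>a. pt a b) (0, 1) (1, 2)" if "b \<in> J" for b
      using ch[OF that] that \<open>even p\<close> \<open>even M\<close> by (simp add: oriented_def unfolding_count_def)
    then show ?thesis by blast
  next
    assume "\<forall>b\<in>J. K b < 0"
    then have "changes \<gamma> (\<lambda>a. pt a b) (1, 0) (2, 1)" if "b \<in> J" for b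
      using ch[OF that] that \<open>even p\<close> \<open>even M\<close> by (force simp: oriented_def unfolding_count_def)
    then show ?thesis by blast
  qed
  show ?thesis
  proof (intro conjI impI)
    assume a: "odd p \<and> odd q \<and> q < 2 * p"
    then have "even M" using parity by simp
    show "\<forall>b\<in>J. changes \<gamma> (\<lambda>a. pt a b) (1, 1) (0, 0)"
    proof
      fix b assume "b \<in> J"
      from ch[OF this] a \<open>even M\<close> have "changes \<gamma> (\<lambda>a. pt a b) (0, 0) (1, 1)"
        by (cases "K b > 0") (simp_all add: oriented_def unfolding_count_def)
      then show "changes \<gamma> (\<lambda>a. pt a b) (1, 1) (0, 0)" by (subst sym)
    qed
  next
    assume a: "even p \<and> odd q \<and> q < 2 * p"
    then have "odd M" using parity by simp
    show "\<forall>b\<in>J. changes \<gamma> (\<lambda>a. pt a b) (1, 1) (1, 1)"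
    proof
      fix b assume "b \<in> J"
      from ch[OF this] a \<open>odd M\<close> show "changes \<gamma> (\<lambda>a. pt a b) (1, 1) (1, 1)"
        by (cases "K b > 0") (simp_all add: oriented_def unfolding_count_def)
    qed
  next
    assume a: "even p \<and> even q"
    then have "even M" using parity by (cases "q < 2 * p") auto
    from cross[OF _ this] a show "(\<forall>b\<in>J. changes \<gamma> (\<lambda>a. pt a b) (2, 1) (1, 0)) \<or> (\<forall>b\<in>J. changes \<gamma> (\<lambda>a. pt a b) (1, 2) (0, 1))"
      using sym by blast
  next
    assume a: "even p \<and> odd q \<and> q > 2 * p"
    then have "even M" using parity by simp
    from cross[OF _ this] a show "(\<forall>b\<in>J. changes \<gamma> (\<lambda>a. pt a b) (0, 1) (1, 2)) \<or> (\<forall>b\<in>J. changes \<gamma> (\<lambda>a. pt a b) (1, 0) (2, 1))"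
      by blast
  next
    assume a: "odd p \<and> odd q \<and> q > 2 * p"
    then have "odd M" using parity by simp
    from persist[OF _ this] a show "(\<forall>b\<in>J. persists \<gamma> (\<lambda>a. pt a b) (0, 1)) \<or> (\<forall>b\<in>J. persists \<gamma> (\<lambda>a. pt a b) (1, 0))"
      by blast
  next
    assume a: "odd p \<and> even q"
    then have "odd M" using parity by (cases "q < 2 * p") auto
    from persist[OF _ this] a show "(\<forall>b\<in>J. persists \<gamma> (\<lambda>a. pt a b) (0, 1)) \<or> (\<forall>b\<in>J. persists \<gamma> (\<lambda>a. pt a b) (1, 0))"
      by blast
  qed
qed

end

theorem theorem1:
  fixes \<Phi> :: "real poly poly" and x e1 e2 :: "real \<times> real" and p q :: nat and c \<rho> :: real
    and \<sigma> :: "real fps" and \<gamma> :: "real \<Rightarrow> real \<times> real" and h :: "real \<Rightarrow> real \<Rightarrow> real \<times> real"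
    and N :: "(real \<times> real) set"
  assumes "squarefree \<Phi>" and "all_branches_real \<Phi>"
    and "x \<in> algebraic_singular_points \<Phi>"
    and "norm e1 = 1" and "norm e2 = 1" and "e1 \<bullet> e2 = 0"
    and "p < q" and "2 \<le> p" and "0 < c"
    and "0 < fps_conv_radius \<sigma>" and "\<forall>n\<le>q. fps_nth \<sigma> n = 0"
    and "\<gamma> = (\<lambda>t. x + t ^ p *\<^sub>R e1 + (c * t ^ q + eval_fps \<sigma> t) *\<^sub>R e2)"
    and "injective_near_0 \<gamma>" and "\<forall>\<^sub>F t in nhds 0. \<gamma> t \<in> curve \<Phi>"
    and "\<rho> = real q / (2 * real p)"
    and "N = normal_line x e1"
    and "h = (\<lambda>u2 u1. x + u1 *\<^sub>R e1 + u2 *\<^sub>R e2)"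
  shows
    "((odd p \<and> odd q \<and> \<rho> < 1) \<or> even p \<longrightarrow> N \<subseteq> tED_discriminant \<Phi>) \<and>

     (\<exists>F. (\<forall>\<^sub>F t in at 0. focal_points \<gamma> t (vector_derivative \<gamma> (at t)) = {F t}) \<and>
       (\<rho> < 1 \<longrightarrow> (F \<longlongrightarrow> x) (at 0)) \<and>
       (\<rho> = 1 \<longrightarrow> (\<exists>w. w \<in> N \<and> w \<noteq> x \<and> focal_points \<gamma> 0 e1 = {w} \<and> (F \<longlongrightarrow> w) (at 0))) \<and>
       (\<rho> > 1 \<longrightarrow> filterlim F at_infinity (at 0) \<and> ((\<lambda>t. infdist (F t) N) \<longlongrightarrow> 0) (at 0))) \<and>

     (odd p \<and> odd q \<and> \<rho> < 1 \<longrightarrow> N \<subseteq> germ_discriminant \<gamma>) \<and>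
     (odd p \<and> odd q \<and> \<rho> > 1 \<longrightarrow> \<not> N \<subseteq> germ_discriminant \<gamma>) \<and>
     (odd p \<and> even q \<longrightarrow> \<not> N \<subseteq> germ_discriminant \<gamma>) \<and>
     (even p \<longrightarrow> N \<subseteq> germ_discriminant \<gamma>) \<and>

     (\<forall>J. connected J \<and> J \<subseteq> {u2. u2 \<noteq> 0 \<and> h u2 0 \<notin> focal_points \<gamma> 0 e1} \<longrightarrow>
       (odd p \<and> odd q \<and> \<rho> < 1 \<longrightarrow> (\<forall>u2\<in>J. changes \<gamma> (h u2) (1, 1) (0, 0))) \<and>
       (odd p \<and> odd q \<and> \<rho> > 1 \<longrightarrow>
          (\<forall>u2\<in>J. persists \<gamma> (h u2) (0, 1)) \<or> (\<forall>u2\<in>J. persists \<gamma> (h u2) (1, 0))) \<and>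
       (odd p \<and> even q \<longrightarrow>
          (\<forall>u2\<in>J. persists \<gamma> (h u2) (0, 1)) \<or> (\<forall>u2\<in>J. persists \<gamma> (h u2) (1, 0))) \<and>
       (even p \<and> odd q \<and> \<rho> < 1 \<longrightarrow> (\<forall>u2\<in>J. changes \<gamma> (h u2) (1, 1) (1, 1))) \<and>
       (even p \<and> odd q \<and> \<rho> > 1 \<longrightarrow>
          (\<forall>u2\<in>J. changes \<gamma> (h u2) (0, 1) (1, 2)) \<or> (\<forall>u2\<in>J. changes \<gamma> (h u2) (1, 0) (2, 1))) \<and>
       (even p \<and> even q \<longrightarrow>
          (\<forall>u2\<in>J. changes \<gamma> (h u2) (2, 1) (1, 0)) \<or> (\<forall>u2\<in>J. changes \<gamma> (h u2) (1, 2) (0, 1)))) \<and>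

     (\<rho> < 1 \<longrightarrow> focal_points \<gamma> 0 e1 = {x}) \<and>
     (\<rho> = 1 \<longrightarrow> (\<exists>w. w \<in> N \<and> w \<noteq> x \<and> focal_points \<gamma> 0 e1 = {w})) \<and>
     (\<rho> > 1 \<longrightarrow> focal_points \<gamma> 0 e1 = {})"
proof -
  define y where "y = (\<lambda>t. c * t ^ q + eval_fps \<sigma> t)"
  obtain w where w: "real_analytic_at w 0" "w 0 = c" "\<forall>\<^sub>F t in nhds 0. y t = t ^ q * w t"
    using fps_branch_normal_form(1)[OF assms(10,11)] unfolding y_def by blast
  have "real_analytic_at y 0" unfolding y_def by (rule fps_branch_normal_form(2)[OF assms(10,11)])
  then interpret singular_branch x e1 e2 p q c y w \<gamma>
    using assms w by unfold_locales (auto simp: y_def)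
  have \<rho>: "\<rho> < 1 \<longleftrightarrow> q < 2 * p" "\<rho> = 1 \<longleftrightarrow> q = 2 * p" "\<rho> > 1 \<longleftrightarrow> q > 2 * p"
    using assms(8) by (auto simp: assms(15) field_simps simp flip: of_nat_mult of_nat_less_iff of_nat_eq_iff)
  have N: "N = range (pt 0)" using assms(16) normal_line_eq by simp
  have h: "h b = (\<lambda>a. pt a b)" "h b 0 = pt 0 b" for b by (simp_all add: assms(17) pt_def)
  have param: "branch_param (curve \<Phi>) \<gamma>" by (rule branch_paramI[OF assms(13,14)])
  have \<Phi>: "\<Phi> \<noteq> 0" using assms(1) by auto
  have gain: "gains_maxima \<gamma> 1 v" "v \<in> tED_discriminant \<Phi>"
    if cv: "(odd p \<and> odd q \<and> q < 2 * p) \<or> even p" "v \<in> N" for v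
  proof -
    obtain b where v: "v = pt 0 b" using cv(2) by (auto simp: N)
    show "gains_maxima \<gamma> 1 v" using normal_line_gains_maxima[OF cv(1) assms(13)] by (simp add: v)
    then show "v \<in> tED_discriminant \<Phi>"
      using gains_maxima_not_top_stable[OF \<Phi> param, of 1 v] normal_line_gains_maxima[OF cv(1) assms(13), of b]
      by (simp add: tED_discriminant_def v)
  qed
  have germ: "(odd p \<and> odd q \<and> q < 2 * p) \<or> even p \<Longrightarrow> N \<subseteq> germ_discriminant \<gamma>"
    using gain gains_maxima_germ_discriminant by blast
  \<comment> \<open>One stable point suffices; in these cases both \<open>p\<close> and
    \<open>M\<close> are odd, so the distance keeps a single extremum near that point.\<close>
  have stable: "\<not> N \<subseteq> germ_discriminant \<gamma>" if "odd p" "even q \<or> q > 2 * p"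
  proof -
    have "odd M" using that pq by (auto simp: M_def)
    then have "pt 0 (- 1) \<notin> germ_discriminant \<gamma>"
      using germ_stable_point that(1) by (simp add: germ_discriminant_def)
    then show ?thesis by (auto simp: N)
  qed
  have vertex: "pt 0 (1 / (2 * c)) \<in> N \<and> pt 0 (1 / (2 * c)) \<noteq> x"
  proof -
    have x: "x = pt 0 0" by (simp add: pt_def)
    have "pt 0 (1 / (2 * c)) \<noteq> pt 0 0" using c by simp
    then show ?thesis unfolding N x[symmetric] by blast
  qed
  obtain F where F: "\<forall>\<^sub>F t in at 0. focal_points \<gamma> t (vector_derivative \<gamma> (at t)) = {F t}"
    "q < 2 * p \<Longrightarrow> (F \<longlongrightarrow> x) (at 0)" "q = 2 * p \<Longrightarrow> (F \<longlongrightarrow> pt 0 (1 / (2 * c))) (at 0)"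
    "q > 2 * p \<Longrightarrow> filterlim F at_infinity (at 0) \<and> ((\<lambda>t. infdist (F t) N) \<longlongrightarrow> 0) (at 0)"
    using focal_limit assms(16) by blast
  show ?thesis
    unfolding \<rho>
  proof (intro conjI)
    show "(odd p \<and> odd q \<and> q < 2 * p) \<or> even p \<longrightarrow> N \<subseteq> tED_discriminant \<Phi>" using gain by blast
    show "\<exists>F. (\<forall>\<^sub>F t in at 0. focal_points \<gamma> t (vector_derivative \<gamma> (at t)) = {F t}) \<and>
       (q < 2 * p \<longrightarrow> (F \<longlongrightarrow> x) (at 0)) \<and>
       (q = 2 * p \<longrightarrow> (\<exists>w. w \<in> N \<and> w \<noteq> x \<and> focal_points \<gamma> 0 e1 = {w} \<and> (F \<longlongrightarrow> w) (at 0))) \<and>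
       (q > 2 * p \<longrightarrow> filterlim F at_infinity (at 0) \<and> ((\<lambda>t. infdist (F t) N) \<longlongrightarrow> 0) (at 0))"
    proof (intro exI[of _ F] conjI impI)
      assume q: "q = 2 * p"
      show "\<exists>w. w \<in> N \<and> w \<noteq> x \<and> focal_points \<gamma> 0 e1 = {w} \<and> (F \<longlongrightarrow> w) (at 0)"
        by (rule exI[of _ "pt 0 (1 / (2 * c))"]) (use vertex F(3)[OF q] q in \<open>simp add: focal_points_0\<close>)
    qed (use F in simp_all)
    show "odd p \<and> odd q \<and> q < 2 * p \<longrightarrow> N \<subseteq> germ_discriminant \<gamma>" "even p \<longrightarrow> N \<subseteq> germ_discriminant \<gamma>"
      using germ by blast+
    show "odd p \<and> odd q \<and> q > 2 * p \<longrightarrow> \<not> N \<subseteq> germ_discriminant \<gamma>"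
      "odd p \<and> even q \<longrightarrow> \<not> N \<subseteq> germ_discriminant \<gamma>" using stable by blast+
    show "q < 2 * p \<longrightarrow> focal_points \<gamma> 0 e1 = {x}" "q > 2 * p \<longrightarrow> focal_points \<gamma> 0 e1 = {}"
      by (auto simp: focal_points_0)
    show "q = 2 * p \<longrightarrow> (\<exists>w. w \<in> N \<and> w \<noteq> x \<and> focal_points \<gamma> 0 e1 = {w})"
    proof
      assume q: "q = 2 * p"
      show "\<exists>w. w \<in> N \<and> w \<noteq> x \<and> focal_points \<gamma> 0 e1 = {w}"
        by (rule exI[of _ "pt 0 (1 / (2 * c))"]) (use vertex q in \<open>simp add: focal_points_0\<close>)
    qed
  qed (unfold h, intro allI impI, elim conjE, rule crossing_list, assumption+)
qed

end
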